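(* Let $\Phi_n$ be an $n\times n$ matrix-valued tempered distribution satisfying $$P(-i\omega)\widehat{\Phi}_n(\omega)P^*(-i\omega)=P(-i\omega)G^\dagger(-i\omega)P^*(-i\omega),\qquad \omega\ne0,$$ and let $$\mathbb{K}_{\ell,k,m,n,h}=I_{m\times m}\psi_{\ell,k,h}-(P(D)\Phi_n)*(P^T(-D)\psi_{\ell,k,h}),$$ i.e. the $m\times m$ matrix-valued kernel with Fourier transform $\widehat{\mathbb{K}}_{\ell,k,m,n,h}(\omega)=\mathbb{P}(\omega)\widehat{\psi}_{\ell,k,h}(\omega)$. Then every column of $\mathbb{K}_{\ell,k,m,n,h}$ satisfies the constraints: for all $1\le l\le n$, $$P_l(-D)\cdot\mathbb{K}_{\ell,k,m,n,h}=P_l^T(-D)\,\mathbb{K}_{\ell,k,m,n,h}=0$$ (the zero row vector of length $m$).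
   Context: Operators. Let $d,m,n$ be positive integers. For $1\le l\le n$ let $P_l(D)=\sum_{|\alpha|\le r_l}\gamma_l^\alpha D^\alpha$ be an $m\times1$ column vector of linear differential operators on $\mathbb{R}^d$ of order $r_l$ with constant coefficients $\gamma_l^\alpha\in\mathbb{R}^m$, with $P_1,\dots,P_n$ linearly independent; $P_l(-D)=\sum(-1)^{|\alpha|}\gamma_l^\alpha D^\alpha$ and $P_l(\pm i\omega)=\sum\gamma_l^\alpha(\pm i\omega)^\alpha$. Let $P(D)=[P_1(D),\dots,P_n(D)]$ ($m\times n$), $P(-i\omega)=[P_1(-i\omega),\dots,P_n(-i\omega)]\in\mathbb{C}^{m\times n}$, $P^*(-i\omega)=P(i\omega)^T$ its Hermitian conjugate, $G(-i\omega)=P^*(-i\omega)P(-i\omega)$, $G^\dagger$ the Moore--Penrose pseudo-inverse of $G$, and $\mathbb{P}(\omega)=I_{m\times m}-P(-i\omega)G^\dagger(-i\omega)P^*(-i\omega)$. Fourier transform. $\widehat f(\omega)=\int_{\mathbb{R}^d}f(x)e^{i\omega\cdot x}\,dx$, extended to tempered distributions and applied entrywise; thus $D^\alpha$ has symbol $(-i\omega)^\alpha$ and $\widehat{f*g}=\widehat f\,\widehat g$. Convolution of matrix-valued functions is the matrix product with entries multiplied by convolution. Spline. Let $1\le k\le\ell$ be integers with $2\ell\ge d+1$, and $h>0$. Let $\phi_\ell$ be the thin plate spline, the fundamental solution $\Delta^\ell\phi_\ell=\delta$ given by $\phi_\ell(x)=E_{\ell,d}\|x\|^{2\ell-d}$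 for $d$ odd and $\phi_\ell(x)=E_{\ell,d}\|x\|^{2\ell-d}\ln\|x\|$ for $d$ even, with $E_{\ell,d}=\Gamma(d/2)\big/\big(2^\ell\pi^{d/2}(\ell-1)!\prod_{j=0,\,j\ne\ell-d/2}^{\ell-1}(2\ell-2j-d)\big)$. Let $(\widetilde{\Delta_h})_jf(x)=f(x-he_j)-2f(x)+f(x+he_j)$, $j=1,\dots,d$, and $a_i=(-1)^i2(i!)^2/(2i+2)!$. Let $p_{d,\ell,k}(t_1,\dots,t_d)=\big(\sum_{i=0}^{k-1}a_i\sum_{j=1}^dt_j^{i+1}\big)^\ell$ and let $q_{d,\ell,k}$ be its truncation of order $\ell+k$ (the sum of its monomials of total degree at most $\ell+k$). The $h$-embedded level-$k\ell$-type polyharmonic spline is $\psi_{\ell,k,h}(x)=h^{-2\ell}q_{d,\ell,k}(\widetilde{\Delta_h})\phi_\ell(x)$, where $t_j$ is replaced by $(\widetilde{\Delta_h})_j$. *)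

theory Defs
  imports "HOL-Analysis.Analysis" "HOL-Library.Poly_Mapping"
begin

section \<open>Partial derivatives, test functions, tempered distributions\<close>

text \<open>An arbitrary but fixed listing of the coordinates.  It only serves to write compositions of
  commuting operators (partial derivatives of smooth functions, difference operators).\<close>

definition coords :: "'d::finite list" where
  "coords = (SOME xs. distinct xs \<and> set xs = UNIV)"

definition partial :: "'d::finite \<Rightarrow> (real^'d \<Rightarrow> complex) \<Rightarrow> real^'d \<Rightarrow> complex" where
  "partial j f x = vector_derivative (\<lambda>t. f (x + t *\<^sub>R axis j 1)) (at 0)"

definition partials :: "'d::finite list \<Rightarrow> (real^'d \<Rightarrow> complex) \<Rightarrow> real^'d \<Rightarrow> complex" where
  "partials js f = foldr partial js f"

definition mi_size :: "('d::finite \<Rightarrow> nat) \<Rightarrow> nat" where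
  "mi_size \<alpha> = (\<Sum>j\<in>UNIV. \<alpha> j)"

definition mi_deriv :: "('d::finite \<Rightarrow> nat) \<Rightarrow> (real^'d \<Rightarrow> complex) \<Rightarrow> real^'d \<Rightarrow> complex" where
  "mi_deriv \<alpha> f = foldr (\<lambda>j. partial j ^^ \<alpha> j) coords f"

text \<open>Infinite differentiability, for an open set \<open>S\<close>.\<close>

definition smooth_on :: "(real^'d::finite) set \<Rightarrow> (real^'d \<Rightarrow> complex) \<Rightarrow> bool" where
  "smooth_on S f \<longleftrightarrow> (\<forall>js. \<forall>x\<in>S. partials js f differentiable (at x))"

definition schwartz :: "(real^'d::finite \<Rightarrow> complex) set" where
  "schwartz = {f. smooth_on UNIV f \<and>
     (\<forall>N js. \<exists>C. \<forall>x. norm x ^ N * norm (partials js f x) \<le> C)}"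

definition test_on :: "(real^'d::finite) set \<Rightarrow> (real^'d \<Rightarrow> complex) set" where
  "test_on S = {f. smooth_on UNIV f \<and> compact (closure {x. f x \<noteq> 0}) \<and> closure {x. f x \<noteq> 0} \<subseteq> S}"

text \<open>A distribution is a functional of which only the values on \<open>schwartz\<close> matter.  The second
  clause is continuity: \<open>T\<close> is bounded by one of the Schwartz norms.\<close>

type_synonym 'd distr = "(real^'d \<Rightarrow> complex) \<Rightarrow> complex"

definition tempered :: "'d::finite distr \<Rightarrow> bool" where
  "tempered T \<longleftrightarrow>
     (\<forall>f\<in>schwartz. \<forall>g\<in>schwartz. \<forall>a b. T (\<lambda>x. a * f x + b * g x) = a * T f + b * T g) \<and>
     (\<exists>C N. \<forall>f\<in>schwartz. \<forall>M.
        (\<forall>js x. length js \<le> N \<longrightarrow> (1 + norm x) ^ N * norm (partials js f x) \<le> M)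
        \<longrightarrow> norm (T f) \<le> C * M)"

definition of_fun :: "(real^'d::finite \<Rightarrow> complex) \<Rightarrow> 'd distr" where
  "of_fun g f = (LINT x|lborel. g x * f x)"

text \<open>\<open>is_fun T g\<close>: the tempered distribution \<open>T\<close> is the (locally integrable) function \<open>g\<close>;
  \<open>is_fun_on S T g\<close>: its restriction to the open set \<open>S\<close> is \<open>g\<close>.\<close>

definition is_fun :: "'d::finite distr \<Rightarrow> (real^'d \<Rightarrow> complex) \<Rightarrow> bool" where
  "is_fun T g \<longleftrightarrow> (\<forall>f\<in>schwartz. integrable lborel (\<lambda>x. g x * f x) \<and> T f = of_fun g f)"

definition is_fun_on :: "(real^'d::finite) set \<Rightarrow> 'd distr \<Rightarrow> (real^'d \<Rightarrow> complex) \<Rightarrow> bool" where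
  "is_fun_on S T g \<longleftrightarrow> (\<forall>f\<in>test_on S. integrable lborel (\<lambda>x. g x * f x) \<and> T f = of_fun g f)"

definition fourier :: "(real^'d::finite \<Rightarrow> complex) \<Rightarrow> real^'d \<Rightarrow> complex" where
  "fourier f \<omega> = (LINT x|lborel. f x * exp (\<i> * complex_of_real (\<omega> \<bullet> x)))"

definition ft :: "'d::finite distr \<Rightarrow> 'd distr" where
  "ft T f = T (fourier f)"

definition D_distr :: "('d::finite \<Rightarrow> nat) \<Rightarrow> 'd distr \<Rightarrow> 'd distr" where
  "D_distr \<alpha> T f = (-1) ^ mi_size \<alpha> * T (mi_deriv \<alpha> f)"

text \<open>The scalar operator \<open>\<Sum>\<^bsub>|\<alpha>| \<le> r\<^esub> c\<^sup>\<alpha> (s D)\<^sup>\<alpha>\<close>, used with \<open>s = 1\<close> and \<open>s = -1\<close>.\<close>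

definition diff_op :: "nat \<Rightarrow> (('d::finite \<Rightarrow> nat) \<Rightarrow> real) \<Rightarrow> real \<Rightarrow> 'd distr \<Rightarrow> 'd distr" where
  "diff_op r c s T f =
     (\<Sum>\<alpha> | mi_size \<alpha> \<le> r. complex_of_real (c \<alpha> * s ^ mi_size \<alpha>) * D_distr \<alpha> T f)"


section \<open>The operators \<open>P\<^sub>l\<close> and their symbols\<close>

text \<open>The column operator \<open>P\<^sub>l(D)\<close> is given by \<open>r l\<close> and \<open>\<gamma> l \<alpha>\<close>, for \<open>|\<alpha>| \<le> r l\<close>; its \<open>i\<close>-th
  component has the coefficients \<open>\<lambda>\<alpha>. \<gamma> l \<alpha> $ i\<close>.  Values \<open>\<gamma> l \<alpha>\<close> with \<open>|\<alpha>| > r l\<close> are junk.\<close>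

definition ops_independent ::
    "('n::finite \<Rightarrow> nat) \<Rightarrow> ('n \<Rightarrow> ('d::finite \<Rightarrow> nat) \<Rightarrow> real^'m::finite) \<Rightarrow> bool" where
  "ops_independent r \<gamma> \<longleftrightarrow>
     (\<forall>c::'n \<Rightarrow> real. (\<forall>\<alpha>. (\<Sum>l\<in>UNIV. c l *\<^sub>R (if mi_size \<alpha> \<le> r l then \<gamma> l \<alpha> else 0)) = 0)
        \<longrightarrow> (\<forall>l. c l = 0))"

text \<open>\<open>Psym r \<gamma> \<omega>\<close> is the matrix \<open>P(-i\<omega>)\<close>.\<close>

definition Psym :: "('n::finite \<Rightarrow> nat) \<Rightarrow> ('n \<Rightarrow> ('d::finite \<Rightarrow> nat) \<Rightarrow> real^'m::finite)
    \<Rightarrow> real^'d \<Rightarrow> complex^'n^'m" where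
  "Psym r \<gamma> \<omega> = (\<chi> i l. \<Sum>\<alpha> | mi_size \<alpha> \<le> r l.
     complex_of_real (\<gamma> l \<alpha> $ i) * (\<Prod>j\<in>UNIV. (- \<i> * complex_of_real (\<omega> $ j)) ^ \<alpha> j))"

definition adj :: "complex^'b::finite^'a::finite \<Rightarrow> complex^'a^'b" where
  "adj A = (\<chi> i j. cnj (A $ j $ i))"

text \<open>Moore--Penrose pseudo-inverse, by the four Penrose equations.\<close>

definition pinv :: "complex^'b::finite^'a::finite \<Rightarrow> complex^'a^'b" where
  "pinv A = (THE X. A ** X ** A = A \<and> X ** A ** X = X \<and>
     adj (A ** X) = A ** X \<and> adj (X ** A) = X ** A)"

definition Gsym :: "('n::finite \<Rightarrow> nat) \<Rightarrow> ('n \<Rightarrow> ('d::finite \<Rightarrow> nat) \<Rightarrow> real^'m::finite)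
    \<Rightarrow> real^'d \<Rightarrow> complex^'n^'n" where
  "Gsym r \<gamma> \<omega> = adj (Psym r \<gamma> \<omega>) ** Psym r \<gamma> \<omega>"

definition PGP :: "('n::finite \<Rightarrow> nat) \<Rightarrow> ('n \<Rightarrow> ('d::finite \<Rightarrow> nat) \<Rightarrow> real^'m::finite)
    \<Rightarrow> real^'d \<Rightarrow> complex^'m^'m" where
  "PGP r \<gamma> \<omega> = Psym r \<gamma> \<omega> ** pinv (Gsym r \<gamma> \<omega>) ** adj (Psym r \<gamma> \<omega>)"

definition Proj :: "('n::finite \<Rightarrow> nat) \<Rightarrow> ('n \<Rightarrow> ('d::finite \<Rightarrow> nat) \<Rightarrow> real^'m::finite)
    \<Rightarrow> real^'d \<Rightarrow> complex^'m^'m" where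
  "Proj r \<gamma> \<omega> = mat 1 - PGP r \<gamma> \<omega>"


section \<open>Matrices of distributions\<close>

type_synonym ('d, 'a, 'b) mdistr = "'a \<Rightarrow> 'b \<Rightarrow> 'd distr"

definition fmult :: "(real^'d::finite \<Rightarrow> complex) \<Rightarrow> 'd distr \<Rightarrow> 'd distr" where
  "fmult v T f = T (\<lambda>\<omega>. v \<omega> * f \<omega>)"

text \<open>\<open>P(D) \<Phi>\<close> and \<open>P\<^sup>T(-D) (I u)\<close>, the latter for a scalar distribution \<open>u\<close>.\<close>

definition P_left :: "('n::finite \<Rightarrow> nat) \<Rightarrow> ('n \<Rightarrow> ('d::finite \<Rightarrow> nat) \<Rightarrow> real^'m::finite)
    \<Rightarrow> ('d, 'n, 'n) mdistr \<Rightarrow> ('d, 'm, 'n) mdistr" where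
  "P_left r \<gamma> \<Phi> i k f = (\<Sum>l\<in>UNIV. diff_op (r l) (\<lambda>\<alpha>. \<gamma> l \<alpha> $ i) 1 (\<Phi> l k) f)"

definition PT_minus :: "('n::finite \<Rightarrow> nat) \<Rightarrow> ('n \<Rightarrow> ('d::finite \<Rightarrow> nat) \<Rightarrow> real^'m::finite)
    \<Rightarrow> 'd distr \<Rightarrow> ('d, 'n, 'm) mdistr" where
  "PT_minus r \<gamma> u l j = diff_op (r l) (\<lambda>\<alpha>. \<gamma> l \<alpha> $ j) (-1) u"

text \<open>\<open>P(-i\<omega>) F P\<^sup>*(-i\<omega>)\<close> for a matrix \<open>F\<close> of distributions.\<close>

definition P_sandwich :: "('n::finite \<Rightarrow> nat) \<Rightarrow> ('n \<Rightarrow> ('d::finite \<Rightarrow> nat) \<Rightarrow> real^'m::finite)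
    \<Rightarrow> ('d, 'n, 'n) mdistr \<Rightarrow> ('d, 'm, 'm) mdistr" where
  "P_sandwich r \<gamma> F i j f =
     (\<Sum>k\<in>UNIV. \<Sum>l\<in>UNIV. fmult (\<lambda>\<omega>. Psym r \<gamma> \<omega> $ i $ k * adj (Psym r \<gamma> \<omega>) $ l $ j) (F k l) f)"

text \<open>\<open>C = A * B\<close> through the exchange formula: the Fourier transform of \<open>C\<close> is the matrix product
  of those of \<open>A\<close> and \<open>B\<close>.  The product of distributions is the product of a distribution and a
  smooth function, the Fourier transform of \<open>B\<close> being a smooth function \<open>v\<close> for \<open>\<omega> \<noteq> 0\<close>
  (here \<open>B\<close> comes from a polyharmonic spline, whose Fourier transform is smooth away from the
  origin only).  This determines \<open>C\<close> up to terms whose Fourier transform is supported at the origin,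
  i.e. up to polynomials, which are to be excluded separately.\<close>

definition is_conv :: "('d::finite, 'a, 'k::finite) mdistr \<Rightarrow> ('d, 'k, 'b) mdistr
    \<Rightarrow> ('d, 'a, 'b) mdistr \<Rightarrow> bool" where
  "is_conv A B C \<longleftrightarrow> (\<exists>v.
     (\<forall>k j. smooth_on (- {0}) (v k j) \<and> is_fun_on (- {0}) (ft (B k j)) (v k j)) \<and>
     (\<forall>i j. \<forall>f\<in>test_on (- {0}). ft (C i j) f = (\<Sum>k\<in>UNIV. fmult (v k j) (ft (A i k)) f)))"


section \<open>Polyharmonic splines\<close>

definition tps_const :: "nat \<Rightarrow> nat \<Rightarrow> real" where
  "tps_const d L = Gamma (real d / 2) /
     (2 ^ L * pi powr (real d / 2) * fact (L - 1) *
      (\<Prod>j \<in> {j \<in> {0..<L}. real j \<noteq> real L - real d / 2}. 2 * real L - 2 * real j - real d))"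

text \<open>Only used with \<open>2L > d\<close>, so the exponent is a true difference, and the value at \<open>0\<close> is \<open>0\<close>.\<close>

definition tps :: "nat \<Rightarrow> real^'d::finite \<Rightarrow> real" where
  "tps L x = tps_const CARD('d) L * norm x ^ (2 * L - CARD('d)) *
     (if odd CARD('d) then 1 else ln (norm x))"

definition cdiff :: "real \<Rightarrow> 'd::finite \<Rightarrow> (real^'d \<Rightarrow> real) \<Rightarrow> real^'d \<Rightarrow> real" where
  "cdiff h j f x = f (x - h *\<^sub>R axis j 1) - 2 * f x + f (x + h *\<^sub>R axis j 1)"

text \<open>Real polynomials in the variables \<open>t\<^sub>j\<close>, \<open>j :: 'd\<close>, as finitely supported maps from monomials
  to coefficients.\<close>

type_synonym 'd rpoly = "('d \<Rightarrow>\<^sub>0 nat) \<Rightarrow>\<^sub>0 real"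

definition tvar :: "'d \<Rightarrow> 'd rpoly" where
  "tvar j = Poly_Mapping.single (Poly_Mapping.single j 1) 1"

definition tconst :: "real \<Rightarrow> 'd rpoly" where
  "tconst c = Poly_Mapping.single 0 c"

definition truncate :: "nat \<Rightarrow> 'd::finite rpoly \<Rightarrow> 'd rpoly" where
  "truncate N p = (\<Sum>\<mu> | \<mu> \<in> Poly_Mapping.keys p \<and> mi_size (Poly_Mapping.lookup \<mu>) \<le> N.
     Poly_Mapping.single \<mu> (Poly_Mapping.lookup p \<mu>))"

definition a_coeff :: "nat \<Rightarrow> real" where
  "a_coeff i = (-1) ^ i * 2 * (fact i)\<^sup>2 / fact (2 * i + 2)"

definition p_poly :: "nat \<Rightarrow> nat \<Rightarrow> 'd::finite rpoly" where
  "p_poly L k = (\<Sum>i<k. tconst (a_coeff i) * (\<Sum>j\<in>UNIV. tvar j ^ (i + 1))) ^ L"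

definition q_poly :: "nat \<Rightarrow> nat \<Rightarrow> 'd::finite rpoly" where
  "q_poly L k = truncate (L + k) (p_poly L k)"

definition poly_cdiff :: "'d::finite rpoly \<Rightarrow> real \<Rightarrow> (real^'d \<Rightarrow> real) \<Rightarrow> real^'d \<Rightarrow> real" where
  "poly_cdiff p h f x =
     (\<Sum>\<mu>\<in>Poly_Mapping.keys p. Poly_Mapping.lookup p \<mu> * foldr (\<lambda>j. cdiff h j ^^ Poly_Mapping.lookup \<mu> j) coords f x)"

definition spline :: "nat \<Rightarrow> nat \<Rightarrow> real \<Rightarrow> real^'d::finite \<Rightarrow> real" where
  "spline L k h x = poly_cdiff (q_poly L k) h (tps L) x / h ^ (2 * L)"

definition spline_distr :: "nat \<Rightarrow> nat \<Rightarrow> real \<Rightarrow> 'd::finite distr" where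
  "spline_distr L k h = of_fun (\<lambda>x. complex_of_real (spline L k h x))"

end

theory Submission
  imports Defs
begin

text \<open>On the frequency side the theorem is linear algebra at each point: the transform of the kernel is the
  projection \<open>I - P G\<^sup>\<dagger> P\<^sup>*\<close> times the scalar transform of the spline, and \<open>P\<^sup>*\<close> annihilates this projection.
  The work lies in justifying pointwise statements for objects that are given as distributions.

  Off the origin, the factors \<open>v\<^sub>k\<^sub>j\<close> of the convolution represent \<open>P\<^sup>*\<^sub>k\<^sub>j\<close> times the transform of the spline, but
  that transform itself is not known to be a function there, and dividing by \<open>P\<^sup>*\<^sub>k\<^sub>j\<close> is impossible at its zeros.
  Division is avoided by testing only against multiples \<open>P\<^sup>*\<^sub>k\<^sub>j f\<close> of test functions.  The factors \<open>v\<close> are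
  proportional to the entries of \<open>P\<^sup>*\<close> (\<open>convolution_factors_proportional\<close>), and the hypothesis on \<open>\<Phi>\<close> then
  gives \<open>\<kappa>\<^sub>a\<^sub>b P\<^sup>*\<^sub>k\<^sub>j = (I - P G\<^sup>\<dagger> P\<^sup>*)\<^sub>a\<^sub>b v\<^sub>k\<^sub>j\<close> almost everywhere for the functions \<open>\<kappa>\<^sub>a\<^sub>b\<close> that represent the transform of the
  kernel (\<open>kernel_transform_times_symbol\<close>).  Some entry of \<open>P\<^sup>*\<close> is a nonzero polynomial, by linear independence
  of the operators, so it can be cancelled almost everywhere (\<open>AE_polynomial_nonzero\<close>).

  If the transform of the spline is a function, the same cancellation identifies \<open>\<kappa>\<^sub>a\<^sub>b\<close> with the claimed
  product.  Without that assumption, multiplying the identity by \<open>P\<^sup>*\<close> from the left still gives \<open>P\<^sup>* \<kappa> = 0\<close> almost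
  everywhere (\<open>adj_P_Proj\<close>).  Since the transform of the kernel is a function, nothing can be concentrated at
  the origin, and the operators \<open>P\<^sub>l(-D)\<close> applied to the kernel have transform \<open>P\<^sup>* \<kappa>\<close>.  They are evaluated on an
  arbitrary Schwartz function by writing it as a Fourier transform (\<open>fourier_surjective\<close>).

  Three ingredients carry the passage between distributions and functions: bump functions with the
  fundamental lemma of the calculus of variations (\<open>AE_zero_if_test_integrals_zero\<close>), the Fourier transform
  as a bijection of the Schwartz space, obtained from a Gaussian approximate identity
  (\<open>fourier_inversion\<close>), and the exchange of derivatives and multiplications on test functions
  (\<open>diff_op_fourier\<close>).\<close>

section \<open>Moore--Penrose inverses of Hermitian matrices\<close>

lemma adj_mult: "adj (A ** B) = adj B ** adj A"
  by (vector adj_def matrix_matrix_mult_def) (simp add: mult.commute)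

lemma adj_adj [simp]: "adj (adj A) = A"
  by (vector adj_def)

lemma matrix_mult_0_left: "0 ** A = (0 :: complex^'n::finite^'m::finite)"
  by (vector matrix_matrix_mult_def)

lemma matrix_mult_0_right: "A ** 0 = (0 :: complex^'n::finite^'m::finite)"
  by (vector matrix_matrix_mult_def)

text \<open>The diagonal entries of \<open>A\<^sup>* A\<close> are the squared norms of the columns of \<open>A\<close>.\<close>
lemma matrix_eq_0_if_adj_mult_eq_0:
  assumes "adj A ** A = 0"
  shows "A = 0"
proof -
  have "A $ i $ j = 0" for i j
  proof -
    have "(\<Sum>k\<in>UNIV. cnj (A $ k $ j) * A $ k $ j) = 0"
      using assms by (simp add: vec_eq_iff adj_def matrix_matrix_mult_def)
    then have "complex_of_real (\<Sum>k\<in>UNIV. (norm (A $ k $ j))\<^sup>2) = 0"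
      unfolding of_real_sum complex_norm_square by (simp add: mult.commute)
    then have "(\<Sum>k\<in>UNIV. (norm (A $ k $ j))\<^sup>2) = 0"
      by (simp only: of_real_eq_0_iff)
    then show ?thesis
      by (subst (asm) sum_nonneg_eq_0_iff) auto
  qed
  then show ?thesis
    by (simp add: vec_eq_iff)
qed

text \<open>A Hermitian matrix is injective on its own range, because \<open>(A Z)\<^sup>* (A Z) = Z\<^sup>* (A A Z)\<close>. Cancelling
  repeated factors in this way takes the place of a spectral decomposition.\<close>
lemma hermitian_cancel:
  assumes "adj A = A" and "A ** (A ** Z) = 0"
  shows "A ** Z = 0"
proof (rule matrix_eq_0_if_adj_mult_eq_0)
  have "adj (A ** Z) ** (A ** Z) = adj Z ** (A ** (A ** Z))"
    by (simp add: adj_mult assms(1) matrix_mul_assoc)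
  then show "adj (A ** Z) ** (A ** Z) = 0"
    by (simp only: assms(2) matrix_mult_0_right)
qed

text \<open>Any linear section of \<open>A\<close> over its range will do; the choice is far from canonical.\<close>
lemma generalized_inverse_exists:
  fixes A :: "complex^'n::finite^'n"
  obtains X where "A ** X ** A = A"
proof -
  obtain g where g: "Vector_Spaces.linear (*s) (*s) g" "\<And>x. A *v (g (A *v x)) = A *v x"
    using vec.linear_exists_right_inverse_on[OF matrix_vector_mul_linear_gen vec.subspace_UNIV, of A]
    by auto
  have "A ** matrix g ** A = A"
    by (simp add: matrix_eq matrix_vector_mul_assoc[symmetric] matrix_works[OF g(1)] g(2))
  then show thesis by (rule that)
qed

lemma matrix_minus_right: "A ** (B - C) = A ** B - A ** (C :: complex^'n::finite^'m::finite)"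
  by (vector matrix_matrix_mult_def) (simp add: algebra_simps sum_subtractf)

lemma matrix_minus_left: "(B - C) ** A = B ** A - (C :: complex^'n::finite^'m::finite) ** A"
  by (vector matrix_matrix_mult_def) (simp add: algebra_simps sum_subtractf)

lemma adj_minus: "adj (A - B) = adj A - adj B"
  by (vector adj_def)

text \<open>If \<open>X\<close> is any inner inverse of \<open>A\<^sup>3\<close>, then \<open>A X A\<close> is the pseudo-inverse of \<open>A\<close>.  Cancelling
  Hermitian factors turns \<open>A\<^sup>3 X A\<^sup>3 = A\<^sup>3\<close> into \<open>A\<^sup>3 X A = A\<close> and \<open>A\<^sup>2 X A\<^sup>2 = A\<close>, and all four Penrose
  equations are products of these two with other matrices.\<close>
lemma hermitian_penrose_exists:
  fixes A :: "complex^'n::finite^'n"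
  assumes h: "adj A = A"
  shows "\<exists>Y. A ** Y ** A = A \<and> Y ** A ** Y = Y \<and> adj (A ** Y) = A ** Y \<and> adj (Y ** A) = Y ** A"
proof -
  note assoc = matrix_mul_assoc
  obtain X where X: "(A ** A ** A) ** X ** (A ** A ** A) = A ** A ** A"
    by (rule generalized_inverse_exists)
  have cancel: "A ** Z = A ** W" if "A ** (A ** Z) = A ** (A ** W)" for Z W :: "complex^'n^'n"
    using hermitian_cancel[OF h, of "Z - W"] that by (simp only: matrix_minus_right right_minus_eq)
  have X': "A ** (A ** (A ** adj X ** A ** A ** A)) = A ** (A ** A)"
    using arg_cong[OF X, of adj] by (simp add: adj_mult h assoc)
  have "A ** (A ** adj X ** A ** A ** A) = A ** A"
    using cancel[OF X'] .
  then have "A ** (A ** (adj X ** A ** A ** A)) = A ** (A ** mat 1)"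
    by (simp add: assoc)
  from cancel[OF this] have "A ** adj X ** A ** A ** A = A"
    by (simp add: assoc)
  from arg_cong[OF this, of adj] have H1: "A ** A ** A ** X ** A = A"
    by (simp add: adj_mult h assoc)
  have "A ** (A ** (A ** X ** A ** A)) = A ** (A ** mat 1)"
    using arg_cong[OF H1, of "\<lambda>M. M ** A"] by (simp add: assoc)
  from cancel[OF this] have H2: "A ** A ** X ** A ** A = A"
    by (simp add: assoc)
  \<comment> \<open>A matrix of the form \<open>N N\<^sup>*\<close> is Hermitian; here \<open>N\<close> is \<open>M\<close> or its adjoint.\<close>
  have herm: "adj M = M" if "adj M = M ** adj M \<or> adj M = adj M ** M" for M :: "complex^'n^'n"
    using that by (metis adj_adj adj_mult)
  let ?Y = "A ** X ** A"
  have "A ** ?Y ** A = A" using H2 by (simp add: assoc)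
  moreover have "?Y ** A ** ?Y = ?Y"
    using arg_cong[OF H1, of "\<lambda>M. A ** X ** M"] by (simp add: assoc)
  moreover have "adj (A ** ?Y) = A ** ?Y"
    using arg_cong[OF H2, of "\<lambda>M. M ** adj X ** A ** A"] by (intro herm) (simp add: adj_mult h assoc)
  moreover have "adj (?Y ** A) = ?Y ** A"
    using arg_cong[OF H2, of "\<lambda>M. A ** A ** adj X ** M"] by (intro herm) (simp add: adj_mult h assoc)
  ultimately show ?thesis by blast
qed

text \<open>Taking the adjoint of \<open>A X = (A Y) (A X)\<close> interchanges the two factors, so \<open>A X = (A X) (A Y) = A Y\<close>;
  likewise \<open>X A = Y A\<close>, and \<open>X = X A X\<close> depends only on these products.\<close>
lemma penrose_unique:
  fixes A :: "complex^'n::finite^'n"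
  assumes X: "A ** X ** A = A" "X ** A ** X = X" "adj (A ** X) = A ** X" "adj (X ** A) = X ** A"
    and Y: "A ** Y ** A = A" "Y ** A ** Y = Y" "adj (A ** Y) = A ** Y" "adj (Y ** A) = Y ** A"
  shows "X = Y"
proof -
  have "A ** X = adj (A ** Y ** A ** X)" by (simp add: X Y)
  also have "\<dots> = adj (A ** X) ** adj (A ** Y)" by (simp add: adj_mult matrix_mul_assoc)
  also have "\<dots> = A ** Y" by (simp add: X(1,3) Y(3) matrix_mul_assoc)
  finally have 1: "A ** X = A ** Y" .
  have "X ** A = adj (X ** (A ** Y ** A))" by (simp add: X Y)
  also have "\<dots> = adj (Y ** A) ** adj (X ** A)" by (simp add: adj_mult matrix_mul_assoc)
  also have "\<dots> = Y ** (A ** X ** A)" by (simp add: X(4) Y(4) matrix_mul_assoc)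
  also have "\<dots> = Y ** A" by (simp add: X(1))
  finally have 2: "X ** A = Y ** A" .
  show ?thesis using X(2) Y(2) 1 2 by (metis matrix_mul_assoc)
qed

text \<open>Existence and uniqueness make the definite description in the definition of the pseudo-inverse
  denote, so that its defining equations become available.\<close>
lemma pinv_hermitian:
  fixes A :: "complex^'n::finite^'n"
  assumes "adj A = A"
  shows "A ** pinv A ** A = A"
proof -
  have "\<exists>!Y. A ** Y ** A = A \<and> Y ** A ** Y = Y \<and> adj (A ** Y) = A ** Y \<and> adj (Y ** A) = Y ** A"
    using hermitian_penrose_exists[OF assms] penrose_unique[of A] by blast
  from theI'[OF this] show ?thesis by (simp add: pinv_def)
qed

text \<open>The projection annihilates the range of \<open>P\<close>, that is \<open>G G\<^sup>\<dagger> P\<^sup>* = P\<^sup>*\<close>.  The difference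
  \<open>M = P\<^sup>* - G G\<^sup>\<dagger> P\<^sup>*\<close> satisfies \<open>M P = G - G G\<^sup>\<dagger> G = 0\<close>, and \<open>M M\<^sup>*\<close> is a right multiple of \<open>M P\<close>.\<close>
lemma adj_P_Proj: "adj (Psym r \<gamma> \<omega>) ** Proj r \<gamma> \<omega> = 0"
proof -
  let ?P = "Psym r \<gamma> \<omega>" and ?G = "Gsym r \<gamma> \<omega>"
  define M where "M = adj ?P - ?G ** pinv ?G ** adj ?P"
  have G: "adj ?P ** ?P = ?G" "adj ?G = ?G" by (simp_all add: Gsym_def adj_mult)
  have "M ** ?P = ?G - ?G ** pinv ?G ** ?G"
    by (simp add: M_def matrix_minus_left G matrix_mul_assoc[symmetric])
  then have MP: "M ** ?P = 0" by (simp add: pinv_hermitian[OF G(2)])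
  have "adj (adj M) ** adj M = (M ** ?P) ** (mat 1 - adj (?G ** pinv ?G))"
    unfolding M_def by (simp add: adj_minus adj_mult matrix_minus_right matrix_mul_assoc)
  then have "adj (adj M) ** adj M = 0" by (simp only: MP matrix_mult_0_left)
  then have "adj M = 0" by (rule matrix_eq_0_if_adj_mult_eq_0)
  then have "adj (adj M) = adj 0" by simp
  then have "M = 0" by (simp add: adj_def vec_eq_iff)
  then show ?thesis
    by (simp add: M_def Proj_def PGP_def matrix_minus_right matrix_mul_assoc G)
qed

section \<open>Zero sets of polynomials\<close>

lemma infinite_not_root:
  fixes S :: "'a::idom set"
  assumes "infinite S" "finite I" "\<And>i. i \<in> I \<Longrightarrow> q i \<noteq> 0"
  obtains x where "x \<in> S" "\<And>i. i \<in> I \<Longrightarrow> poly (q i) x \<noteq> 0"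
proof -
  have "finite (\<Union>i\<in>I. {x. poly (q i) x = 0})"
    using assms by (auto intro: poly_roots_finite)
  then obtain x where "x \<in> S" "x \<notin> (\<Union>i\<in>I. {x. poly (q i) x = 0})"
    using assms(1) by (meson finite_subset subsetI)
  then show thesis by (intro that[of x]) auto
qed

text \<open>The weights are powers \<open>B\<^bsup>e j\<^esup>\<close> of a natural number.  If two multi-indices \<open>\<alpha> \<noteq> \<beta>\<close> had the same weighted
  sum, \<open>B\<close> would be a root of the nonzero polynomial with coefficients \<open>\<alpha>\<^sub>j - \<beta>\<^sub>j\<close>, which excludes only
  finitely many \<open>B\<close>.\<close>
lemma separating_weights:
  fixes A :: "('d::finite \<Rightarrow> nat) set"
  assumes "finite A"
  obtains w :: "'d \<Rightarrow> nat" where "inj_on (\<lambda>\<alpha>. \<Sum>j\<in>UNIV. w j * \<alpha> j) A"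
proof -
  obtain e :: "'d \<Rightarrow> nat" where e: "inj e"
    using finite_imp_inj_to_nat_seg[of "UNIV :: 'd set"] by auto
  define q :: "('d \<Rightarrow> nat) \<times> ('d \<Rightarrow> nat) \<Rightarrow> real poly" where
    "q = (\<lambda>(\<alpha>, \<beta>). \<Sum>j\<in>UNIV. monom (real (\<alpha> j) - real (\<beta> j)) (e j))"
  have coeff_q: "coeff (q (\<alpha>, \<beta>)) (e i) = real (\<alpha> i) - real (\<beta> i)" for \<alpha> \<beta> i
    unfolding q_def using e by (simp add: coeff_sum inj_eq)
  have q0: "q p \<noteq> 0" if "p \<in> {(\<alpha>, \<beta>). \<alpha> \<in> A \<and> \<beta> \<in> A \<and> \<alpha> \<noteq> \<beta>}" for p
  proof -
    obtain \<alpha> \<beta> where p: "p = (\<alpha>, \<beta>)" by (cases p)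
    with that obtain i where "\<alpha> i \<noteq> \<beta> i" by (auto simp: fun_eq_iff)
    then show ?thesis using coeff_q[of \<alpha> \<beta> i] p by auto
  qed
  have "finite {(\<alpha>, \<beta>). \<alpha> \<in> A \<and> \<beta> \<in> A \<and> \<alpha> \<noteq> \<beta>}"
    by (rule finite_subset[of _ "A \<times> A"]) (use assms in auto)
  then obtain b where b: "b \<in> (\<nat>::real set)"
      "\<And>p. p \<in> {(\<alpha>, \<beta>). \<alpha> \<in> A \<and> \<beta> \<in> A \<and> \<alpha> \<noteq> \<beta>} \<Longrightarrow> poly (q p) b \<noteq> 0"
    using infinite_not_root[of "\<nat> :: real set" _ q, OF Nats_infinite _ q0] by blast
  then obtain B where B: "b = real B" by (auto elim: Nats_cases)
  show thesis
  proof (rule that[of "\<lambda>j. B ^ e j"], rule inj_onI, rule ccontr)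
    fix \<alpha> \<beta> assume *: "\<alpha> \<in> A" "\<beta> \<in> A" "(\<Sum>j\<in>UNIV. B ^ e j * \<alpha> j) = (\<Sum>j\<in>UNIV. B ^ e j * \<beta> j)" "\<alpha> \<noteq> \<beta>"
    have "real (\<Sum>j\<in>UNIV. B ^ e j * \<alpha> j) - real (\<Sum>j\<in>UNIV. B ^ e j * \<beta> j) = 0" by (simp only: *(3))
    then have "poly (q (\<alpha>, \<beta>)) b = 0"
      by (simp add: q_def B poly_sum poly_monom algebra_simps sum_subtractf)
    then show False using b(2)[of "(\<alpha>, \<beta>)"] * by auto
  qed
qed

text \<open>Along the curve \<open>t \<mapsto> (t\<^bsup>w j\<^esup>)\<^sub>j\<close> with separating weights distinct monomials become distinct powers of
  \<open>t\<close>, so nothing cancels and a positive \<open>t\<close> outside the finitely many roots gives the direction.\<close>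
lemma generic_direction:
  fixes c :: "('d::finite \<Rightarrow> nat) \<Rightarrow> complex"
  assumes "finite A" "\<alpha>\<^sub>0 \<in> A" "c \<alpha>\<^sub>0 \<noteq> 0"
  obtains v :: "real^'d" where "\<And>j. v $ j \<noteq> 0"
    "(\<Sum>\<alpha>\<in>A. c \<alpha> * (\<Prod>j\<in>UNIV. complex_of_real (v $ j) ^ \<alpha> j)) \<noteq> 0"
proof -
  obtain w :: "'d \<Rightarrow> nat" where w: "inj_on (\<lambda>\<alpha>. \<Sum>j\<in>UNIV. w j * \<alpha> j) A"
    using separating_weights[OF assms(1)] by blast
  define q where "q = (\<Sum>\<alpha>\<in>A. monom (c \<alpha>) (\<Sum>j\<in>UNIV. w j * \<alpha> j))"
  have "coeff q (\<Sum>j\<in>UNIV. w j * \<alpha>\<^sub>0 j) = (\<Sum>\<alpha>\<in>A. if \<alpha> = \<alpha>\<^sub>0 then c \<alpha> else 0)"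
    unfolding q_def coeff_sum
    by (rule sum.cong) (simp_all add: inj_on_eq_iff[OF w _ assms(2)])
  then have "coeff q (\<Sum>j\<in>UNIV. w j * \<alpha>\<^sub>0 j) = c \<alpha>\<^sub>0" using assms by simp
  then have "q \<noteq> 0" using assms(3) by auto
  moreover have "infinite (complex_of_real ` {0<..})"
    using infinite_Ioi[of "0::real"] by (simp add: finite_image_iff inj_on_def)
  ultimately obtain z where z: "z \<in> complex_of_real ` {0<..}" "poly q z \<noteq> 0"
    using infinite_not_root[of "complex_of_real ` {0<..}" "{()}" "\<lambda>_. q"] by auto
  then obtain t where t: "t > 0" "z = complex_of_real t" by auto
  show thesis
  proof (rule that[of "\<chi> j. t ^ w j"])
    show "(\<chi> j. t ^ w j) $ j \<noteq> 0" for j using t by simp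
    have "poly q z = (\<Sum>\<alpha>\<in>A. c \<alpha> * (\<Prod>j\<in>UNIV. complex_of_real ((\<chi> j. t ^ w j) $ j) ^ \<alpha> j))"
      by (simp add: q_def poly_sum poly_monom t power_sum power_mult)
    then show "(\<Sum>\<alpha>\<in>A. c \<alpha> * (\<Prod>j\<in>UNIV. complex_of_real ((\<chi> j. t ^ w j) $ j) ^ \<alpha> j)) \<noteq> 0"
      using z by simp
  qed
qed

text \<open>Average the indicator of \<open>Z\<close> over the translations by \<open>s v\<close>, \<open>0 \<le> s \<le> 1\<close>.  By translation invariance
  this leaves its integral unchanged; integrating over \<open>s\<close> first gives zero.\<close>
lemma null_if_finite_on_parallel_lines:
  fixes Z :: "'a::euclidean_space set"
  assumes Z[measurable]: "Z \<in> sets borel" and fin: "\<And>x. finite {s. x + s *\<^sub>R v \<in> Z}"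
  shows "emeasure lborel Z = 0"
proof -
  let ?f = "\<lambda>x s. indicator {0..1::real} s * indicator Z (x + s *\<^sub>R v) :: ennreal"
  have "(\<integral>\<^sup>+x. ?f x s \<partial>lborel) = indicator {0..1} s * emeasure lborel Z" for s
  proof -
    have "(\<integral>\<^sup>+x. indicator Z x \<partial>lborel) = (\<integral>\<^sup>+x. indicator Z x \<partial>distr lborel borel ((+) (s *\<^sub>R v)))"
      by (simp add: lborel_distr_plus)
    also have "\<dots> = (\<integral>\<^sup>+x. indicator Z (x + s *\<^sub>R v) \<partial>lborel)"
      by (subst nn_integral_distr) (auto simp: add.commute)
    finally have "(\<integral>\<^sup>+x. indicator Z (x + s *\<^sub>R v) \<partial>lborel) = emeasure lborel Z" by simp
    then show ?thesis by (subst nn_integral_cmult) auto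
  qed
  then have "emeasure lborel Z = (\<integral>\<^sup>+s. (\<integral>\<^sup>+x. ?f x s \<partial>lborel) \<partial>lborel)"
    by (simp add: nn_integral_multc)
  also have "\<dots> = (\<integral>\<^sup>+x. (\<integral>\<^sup>+s. ?f x s \<partial>lborel) \<partial>lborel)"
    by (rule lborel_pair.Fubini'[symmetric]) measurable
  also have "\<dots> = (\<integral>\<^sup>+(x::'a). 0 \<partial>lborel)"
  proof (rule nn_integral_cong)
    fix x
    have "AE s in lborel. s \<notin> {s. x + s *\<^sub>R v \<in> Z}"
      using finite_imp_null_set_lborel[OF fin[of x]] by (rule AE_not_in)
    then have "AE s in lborel. ?f x s = 0" by eventually_elim auto
    then show "(\<integral>\<^sup>+s. ?f x s \<partial>lborel) = 0"
      by (subst nn_integral_0_iff_AE) measurable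
  qed
  finally show ?thesis by simp
qed

text \<open>Choose \<open>v\<close> where the homogeneous part of top degree \<open>N\<close> does not vanish.  Restricted to any line
  \<open>x + s v\<close> the polynomial has the value of that part at \<open>v\<close> as coefficient of \<open>s\<^sup>N\<close>, whatever \<open>x\<close> is, hence
  it has finitely many zeros on the line.\<close>
lemma AE_polynomial_nonzero:
  fixes c :: "('d::finite \<Rightarrow> nat) \<Rightarrow> complex"
  assumes "finite A" "\<alpha>\<^sub>0 \<in> A" "c \<alpha>\<^sub>0 \<noteq> 0"
  shows "AE x in lborel. (\<Sum>\<alpha>\<in>A. c \<alpha> * (\<Prod>j\<in>UNIV. complex_of_real (x $ j) ^ \<alpha> j)) \<noteq> 0"
proof -
  let ?p = "\<lambda>x :: real^'d. \<Sum>\<alpha>\<in>A. c \<alpha> * (\<Prod>j\<in>UNIV. complex_of_real (x $ j) ^ \<alpha> j)"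
  \<comment> \<open>Only monomials that really occur may determine the top degree.\<close>
  define S where "S = {\<alpha>\<in>A. c \<alpha> \<noteq> 0}"
  define N where "N = Max (mi_size ` S)"
  have S: "finite S" "S \<noteq> {}" using assms by (auto simp: S_def)
  have "N \<in> mi_size ` S"
    unfolding N_def by (rule Max_in) (use S in auto)
  then obtain \<alpha>\<^sub>1 where a1: "\<alpha>\<^sub>1 \<in> S" "mi_size \<alpha>\<^sub>1 = N" by auto
  have le_N: "mi_size \<alpha> \<le> N" if "\<alpha> \<in> S" for \<alpha> unfolding N_def by (rule Max_ge) (use S that in auto)
  obtain v :: "real^'d" where v: "\<And>j. v $ j \<noteq> 0"
    "(\<Sum>\<alpha> | \<alpha> \<in> S \<and> mi_size \<alpha> = N. c \<alpha> * (\<Prod>j\<in>UNIV. complex_of_real (v $ j) ^ \<alpha> j)) \<noteq> 0"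
    by (rule generic_direction[of "{\<alpha>. \<alpha> \<in> S \<and> mi_size \<alpha> = N}" \<alpha>\<^sub>1 c]) (use assms(1) a1 in \<open>auto simp: S_def\<close>)
  have "finite {s. ?p (x + s *\<^sub>R v) = 0}" for x
  proof -
    define m where "m = (\<lambda>\<alpha>. \<Prod>j\<in>UNIV. [:complex_of_real (x $ j), complex_of_real (v $ j):] ^ \<alpha> j)"
    define R where "R = (\<Sum>\<alpha>\<in>S. smult (c \<alpha>) (m \<alpha>))"
    have deg: "degree (m \<alpha>) = mi_size \<alpha>" for \<alpha>
      unfolding m_def by (subst degree_prod_eq_sum_degree) (auto simp: v degree_power_eq mi_size_def)
    have "lead_coeff (m \<alpha>) = (\<Prod>j\<in>UNIV. complex_of_real (v $ j) ^ \<alpha> j)" for \<alpha>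
      unfolding m_def lead_coeff_prod lead_coeff_power by (simp add: v)
    then have top: "coeff (m \<alpha>) (mi_size \<alpha>) = (\<Prod>j\<in>UNIV. complex_of_real (v $ j) ^ \<alpha> j)" for \<alpha>
      by (simp only: deg)
    have "coeff (m \<alpha>) N = (if mi_size \<alpha> = N then \<Prod>j\<in>UNIV. complex_of_real (v $ j) ^ \<alpha> j else 0)"
      if "\<alpha> \<in> S" for \<alpha>
    proof (cases "mi_size \<alpha> = N")
      case True
      then show ?thesis using top[of \<alpha>] by simp
    next
      case False
      then have "degree (m \<alpha>) < N" using le_N[OF that] by (simp add: deg)
      then show ?thesis using False by (simp add: coeff_eq_0)
    qed
    then have "coeff R N = (\<Sum>\<alpha>\<in>S. if mi_size \<alpha> = N then c \<alpha> * (\<Prod>j\<in>UNIV. complex_of_real (v $ j) ^ \<alpha> j) else 0)"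
      unfolding R_def coeff_sum by (intro sum.cong) auto
    also have "\<dots> \<noteq> 0" using v(2) S(1) by (simp add: sum.inter_filter)
    finally have "R \<noteq> 0" by auto
    then have "finite {z. poly R z = 0}" by (rule poly_roots_finite)
    then have "finite (complex_of_real -` {z. poly R z = 0})"
      by (rule finite_vimageI) (simp add: inj_def)
    moreover have "?p (x + s *\<^sub>R v) = poly R (complex_of_real s)" for s
    proof -
      have "?p (x + s *\<^sub>R v) = (\<Sum>\<alpha>\<in>S. c \<alpha> * (\<Prod>j\<in>UNIV. complex_of_real ((x + s *\<^sub>R v) $ j) ^ \<alpha> j))"
        unfolding S_def by (rule sum.mono_neutral_right) (use assms in auto)
      then show ?thesis
        by (simp add: R_def m_def poly_sum poly_prod)
    qed
    ultimately show ?thesis by (simp add: vimage_def)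
  qed
  moreover have "{x. ?p x = 0} \<in> sets borel"
    by (intro borel_closed closed_Collect_eq continuous_intros)
  ultimately have "{x. ?p x = 0} \<in> null_sets lborel"
    using null_if_finite_on_parallel_lines[of "{x. ?p x = 0}" v] by auto
  from AE_not_in[OF this] show ?thesis by simp
qed

section \<open>Functions with bounds on all partial derivatives\<close>

lemma partial_eqI:
  assumes "(f has_derivative f') (at x)"
  shows "partial j f x = f' (axis j 1)"
proof -
  have "((\<lambda>t. f (x + t *\<^sub>R axis j 1)) has_derivative (\<lambda>t. f' (t *\<^sub>R axis j 1))) (at (0::real))"
    by (rule has_derivative_compose[of _ _ _ _ f f'])
       (auto intro!: derivative_eq_intros simp: assms)
  moreover have "f' (t *\<^sub>R axis j 1) = t *\<^sub>R f' (axis j 1)" for t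
    using assms by (simp add: has_derivative_bounded_linear linear_simps)
  ultimately show ?thesis
    unfolding partial_def by (intro vector_derivative_at) (simp add: has_vector_derivative_def)
qed

lemma partial_add:
  assumes "f differentiable (at x)" "g differentiable (at x)"
  shows "partial j (\<lambda>x. f x + g x) x = partial j f x + partial j g x"
proof -
  obtain f' g' where d: "(f has_derivative f') (at x)" "(g has_derivative g') (at x)"
    using assms unfolding differentiable_def by auto
  show ?thesis
    using partial_eqI[OF has_derivative_add[OF d]] partial_eqI[OF d(1)] partial_eqI[OF d(2)]
    by simp
qed

lemma partial_mult:
  assumes "f differentiable (at x)" "g differentiable (at x)"
  shows "partial j (\<lambda>x. f x * g x) x = partial j f x * g x + f x * partial j g x"
proof -
  obtain f' g' where d: "(f has_derivative f') (at x)" "(g has_derivative g') (at x)"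
    using assms unfolding differentiable_def by auto
  show ?thesis
    using partial_eqI[OF has_derivative_mult[OF d]] partial_eqI[OF d(1)] partial_eqI[OF d(2)]
    by (simp add: add.commute)
qed

lemma partial_const: "partial j (\<lambda>x. c) = (\<lambda>x. 0)"
  by (simp add: partial_eqI[OF has_derivative_const] fun_eq_iff)

lemma has_derivative_coord:
  "((\<lambda>x. complex_of_real (x $ i)) has_derivative (\<lambda>h. complex_of_real (h $ i))) (at x)"
  by (intro bounded_linear_imp_has_derivative bounded_linear_of_real bounded_linear_compose[OF bounded_linear_of_real]
        bounded_linear_vec_nth)

lemma partial_coord: "partial j (\<lambda>x. complex_of_real (x $ i)) = (\<lambda>x. if i = j then 1 else 0)"
  by (auto simp: fun_eq_iff partial_eqI[OF has_derivative_coord] axis_def)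

lemma partial_cong:
  assumes "open S" "x \<in> S" "\<And>y. y \<in> S \<Longrightarrow> f y = g y"
  shows "partial j f x = partial j g x"
proof -
  have "((\<lambda>t. x + t *\<^sub>R axis j 1) \<longlongrightarrow> x + 0 *\<^sub>R axis j 1) (nhds (0::real))"
    using isCont_def by (intro tendsto_intros filterlim_ident)
  then have "\<forall>\<^sub>F t in nhds (0::real). x + t *\<^sub>R axis j 1 \<in> S"
    using assms(1,2) by (auto simp: tendsto_def)
  then have ev: "\<forall>\<^sub>F t in nhds (0::real). f (x + t *\<^sub>R axis j 1) = g (x + t *\<^sub>R axis j 1)"
    by eventually_elim (rule assms(3))
  show ?thesis
    unfolding partial_def by (rule vector_derivative_cong_eq) (use ev in \<open>auto simp: eventually_nhds\<close>)
qed

lemma differentiable_cong_open: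
  assumes "open S" "x \<in> S" "\<And>y. y \<in> S \<Longrightarrow> f y = g y" "f differentiable (at x)"
  shows "g differentiable (at x)"
  using assms unfolding differentiable_def by (metis has_derivative_transform_within_open)

text \<open>The conditions on all iterated partial derivatives of order at most \<open>n\<close>, arranged for induction on \<open>n\<close>.
  The bound \<open>B\<close> is a parameter because three classes share the same calculus: smooth functions (no
  bound), Schwartz functions (rapid decay) and their multipliers (polynomial growth).\<close>
primrec partials_upto :: "((real^'d::finite \<Rightarrow> complex) \<Rightarrow> bool) \<Rightarrow> (real^'d) set \<Rightarrow> nat
    \<Rightarrow> (real^'d \<Rightarrow> complex) \<Rightarrow> bool" where
  "partials_upto B S 0 f \<longleftrightarrow> (\<forall>x\<in>S. f differentiable (at x)) \<and> B f"
| "partials_upto B S (Suc n) f \<longleftrightarrow>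
     (\<forall>x\<in>S. f differentiable (at x)) \<and> B f \<and> (\<forall>j. partials_upto B S n (partial j f))"

lemma partials_snoc: "partials (js @ [j]) f = partials js (partial j f)"
  by (simp add: partials_def)

lemma partials_upto_iff:
  "partials_upto B S n f \<longleftrightarrow>
     (\<forall>js. length js \<le> n \<longrightarrow> (\<forall>x\<in>S. partials js f differentiable (at x)) \<and> B (partials js f))"
proof (induction n arbitrary: f)
  case 0
  then show ?case by (simp add: partials_def)
next
  case (Suc n)
  show ?case (is "_ = ?R")
  proof
    assume L: "partials_upto B S (Suc n) f"
    show ?R
    proof (intro allI impI)
      fix js :: "'a list" assume "length js \<le> Suc n"
      then show "(\<forall>x\<in>S. partials js f differentiable (at x)) \<and> B (partials js f)"
        using L Suc.IH by (cases js rule: rev_cases) (auto simp: partials_snoc, auto simp: partials_def)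
    qed
  next
    assume R: ?R
    have "(\<forall>x\<in>S. f differentiable (at x)) \<and> B f" using R[rule_format, of "[]"] by (simp add: partials_def)
    moreover have "partials_upto B S n (partial j f)" for j
      unfolding Suc.IH using R[rule_format, of "_ @ [j]"] by (simp add: partials_snoc)
    ultimately show "partials_upto B S (Suc n) f" by simp
  qed
qed

lemma partials_upto_all_iff:
  "(\<forall>n. partials_upto B S n f) \<longleftrightarrow>
     (\<forall>js. (\<forall>x\<in>S. partials js f differentiable (at x)) \<and> B (partials js f))"
  unfolding partials_upto_iff by auto

lemma partials_upto_base:
  assumes "partials_upto B S n f"
  shows "x \<in> S \<Longrightarrow> f differentiable (at x)" "B f"
  using assms by (cases n; simp)+

lemma partials_upto_lower: "partials_upto B S (Suc n) f \<Longrightarrow> partials_upto B S n f"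
  unfolding partials_upto_iff by simp

lemma partials_upto_cong:
  assumes "open S" and B: "\<forall>f g. (\<forall>x\<in>S. f x = g x) \<longrightarrow> B f \<longrightarrow> B g"
  shows "partials_upto B S n f \<Longrightarrow> (\<And>x. x \<in> S \<Longrightarrow> f x = g x) \<Longrightarrow> partials_upto B S n g"
proof (induction n arbitrary: f g)
  case 0
  then show ?case using differentiable_cong_open[OF assms(1) _ 0(2)] B[rule_format, of f g] by simp
next
  case (Suc n)
  have "partials_upto B S n (partial j g)" for j
    by (rule Suc.IH[of "partial j f"]) (use Suc.prems partial_cong[OF assms(1), of _ f g] in auto)
  then show ?case using Suc.prems differentiable_cong_open[OF assms(1) _ Suc.prems(2)] B[rule_format, of f g] by simp
qed

lemma partials_upto_add:
  assumes "open S" and B: "\<forall>f g. (\<forall>x\<in>S. f x = g x) \<longrightarrow> B f \<longrightarrow> B g"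
    and add: "\<forall>f g. B f \<longrightarrow> B g \<longrightarrow> B (\<lambda>x. f x + g x)"
  shows "partials_upto B S n f \<Longrightarrow> partials_upto B S n g \<Longrightarrow> partials_upto B S n (\<lambda>x. f x + g x)"
proof (induction n arbitrary: f g)
  case 0
  then show ?case using add[rule_format, of f g] by simp
next
  case (Suc n)
  have "partials_upto B S n (partial j (\<lambda>x. f x + g x))" for j
    by (rule partials_upto_cong[OF assms(1) B Suc.IH[of "partial j f" "partial j g"]])
       (use Suc.prems in \<open>auto simp: partial_add\<close>)
  then show ?case using Suc.prems add[rule_format, of f g] by simp
qed

text \<open>Leibniz rule.  The two factors may obey different bounds, so that it also covers the product of a
  multiplier with a Schwartz function.\<close>
lemma partials_upto_mult:
  assumes "open S" and B: "\<forall>f g. (\<forall>x\<in>S. f x = g x) \<longrightarrow> B f \<longrightarrow> B g"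
    and add: "\<forall>f g. B f \<longrightarrow> B g \<longrightarrow> B (\<lambda>x. f x + g x)"
    and mult: "\<forall>f g. B' f \<longrightarrow> B g \<longrightarrow> B (\<lambda>x. f x * g x)"
  shows "partials_upto B' S n f \<Longrightarrow> partials_upto B S n g \<Longrightarrow> partials_upto B S n (\<lambda>x. f x * g x)"
proof (induction n arbitrary: f g)
  case 0
  then show ?case using mult[rule_format, of f g] by simp
next
  case (Suc n)
  have "partials_upto B S n (partial j (\<lambda>x. f x * g x))" for j
  proof (rule partials_upto_cong[OF assms(1) B])
    show "partials_upto B S n (\<lambda>x. partial j f x * g x + f x * partial j g x)"
      using Suc.prems[THEN partials_upto_lower] Suc.prems
      by (intro partials_upto_add[OF assms(1) B add] Suc.IH) simp_all
  qed (use Suc.prems in \<open>auto simp: partial_mult\<close>)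
  then show ?case using Suc.prems mult[rule_format, of f g] by simp
qed

section \<open>Smooth functions\<close>

lemma smooth_on_iff: "smooth_on S f \<longleftrightarrow> (\<forall>n. partials_upto (\<lambda>_. True) S n f)"
  unfolding partials_upto_all_iff smooth_on_def by simp

lemma smooth_on_differentiable: "smooth_on S f \<Longrightarrow> x \<in> S \<Longrightarrow> f differentiable (at x)"
  unfolding smooth_on_iff using partials_upto_base(1) by blast

lemma smooth_on_continuous: "smooth_on S f \<Longrightarrow> continuous_on S f"
  using smooth_on_differentiable differentiable_imp_continuous_within
  by (metis continuous_at_imp_continuous_on)

lemma smooth_on_partial: "smooth_on S f \<Longrightarrow> smooth_on S (partial j f)"
  unfolding smooth_on_iff by (metis partials_upto.simps(2))

lemma smooth_on_partials: "smooth_on S f \<Longrightarrow> smooth_on S (partials js f)"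
  by (induction js) (auto simp: partials_def intro: smooth_on_partial)

lemma smooth_on_cong:
  "open S \<Longrightarrow> smooth_on S f \<Longrightarrow> (\<And>x. x \<in> S \<Longrightarrow> f x = g x) \<Longrightarrow> smooth_on S g"
  unfolding smooth_on_iff using partials_upto_cong[of S "\<lambda>_. True" _ f g] by simp

lemma smooth_on_subset: "smooth_on S f \<Longrightarrow> T \<subseteq> S \<Longrightarrow> smooth_on T f"
  unfolding smooth_on_def by blast

lemma smooth_on_Un: "smooth_on S f \<Longrightarrow> smooth_on T f \<Longrightarrow> smooth_on (S \<union> T) f"
  unfolding smooth_on_def by blast

lemma smooth_on_add: "open S \<Longrightarrow> smooth_on S f \<Longrightarrow> smooth_on S g \<Longrightarrow> smooth_on S (\<lambda>x. f x + g x)"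
  unfolding smooth_on_iff by (simp add: partials_upto_add)

lemma smooth_on_mult: "open S \<Longrightarrow> smooth_on S f \<Longrightarrow> smooth_on S g \<Longrightarrow> smooth_on S (\<lambda>x. f x * g x)"
  unfolding smooth_on_iff by (simp add: partials_upto_mult[where B'="\<lambda>_. True"])

lemma partials_upto_const: "(\<And>c. B (\<lambda>_. c)) \<Longrightarrow> partials_upto B S n (\<lambda>x. c)"
  by (induction n arbitrary: c) (auto simp: partial_const)

lemma partials_upto_coord:
  "(\<And>c. B (\<lambda>_. c)) \<Longrightarrow> B (\<lambda>x. complex_of_real (x $ i)) \<Longrightarrow> partials_upto B S n (\<lambda>x. complex_of_real (x $ i))"
  using has_derivative_coord[of i] partials_upto_const[of B S]
  by (cases n) (auto simp: partial_coord differentiable_def)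

lemma smooth_on_const: "smooth_on S (\<lambda>x. c)"
  unfolding smooth_on_iff by (auto intro: partials_upto_const)

lemma smooth_on_coord: "smooth_on S (\<lambda>x. complex_of_real (x $ i))"
  unfolding smooth_on_iff by (auto intro: partials_upto_coord)

lemma smooth_on_prod:
  "open S \<Longrightarrow> (\<And>i. i \<in> I \<Longrightarrow> smooth_on S (f i)) \<Longrightarrow> smooth_on S (\<lambda>x. \<Prod>i\<in>I. f i x)"
  by (induction I rule: infinite_finite_induct) (auto intro: smooth_on_const smooth_on_mult)

section \<open>Schwartz functions and their multipliers\<close>

definition rapid :: "(real^'d::finite \<Rightarrow> complex) \<Rightarrow> bool" where
  "rapid f \<longleftrightarrow> (\<forall>N. \<exists>C. \<forall>x. norm x ^ N * norm (f x) \<le> C)"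

definition poly_bounded :: "(real^'d::finite \<Rightarrow> complex) \<Rightarrow> bool" where
  "poly_bounded f \<longleftrightarrow> (\<exists>C N. \<forall>x. norm (f x) \<le> C * (1 + norm x) ^ N)"

text \<open>The slowly increasing smooth functions.  Characters and the symbols of differential operators are of
  this kind.\<close>
definition multiplier :: "(real^'d::finite \<Rightarrow> complex) \<Rightarrow> bool" where
  "multiplier f \<longleftrightarrow> (\<forall>n. partials_upto poly_bounded UNIV n f)"

lemma schwartz_iff: "f \<in> schwartz \<longleftrightarrow> (\<forall>n. partials_upto rapid UNIV n f)"
  unfolding partials_upto_all_iff schwartz_def smooth_on_def rapid_def by auto

text \<open>The weight \<open>1 + \<parallel>x\<parallel>\<close> is bounded below and changes by a bounded factor under bounded translations,
  unlike \<open>\<parallel>x\<parallel>\<close>; the two are exchanged by \<open>(1 + r)\<^sup>N \<le> 2\<^sup>N (1 + r\<^sup>N)\<close>.\<close>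
lemma rapid_weight:
  assumes "rapid f"
  obtains C where "0 \<le> C" "\<And>x. (1 + norm x) ^ N * norm (f x) \<le> C"
proof -
  obtain C0 where 0: "\<And>x. norm (f x) \<le> C0" using assms unfolding rapid_def by (metis mult_1 power_0)
  obtain C1 where 1: "\<And>x. norm x ^ N * norm (f x) \<le> C1" using assms unfolding rapid_def by blast
  have C: "0 \<le> C0" "0 \<le> C1"
    using order_trans[OF norm_ge_zero 0[of 0]] order_trans[OF _ 1[of 0]] by auto
  show thesis
  proof (rule that[of "2 ^ N * (C0 + C1)"])
    show "(1 + norm x) ^ N * norm (f x) \<le> 2 ^ N * (C0 + C1)" for x
    proof -
      have "(1 + norm x) ^ N \<le> (2 * max 1 (norm x)) ^ N" by (intro power_mono) auto
      also have "\<dots> = 2 ^ N * (max 1 (norm x)) ^ N" by (simp add: power_mult_distrib)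
      also have "\<dots> \<le> 2 ^ N * (1 + norm x ^ N)" by (intro mult_left_mono) (auto simp: max_def)
      finally have "(1 + norm x) ^ N * norm (f x) \<le> 2 ^ N * (1 + norm x ^ N) * norm (f x)"
        by (rule mult_right_mono) simp
      also have "\<dots> = 2 ^ N * (norm (f x) + norm x ^ N * norm (f x))" by (simp add: algebra_simps)
      also have "\<dots> \<le> 2 ^ N * (C0 + C1)" using 0[of x] 1[of x] by simp
      finally show ?thesis .
    qed
  qed (use C in simp)
qed

lemma rapidI:
  assumes "\<And>N. \<exists>C. \<forall>x. (1 + norm x) ^ N * norm (f x) \<le> C"
  shows "rapid f"
  unfolding rapid_def
proof
  fix N
  obtain C where C: "\<And>x. (1 + norm x) ^ N * norm (f x) \<le> C" using assms by blast
  have "norm x ^ N * norm (f x) \<le> (1 + norm x) ^ N * norm (f x)" for x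
    by (intro mult_right_mono power_mono) auto
  then show "\<exists>C. \<forall>x. norm x ^ N * norm (f x) \<le> C" using C order_trans by blast
qed

lemma rapid_add:
  assumes "rapid f" "rapid g"
  shows "rapid (\<lambda>x. f x + g x)"
proof (rule rapidI)
  fix N
  obtain C where C: "\<And>x. (1 + norm x) ^ N * norm (f x) \<le> C" by (rule rapid_weight[OF assms(1)]) blast
  obtain D where D: "\<And>x. (1 + norm x) ^ N * norm (g x) \<le> D" by (rule rapid_weight[OF assms(2)]) blast
  have "(1 + norm x) ^ N * norm (f x + g x) \<le> (1 + norm x) ^ N * (norm (f x) + norm (g x))" for x
    by (intro mult_left_mono norm_triangle_ineq) auto
  then have "(1 + norm x) ^ N * norm (f x + g x) \<le> C + D" for x
    using C[of x] D[of x] by (simp add: distrib_left) (meson add_mono order_trans)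
  then show "\<exists>C. \<forall>x. (1 + norm x) ^ N * norm (f x + g x) \<le> C" by blast
qed

lemma rapid_mult:
  assumes "poly_bounded f" "rapid g"
  shows "rapid (\<lambda>x. f x * g x)"
proof (rule rapidI)
  fix N
  obtain C M where C: "\<And>x. norm (f x) \<le> C * (1 + norm x) ^ M"
    using assms(1) unfolding poly_bounded_def by blast
  obtain D where D: "\<And>x. (1 + norm x) ^ (N + M) * norm (g x) \<le> D" by (rule rapid_weight[OF assms(2)]) blast
  have C0: "0 \<le> C" using C[of 0] by (simp add: order_trans[OF norm_ge_zero])
  have "(1 + norm x) ^ N * norm (f x * g x) \<le> C * D" for x
  proof -
    have "(1 + norm x) ^ N * norm (f x * g x) = (1 + norm x) ^ N * norm (g x) * norm (f x)"
      by (simp add: norm_mult)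
    also have "\<dots> \<le> (1 + norm x) ^ N * norm (g x) * (C * (1 + norm x) ^ M)"
      by (intro mult_left_mono C) auto
    also have "\<dots> = C * ((1 + norm x) ^ (N + M) * norm (g x))" by (simp add: power_add)
    also have "\<dots> \<le> C * D" by (intro mult_left_mono D C0)
    finally show ?thesis .
  qed
  then show "\<exists>C. \<forall>x. (1 + norm x) ^ N * norm (f x * g x) \<le> C" by blast
qed

lemma poly_bounded_weaken:
  assumes "\<And>x. norm (f x) \<le> C * (1 + norm x) ^ N" "N \<le> M"
  shows "norm (f x) \<le> C * (1 + norm x) ^ M"
proof -
  have "0 \<le> C" using assms(1)[of 0] by (simp add: order_trans[OF norm_ge_zero])
  then have "C * (1 + norm x) ^ N \<le> C * (1 + norm x) ^ M"
    by (intro mult_left_mono power_increasing assms) auto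
  with assms(1) show ?thesis by (rule order_trans)
qed

lemma poly_bounded_add:
  assumes "poly_bounded f" "poly_bounded g"
  shows "poly_bounded (\<lambda>x. f x + g x)"
proof -
  obtain C N D M where C: "\<And>x. norm (f x) \<le> C * (1 + norm x) ^ N"
      and D: "\<And>x. norm (g x) \<le> D * (1 + norm x) ^ M"
    using assms unfolding poly_bounded_def by blast
  have "norm (f x + g x) \<le> (C + D) * (1 + norm x) ^ (N + M)" for x
    using norm_triangle_ineq[of "f x" "g x"] poly_bounded_weaken[OF C, of "N + M" x]
      poly_bounded_weaken[OF D, of "N + M" x] by (simp add: distrib_right)
  then show ?thesis unfolding poly_bounded_def by blast
qed

lemma poly_bounded_mult:
  assumes "poly_bounded f" "poly_bounded g"
  shows "poly_bounded (\<lambda>x. f x * g x)"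
proof -
  obtain C N D M where C: "\<And>x. norm (f x) \<le> C * (1 + norm x) ^ N"
      and D: "\<And>x. norm (g x) \<le> D * (1 + norm x) ^ M"
    using assms unfolding poly_bounded_def by blast
  have "norm (f x * g x) \<le> (C * (1 + norm x) ^ N) * (D * (1 + norm x) ^ M)" for x
    unfolding norm_mult by (intro mult_mono C D) (use C D norm_ge_zero order_trans in blast)+
  then have "norm (f x * g x) \<le> (C * D) * (1 + norm x) ^ (N + M)" for x
    by (simp add: power_add mult.assoc mult.left_commute)
  then show ?thesis unfolding poly_bounded_def by blast
qed

lemma poly_bounded_const: "poly_bounded (\<lambda>_. c)"
  unfolding poly_bounded_def by (intro exI[of _ "norm c"] exI[of _ 0]) simp

lemma poly_bounded_coord: "poly_bounded (\<lambda>x. complex_of_real (x $ i))"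
  unfolding poly_bounded_def
  by (intro exI[of _ 1] exI[of _ 1]) (simp, meson add_increasing component_le_norm_cart zero_le_one)

text \<open>Discharges the congruence premise of the closure lemmas when the domain is the whole space.\<close>
lemma agree_on_UNIV: "\<forall>f g. (\<forall>x\<in>UNIV. f x = g x) \<longrightarrow> B f \<longrightarrow> B g"
  by (metis UNIV_I ext)

lemma multiplier_const: "multiplier (\<lambda>_. c)"
  unfolding multiplier_def by (auto intro: partials_upto_const poly_bounded_const)

lemma multiplier_coord: "multiplier (\<lambda>x. complex_of_real (x $ i))"
  unfolding multiplier_def by (auto intro: partials_upto_coord poly_bounded_const poly_bounded_coord)

lemma multiplier_add: "multiplier f \<Longrightarrow> multiplier g \<Longrightarrow> multiplier (\<lambda>x. f x + g x)"
  unfolding multiplier_def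
  by (simp add: partials_upto_add[OF open_UNIV agree_on_UNIV] poly_bounded_add)

lemma multiplier_mult: "multiplier f \<Longrightarrow> multiplier g \<Longrightarrow> multiplier (\<lambda>x. f x * g x)"
  unfolding multiplier_def
  by (simp add: partials_upto_mult[OF open_UNIV agree_on_UNIV, where B'=poly_bounded] poly_bounded_add poly_bounded_mult)

lemma multiplier_power: "multiplier f \<Longrightarrow> multiplier (\<lambda>x. f x ^ n)"
  by (induction n) (auto intro: multiplier_const multiplier_mult)

lemma multiplier_sum: "(\<And>i. i \<in> I \<Longrightarrow> multiplier (f i)) \<Longrightarrow> multiplier (\<lambda>x. \<Sum>i\<in>I. f i x)"
  by (induction I rule: infinite_finite_induct) (auto intro: multiplier_const multiplier_add)

lemma multiplier_prod: "(\<And>i. i \<in> I \<Longrightarrow> multiplier (f i)) \<Longrightarrow> multiplier (\<lambda>x. \<Prod>i\<in>I. f i x)"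
  by (induction I rule: infinite_finite_induct) (auto intro: multiplier_const multiplier_mult)

lemma multiplier_smooth: "multiplier f \<Longrightarrow> smooth_on UNIV f"
  unfolding multiplier_def smooth_on_def partials_upto_all_iff by blast

lemma schwartz_mult: "multiplier f \<Longrightarrow> g \<in> schwartz \<Longrightarrow> (\<lambda>x. f x * g x) \<in> schwartz"
  unfolding multiplier_def schwartz_iff
  by (simp add: partials_upto_mult[OF open_UNIV agree_on_UNIV, where B'=poly_bounded] rapid_add rapid_mult)

lemma schwartz_add: "f \<in> schwartz \<Longrightarrow> g \<in> schwartz \<Longrightarrow> (\<lambda>x. f x + g x) \<in> schwartz"
  unfolding schwartz_iff
  by (simp add: partials_upto_add[OF open_UNIV agree_on_UNIV] rapid_add)

lemma schwartz_partial: "f \<in> schwartz \<Longrightarrow> partial j f \<in> schwartz"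
  unfolding schwartz_iff by (metis partials_upto.simps(2))

lemma schwartz_differentiable: "f \<in> schwartz \<Longrightarrow> f differentiable (at x)"
  unfolding schwartz_iff using partials_upto_base(1) by blast

lemma schwartz_rapid: "f \<in> schwartz \<Longrightarrow> rapid f"
  unfolding schwartz_iff using partials_upto_base(2) by blast

lemma schwartz_smooth: "f \<in> schwartz \<Longrightarrow> smooth_on UNIV f"
  by (simp add: schwartz_def)

lemma schwartz_continuous: "f \<in> schwartz \<Longrightarrow> continuous_on UNIV f"
  by (simp add: schwartz_smooth smooth_on_continuous)

section \<open>Bump functions and the fundamental lemma of the calculus of variations\<close>

text \<open>The functions \<open>exp (-1/t) / t\<^sup>m\<close> for \<open>t > 0\<close>, extended by zero.  Including the denominators makes the
  family closed under differentiation, up to linear combinations.\<close>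
definition flat :: "nat \<Rightarrow> real \<Rightarrow> real" where
  "flat m t = (if t > 0 then exp (- 1 / t) / t ^ m else 0)"

lemma power_div_fact_le_exp:
  fixes x :: real assumes "0 \<le> x"
  shows "x ^ n / fact n \<le> exp x"
proof -
  have "(\<Sum>i\<in>{n}. x ^ i /\<^sub>R fact i) \<le> suminf (\<lambda>i. x ^ i /\<^sub>R fact i)"
    by (rule sum_le_suminf[OF summable_exp_generic]) (use assms in auto)
  then show ?thesis by (simp add: exp_def field_simps)
qed

lemma exp_neg_inverse_le:
  fixes t :: real assumes "0 < t"
  shows "exp (- 1 / t) \<le> fact n * t ^ n"
proof -
  have "1 \<le> (fact n * t ^ n) * exp (1 / t)"
    using power_div_fact_le_exp[of "1 / t" n] assms by (simp add: field_simps)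
  then have "exp (- 1 / t) * 1 \<le> exp (- 1 / t) * ((fact n * t ^ n) * exp (1 / t))"
    by (rule mult_left_mono) simp
  also have "\<dots> = fact n * t ^ n"
    by (simp add: exp_minus)
  finally show ?thesis by simp
qed

text \<open>This quadratic bound is what makes the derivative at the origin vanish.\<close>
lemma flat_le: "\<bar>flat m t\<bar> \<le> fact (m + 2) * t\<^sup>2"
proof (cases "t > 0")
  case True
  have "exp (- 1 / t) / t ^ m \<le> fact (m + 2) * t ^ (m + 2) / t ^ m"
    using exp_neg_inverse_le[OF True, of "m + 2"] True by (intro divide_right_mono) auto
  also have "\<dots> = fact (m + 2) * t\<^sup>2"
    using True by (simp only: power_add) simp
  finally show ?thesis using True by (simp add: flat_def)
qed (simp add: flat_def)

lemma has_real_derivative_flat: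
  "(flat m has_real_derivative (flat (m + 2) t - real m * flat (m + 1) t)) (at t)"
proof (cases t "0 :: real" rule: linorder_cases)
  case less
  have "((\<lambda>t. 0) has_real_derivative 0) (at t)" by simp
  then have "(flat m has_real_derivative 0) (at t)"
    by (rule has_field_derivative_transform_within_open[where S="{..<0}"]) (use less in \<open>auto simp: flat_def\<close>)
  then show ?thesis using less by (simp add: flat_def)
next
  case equal
  have "(flat m has_real_derivative 0) (at 0)"
    unfolding has_field_derivative_def
  proof (rule has_derivativeI_sandwich[of 1 _ _ _ _ "\<lambda>y. fact (m + 2) * \<bar>y\<bar>"])
    show "((\<lambda>y::real. fact (m + 2) * \<bar>y\<bar>) \<longlongrightarrow> 0) (at 0)"
      by (intro tendsto_mult_right_zero tendsto_rabs_zero tendsto_ident_at)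
    fix y :: real assume y: "y \<noteq> 0"
    have "\<bar>flat m y\<bar> / \<bar>y\<bar> \<le> fact (m + 2) * \<bar>y\<bar>"
      using flat_le[of m y] y by (simp add: pos_divide_le_eq power2_eq_square abs_mult_self_eq mult.assoc)
    then show "norm (flat m y - flat m 0 - 0 * (y - 0)) / norm (y - 0) \<le> fact (m + 2) * \<bar>y\<bar>"
      by (simp add: flat_def)
  qed (auto intro!: bounded_linear_mult_right)
  then show ?thesis using equal by (simp add: flat_def)
next
  case greater
  have "((\<lambda>t. exp (- 1 / t) / t ^ m) has_real_derivative (flat (m + 2) t - real m * flat (m + 1) t)) (at t)"
    using greater
    by (auto intro!: derivative_eq_intros simp: flat_def)
       (cases m; simp add: field_simps power_add power2_eq_square)
  then show ?thesis
    by (rule has_field_derivative_transform_within_open[where S="{0<..}"]) (use greater in \<open>auto simp: flat_def\<close>)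
qed

lemma has_derivative_of_real_iff:
  assumes "((\<lambda>x. complex_of_real (q x)) has_derivative Q) (at x)"
  shows "(q has_derivative (\<lambda>h. Re (Q h))) (at x)" "complex_of_real (Re (Q h)) = Q h"
proof -
  show *: "(q has_derivative (\<lambda>h. Re (Q h))) (at x)"
    using has_derivative_Re[OF assms] by simp
  have "(\<lambda>h. complex_of_real (Re (Q h))) = Q"
    by (rule has_derivative_unique[OF has_derivative_of_real[OF *] assms])
  then show "complex_of_real (Re (Q h)) = Q h" by metis
qed

text \<open>Every partial derivative of \<open>flat m \<circ> q\<close> is a combination of \<open>flat (m + 1) \<circ> q\<close> and \<open>flat (m + 2) \<circ> q\<close> with
  the smooth factor \<open>\<partial>\<^sub>j q\<close>, so one induction on the order, simultaneous in \<open>m\<close>, suffices.\<close>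
lemma smooth_on_flat:
  assumes "smooth_on UNIV (\<lambda>x::real^'d::finite. complex_of_real (q x))"
  shows "smooth_on UNIV (\<lambda>x. complex_of_real (flat m (q x)))"
proof -
  let ?q = "\<lambda>x. complex_of_real (q x)"
  have deriv: "((\<lambda>x. complex_of_real (flat m (q x))) has_derivative
      (\<lambda>h. complex_of_real (flat (m + 2) (q x) - real m * flat (m + 1) (q x)) * frechet_derivative ?q (at x) h)) (at x)" for m x
  proof -
    have Q: "(?q has_derivative frechet_derivative ?q (at x)) (at x)"
      using smooth_on_differentiable[OF assms, of x] frechet_derivative_works by blast
    have "((\<lambda>x. flat m (q x)) has_derivative
        (\<lambda>h. (flat (m + 2) (q x) - real m * flat (m + 1) (q x)) * Re (frechet_derivative ?q (at x) h))) (at x)"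
      by (rule has_derivative_compose[OF has_derivative_of_real_iff(1)[OF Q]])
         (use has_real_derivative_flat[of m "q x"] in \<open>simp add: has_field_derivative_def\<close>)
    from has_derivative_of_real[OF this, where 'a=complex] show ?thesis
      by (simp only: of_real_mult has_derivative_of_real_iff(2)[OF Q])
  qed
  have "partials_upto (\<lambda>_. True) UNIV n (\<lambda>x. complex_of_real (flat m (q x)))" for n m
  proof (induction n arbitrary: m)
    case 0
    then show ?case using deriv by (auto simp: differentiable_def)
  next
    case (Suc n)
    have eq: "partial j (\<lambda>x. complex_of_real (flat m (q x))) =
       (\<lambda>x. (complex_of_real (flat (m + 2) (q x)) + (- of_nat m) * complex_of_real (flat (m + 1) (q x))) * partial j ?q x)" for j
    proof
      fix x
      have Q: "(?q has_derivative frechet_derivative ?q (at x)) (at x)"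
        using smooth_on_differentiable[OF assms, of x] frechet_derivative_works by blast
      show "partial j (\<lambda>x. complex_of_real (flat m (q x))) x =
       (complex_of_real (flat (m + 2) (q x)) + (- of_nat m) * complex_of_real (flat (m + 1) (q x))) * partial j ?q x"
        by (simp add: partial_eqI[OF deriv] partial_eqI[OF Q])
    qed
    have pq: "partials_upto (\<lambda>_. True) UNIV n (partial j ?q)" for j
      using smooth_on_partial[OF assms] by (simp add: smooth_on_iff)
    have "partials_upto (\<lambda>_. True) UNIV n (partial j (\<lambda>x. complex_of_real (flat m (q x))))" for j
      unfolding eq
      by (intro partials_upto_mult[OF open_UNIV, where B'="\<lambda>_. True"] partials_upto_add[OF open_UNIV]
            partials_upto_const Suc.IH pq) simp_all
    then show ?case using deriv by (auto simp: differentiable_def)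
  qed
  then show ?thesis by (simp add: smooth_on_iff)
qed

text \<open>As \<open>N\<close> grows, the factor \<open>N + 1\<close> lets the bump tend to the indicator of the open box while its support
  stays the same.\<close>
definition box_bump :: "nat \<Rightarrow> real^'d::finite \<Rightarrow> real^'d \<Rightarrow> real^'d \<Rightarrow> real" where
  "box_bump N a b x = (\<Prod>j\<in>UNIV. flat 0 (real (Suc N) * ((x $ j - a $ j) * (b $ j - x $ j))))"

lemma flat_0_bounds: "0 \<le> flat 0 t" "flat 0 t \<le> 1"
  by (auto simp: flat_def)

lemma box_bump_bounds: "0 \<le> box_bump N a b x" "box_bump N a b x \<le> 1"
  unfolding box_bump_def by (auto intro!: prod_nonneg prod_le_1 flat_0_bounds)

lemma box_bump_pos_iff:
  assumes "box a b \<noteq> {}"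
  shows "box_bump N a b x > 0 \<longleftrightarrow> x \<in> box a b"
proof -
  have ab: "a $ j < b $ j" for j using assms unfolding ex_in_conv[symmetric] mem_box_cart by (meson less_trans)
  have "0 < (x $ j - a $ j) * (b $ j - x $ j) \<longleftrightarrow> a $ j < x $ j \<and> x $ j < b $ j" for j
    using ab[of j] by (auto simp: zero_less_mult_iff)
  then have iff: "0 < flat 0 (real (Suc N) * ((x $ j - a $ j) * (b $ j - x $ j))) \<longleftrightarrow> a $ j < x $ j \<and> x $ j < b $ j" for j
    by (simp add: flat_def zero_less_mult_iff[of "1 + real N"])
  show ?thesis
  proof
    assume "x \<in> box a b"
    then show "box_bump N a b x > 0"
      unfolding box_bump_def by (intro prod_pos) (simp add: iff mem_box_cart del: of_nat_Suc)
  next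
    assume *: "box_bump N a b x > 0"
    have "flat 0 (real (Suc N) * ((x $ j - a $ j) * (b $ j - x $ j))) \<noteq> 0" for j
    proof
      assume "flat 0 (real (Suc N) * ((x $ j - a $ j) * (b $ j - x $ j))) = 0"
      then have "box_bump N a b x = 0"
        unfolding box_bump_def by (intro prod_zero bexI[of _ j]) simp_all
      with * show False by simp
    qed
    then have "0 < flat 0 (real (Suc N) * ((x $ j - a $ j) * (b $ j - x $ j)))" for j
      using flat_0_bounds(1)[of "real (Suc N) * ((x $ j - a $ j) * (b $ j - x $ j))"] by (metis less_le)
    then show "x \<in> box a b"
      unfolding iff mem_box_cart by blast
  qed
qed

lemma box_bump_tendsto:
  assumes "box a b \<noteq> {}"
  shows "(\<lambda>N. box_bump N a b x) \<longlonglongrightarrow> indicator (box a b) x"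
proof (cases "x \<in> box a b")
  case True
  have "(\<lambda>N. flat 0 (real (Suc N) * s)) \<longlonglongrightarrow> 1" if "s > 0" for s
  proof -
    have "(\<lambda>N. exp (- (1 / s) * inverse (real (Suc N)))) \<longlonglongrightarrow> exp (- (1 / s) * 0)"
      by (intro tendsto_intros LIMSEQ_inverse_real_of_nat)
    moreover have "exp (- (1 / s) * inverse (real (Suc N))) = flat 0 (real (Suc N) * s)" for N
    proof -
      have "0 < real (Suc N) * s" using that by simp
      then show ?thesis using that by (simp add: flat_def divide_inverse del: of_nat_Suc)
    qed
    ultimately show ?thesis by simp
  qed
  then have "(\<lambda>N. box_bump N a b x) \<longlonglongrightarrow> (\<Prod>j\<in>(UNIV::'a set). 1)"
    unfolding box_bump_def using True by (intro tendsto_prod) (auto simp: mem_box_cart)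
  then show ?thesis using True by simp
next
  case False
  then have "box_bump N a b x = 0" for N
    using box_bump_pos_iff[OF assms, of N x] box_bump_bounds(1)[of N a b x] by auto
  then show ?thesis using False by simp
qed

lemma smooth_on_box_bump: "smooth_on UNIV (\<lambda>x. complex_of_real (box_bump N a b x))"
proof -
  have "smooth_on UNIV (\<lambda>x. complex_of_real (real (Suc N) * ((x $ j - a $ j) * (b $ j - x $ j))))" for j
  proof -
    have "smooth_on UNIV (\<lambda>x. complex_of_real (real (Suc N)) * ((complex_of_real (x $ j) + complex_of_real (- a $ j)) *
        (complex_of_real (b $ j) + (- 1) * complex_of_real (x $ j))))"
      by (intro smooth_on_mult smooth_on_add smooth_on_const smooth_on_coord open_UNIV)
    then show ?thesis by simp
  qed
  then show ?thesis
    unfolding box_bump_def of_real_prod by (intro smooth_on_prod smooth_on_flat open_UNIV)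
qed

text \<open>The product is smooth where \<open>v\<close> is, and vanishes off the support of \<open>f\<close>; these two open sets cover
  the space.  Thus \<open>v\<close> may be singular outside \<open>S\<close>.\<close>
lemma test_on_mult:
  fixes v :: "real^'d::finite \<Rightarrow> complex"
  assumes "open S" "smooth_on S v" "f \<in> test_on S"
  shows "(\<lambda>x. v x * f x) \<in> test_on S"
proof -
  let ?K = "closure {x. f x \<noteq> 0}"
  have f: "smooth_on UNIV f" "compact ?K" "?K \<subseteq> S" using assms(3) by (auto simp: test_on_def)
  have "smooth_on S (\<lambda>x. v x * f x)"
    using assms f by (intro smooth_on_mult) (auto intro: smooth_on_subset)
  moreover have "smooth_on (- ?K) (\<lambda>x. v x * f x)"
    by (rule smooth_on_cong[of _ "\<lambda>x. 0"]) (use closure_subset[of "{x. f x \<noteq> 0}"] in \<open>auto intro: smooth_on_const\<close>)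
  ultimately have "smooth_on (S \<union> - ?K) (\<lambda>x. v x * f x)" by (rule smooth_on_Un)
  then have smooth: "smooth_on UNIV (\<lambda>x. v x * f x)" by (rule smooth_on_subset) (use f in auto)
  have sub: "closure {x. v x * f x \<noteq> 0} \<subseteq> ?K" by (rule closure_mono) auto
  have "compact (?K \<inter> closure {x. v x * f x \<noteq> 0})"
    by (rule compact_Int_closed[OF f(2) closed_closure])
  then have "compact (closure {x. v x * f x \<noteq> 0})"
    by (simp only: inf.absorb2[OF sub])
  then show ?thesis
    unfolding test_on_def mem_Collect_eq using smooth order_trans[OF sub f(3)] by blast
qed

lemma box_bump_test:
  assumes "box a b \<noteq> {}" "cbox a b \<subseteq> S"
  shows "(\<lambda>x. complex_of_real (box_bump N a b x)) \<in> test_on S"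
proof -
  have "{x. complex_of_real (box_bump N a b x) \<noteq> 0} \<subseteq> box a b"
    using box_bump_pos_iff[OF assms(1), of N] box_bump_bounds(1)[of N a b] by (force simp: less_le)
  then have sub: "closure {x. complex_of_real (box_bump N a b x) \<noteq> 0} \<subseteq> cbox a b"
    by (intro closure_minimal closed_cbox) (use box_subset_cbox in auto)
  have "compact (cbox a b \<inter> closure {x. complex_of_real (box_bump N a b x) \<noteq> 0})"
    by (rule compact_Int_closed[OF compact_cbox closed_closure])
  then have "compact (closure {x. complex_of_real (box_bump N a b x) \<noteq> 0})"
    by (simp only: inf.absorb2[OF sub])
  then show ?thesis
    unfolding test_on_def mem_Collect_eq
    using smooth_on_box_bump order_trans[OF sub assms(2)] by blast
qed

text \<open>Open boxes form an intersection-stable generator of the Borel sets, and the sets over which \<open>F\<close>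
  integrates to zero form a Dynkin system.\<close>
lemma AE_zero_if_box_integrals_zero:
  fixes F :: "'a::euclidean_space \<Rightarrow> complex"
  assumes F: "integrable lborel F" and 0: "\<And>a b. (LINT x:box a b|lborel. F x) = 0"
  shows "AE x in lborel. F x = 0"
proof (rule sigma_finite_measure.density_zero[OF sigma_finite_lborel F])
  have int: "set_integrable lborel A F" if "A \<in> sets borel" for A
    unfolding set_integrable_def using that F by (intro integrable_mult_indicator) auto
  have total: "(LINT x|lborel. F x) = 0"
  proof -
    have "(\<lambda>n. LINT x:box (- real n *\<^sub>R One) (real n *\<^sub>R One)|lborel. F x) \<longlonglongrightarrow> (LINT x:(\<Union>n. box (- real n *\<^sub>R One) (real n *\<^sub>R One))|lborel. F x)"
    proof (rule set_integral_cont_up)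
      show "incseq (\<lambda>n. box (- real n *\<^sub>R One) (real n *\<^sub>R One) :: 'a set)"
        by (rule incseq_SucI) (auto simp: mem_box intro: less_trans, fastforce+)
    qed (auto intro: int)
    then show ?thesis
      by (simp add: 0[unfolded set_lebesgue_integral_def] UN_box_eq_UNIV LIMSEQ_const_iff set_lebesgue_integral_def)
  qed
  have stable: "Int_stable (range (\<lambda>(a, b). box a b :: 'a set))"
  proof (rule Int_stableI, clarify)
    fix a b c d :: 'a
    show "box a b \<inter> box c d \<in> range (\<lambda>(a, b). box a b)"
      using box_Int_box[of a b c d] by (metis (no_types, lifting) case_prod_conv rangeI)
  qed
  have Pow_UNIV_sub: "range (\<lambda>(a, b). box a b :: 'a set) \<subseteq> Pow UNIV" by simp
  fix A :: "'a set" assume "A \<in> sets lborel"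
  then have "A \<in> sigma_sets UNIV (range (\<lambda>(a, b). box a b))"
    by (simp add: borel_eq_box)
  from stable Pow_UNIV_sub this show "(LINT x:A|lborel. F x) = 0"
  proof (induction rule: sigma_sets_induct_disjoint)
    case (basic A)
    then show ?case using 0 by auto
  next
    case empty
    then show ?case by (simp add: set_lebesgue_integral_def)
  next
    case (compl A)
    have A: "A \<in> sets borel" using compl(1) by (simp add: borel_eq_box)
    have "(LINT x:A \<union> (UNIV - A)|lborel. F x) = (LINT x:A|lborel. F x) + (LINT x:UNIV - A|lborel. F x)"
      by (rule set_integral_Un) (use A int in auto)
    then show ?case using compl(2) total by (simp add: set_lebesgue_integral_def)
  next
    case (union A)
    have A: "A i \<in> sets borel" for i using union(2) by (auto simp: borel_eq_box)
    have "(LINT x:(\<Union>i. A i)|lborel. F x) = suminf (\<lambda>i. LINT x:A i|lborel. F x)"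
      by (rule lebesgue_integral_countable_add) (use A union(1) int in \<open>auto simp: disjoint_family_on_def\<close>)
    then show ?case using union(3) by simp
  qed
qed

text \<open>The closed boxes are kept inside \<open>S\<close>, so that bumps over the boxes are test functions on \<open>S\<close>.\<close>
lemma countable_box_cover:
  fixes S :: "'a::euclidean_space set"
  assumes "open S"
  obtains D where "countable D" "\<Union>D = S"
    "\<forall>B\<in>D. \<exists>a b. B = box a b \<and> box a b \<noteq> {} \<and> cbox a b \<subseteq> S"
proof -
  define F where "F = {B. \<exists>a b. B = box a b \<and> box a b \<noteq> {} \<and> cbox a b \<subseteq> S}"
  have "\<And>B. B \<in> F \<Longrightarrow> open B" by (auto simp: F_def)
  then obtain D where D: "D \<subseteq> F" "countable D" "\<Union>D = \<Union>F"
    using Lindelof[of F] by metis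
  have "\<Union>F = S"
  proof
    show "\<Union>F \<subseteq> S" unfolding F_def using box_subset_cbox by blast
    show "S \<subseteq> \<Union>F"
    proof
      fix x assume "x \<in> S"
      from open_contains_cbox[OF assms this] obtain a b where "cbox a b \<subseteq> S" "x \<in> box a b" by metis
      then show "x \<in> \<Union>F" unfolding F_def by blast
    qed
  qed
  moreover have "\<forall>B\<in>D. \<exists>a b. B = box a b \<and> box a b \<noteq> {} \<and> cbox a b \<subseteq> S"
    using D(1) by (auto simp: F_def)
  ultimately show thesis using D(2,3) by (intro that[of D]) auto
qed

text \<open>Locally, \<open>g\<close> is recovered from its product \<open>F\<close> with one fixed bump, which is integrable.  Multiplying that
  bump by the bumps of a second box and letting them steepen shows that \<open>F\<close> has integral zero over
  every box.\<close>
lemma AE_zero_if_test_integrals_zero: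
  fixes g :: "real^'d::finite \<Rightarrow> complex"
  assumes "open S"
    and g: "\<And>f. f \<in> test_on S \<Longrightarrow> integrable lborel (\<lambda>x. g x * f x) \<and> (LINT x|lborel. g x * f x) = 0"
  shows "AE x in lborel. x \<in> S \<longrightarrow> g x = 0"
proof -
  obtain D where D: "countable D" "\<Union>D = S"
    "\<forall>B\<in>D. \<exists>a b. B = box a b \<and> box a b \<noteq> {} \<and> cbox a b \<subseteq> S"
    using countable_box_cover[OF assms(1)] by blast
  have "AE x in lborel. x \<in> B \<longrightarrow> g x = 0" if BD: "B \<in> D" for B
  proof -
    obtain a b where B: "B = box a b" "box a b \<noteq> {}" "cbox a b \<subseteq> S" 
      using D(3)[rule_format, OF BD] by (elim exE conjE) (rule that)
    \<comment> \<open>\<open>F\<close> is integrable, whereas \<open>g\<close> itself may fail to be integrable over the box.\<close>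
    define F where "F = (\<lambda>x. g x * complex_of_real (box_bump 0 a b x))"
    have bump: "(\<lambda>x. complex_of_real (box_bump 0 a b x)) \<in> test_on S"
      by (rule box_bump_test[OF B(2,3)])
    have F: "integrable lborel F" unfolding F_def using g[OF bump] by blast
    have "(LINT x:box c d|lborel. F x) = 0" for c d
    proof (cases "box c d = {}")
      case False
      have int: "(LINT x|lborel. F x * complex_of_real (box_bump N c d x)) = 0"
        and meas: "(\<lambda>x. F x * complex_of_real (box_bump N c d x)) \<in> borel_measurable lborel" for N
      proof -
        have "(\<lambda>x. complex_of_real (box_bump N c d x) * complex_of_real (box_bump 0 a b x)) \<in> test_on S"
          by (rule test_on_mult[OF assms(1) _ bump]) (rule smooth_on_subset[OF smooth_on_box_bump], simp)
        from g[OF this] show "(LINT x|lborel. F x * complex_of_real (box_bump N c d x)) = 0"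
          "(\<lambda>x. F x * complex_of_real (box_bump N c d x)) \<in> borel_measurable lborel"
          unfolding F_def by (auto simp: mult_ac)
      qed
      have "(\<lambda>N. LINT x|lborel. F x * complex_of_real (box_bump N c d x)) \<longlonglongrightarrow> (LINT x|lborel. F x * indicator (box c d) x)"
      proof (rule integral_dominated_convergence[where w="\<lambda>x. norm (F x)"])
        show "(\<lambda>x. F x * indicator (box c d) x) \<in> borel_measurable lborel"
          using borel_measurable_integrable[OF F] by measurable
        show "AE x in lborel. (\<lambda>N. F x * complex_of_real (box_bump N c d x)) \<longlonglongrightarrow> F x * indicator (box c d) x"
        proof (rule AE_I2)
          fix x
          have "(\<lambda>N. complex_of_real (box_bump N c d x)) \<longlonglongrightarrow> complex_of_real (indicator (box c d) x)"
            by (intro tendsto_of_real box_bump_tendsto False)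
          then show "(\<lambda>N. F x * complex_of_real (box_bump N c d x)) \<longlonglongrightarrow> F x * indicator (box c d) x"
            by (intro tendsto_mult tendsto_const) (cases "x \<in> box c d"; simp)
        qed
        show "AE x in lborel. norm (F x * complex_of_real (box_bump N c d x)) \<le> norm (F x)" for N
          using box_bump_bounds[of N c d] by (intro AE_I2) (simp add: norm_mult mult_left_le)
      qed (use F meas in auto)
      then have "(LINT x|lborel. F x * indicator (box c d) x) = 0"
        by (simp add: int LIMSEQ_const_iff)
      moreover have "F x * indicator (box c d) x = indicat_real (box c d) x *\<^sub>R F x" for x
        by (simp add: indicator_def)
      ultimately show ?thesis by (simp add: set_lebesgue_integral_def)
    qed (simp add: set_lebesgue_integral_def)
    then have "AE x in lborel. F x = 0" by (rule AE_zero_if_box_integrals_zero[OF F])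
    then show ?thesis
    proof eventually_elim
      case (elim x)
      then show ?case using box_bump_pos_iff[OF B(2), of 0 x] by (auto simp: F_def B(1))
    qed
  qed
  then have "AE x in lborel. \<forall>B\<in>D. x \<in> B \<longrightarrow> g x = 0" 
    unfolding AE_ball_countable[OF D(1)] by blast
  then have "AE x in lborel. x \<in> \<Union>D \<longrightarrow> g x = 0" by eventually_elim blast
  then show ?thesis by (simp only: D(2))
qed

text \<open>On each box of a countable cover, divide the product with a bump by the bump.\<close>
lemma borel_measurable_if_test_products:
  fixes g :: "real^'d::finite \<Rightarrow> complex"
  assumes g: "\<And>f. f \<in> test_on (- {z}) \<Longrightarrow> (\<lambda>x. g x * f x) \<in> borel_measurable borel"
  shows "g \<in> borel_measurable borel"
proof -
  have cov: "open (- {z})" by (simp add: open_Compl)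
  obtain D where D: "countable D" "\<Union>D = - {z}"
    "\<forall>B\<in>D. \<exists>a b. B = box a b \<and> box a b \<noteq> {} \<and> cbox a b \<subseteq> - {z}"
    by (rule countable_box_cover[OF cov]) (rule that; assumption)
  have box: "(\<lambda>x. indicator B x *\<^sub>R g x) \<in> borel_measurable borel" "open B" if BD: "B \<in> D" for B
  proof -
    obtain a b where B: "B = box a b" "box a b \<noteq> {}" "cbox a b \<subseteq> - {z}" 
      using D(3)[rule_format, OF BD] by (elim exE conjE) (rule that)
    let ?f = "\<lambda>x. complex_of_real (box_bump 0 a b x)"
    have "continuous_on UNIV ?f" by (rule smooth_on_continuous[OF smooth_on_box_bump])
    then have [measurable]: "?f \<in> borel_measurable borel" by (rule borel_measurable_continuous_onI)
    have [measurable]: "(\<lambda>x. g x * ?f x) \<in> borel_measurable borel"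
      by (rule g[OF box_bump_test[OF B(2,3)]])
    have "(\<lambda>x. indicator (box a b) x *\<^sub>R ((g x * ?f x) / ?f x)) \<in> borel_measurable borel" by measurable
    also have "(\<lambda>x. indicator (box a b) x *\<^sub>R ((g x * ?f x) / ?f x)) = (\<lambda>x. indicator B x *\<^sub>R g x)"
    proof
      fix x
      show "indicator (box a b) x *\<^sub>R ((g x * ?f x) / ?f x) = indicator B x *\<^sub>R g x"
        using box_bump_pos_iff[OF B(2), of 0 x] by (cases "x \<in> box a b") (auto simp: B(1))
    qed
    finally show "(\<lambda>x. indicator B x *\<^sub>R g x) \<in> borel_measurable borel" .
    show "open B" by (simp add: B(1) open_box)
  qed
  show ?thesis
  proof (rule measurable_piecewise_restrict[of "insert {z} D"])
    show "\<Omega> \<inter> space borel \<in> sets borel" if "\<Omega> \<in> insert {z} D" for \<Omega>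
      using that box(2) by auto
    show "g \<in> borel_measurable (restrict_space borel \<Omega>)" if "\<Omega> \<in> insert {z} D" for \<Omega>
    proof (cases "\<Omega> \<in> D")
      case True
      then show ?thesis using box[OF True] by (subst borel_measurable_restrict_space_iff) auto
    next
      case False
      then have \<Omega>: "\<Omega> = {z}" using that by simp
      have "(\<lambda>x. indicator {z} x *\<^sub>R g x) = (\<lambda>x. indicator {z} x *\<^sub>R g z)" by (auto simp: indicator_def)
      then show ?thesis unfolding \<Omega> by (subst borel_measurable_restrict_space_iff) auto
    qed
  qed (use D in auto)
qed

section \<open>Integration of Schwartz functions\<close>

text \<open>Compare with \<open>\<Sum>n. (n + 1)\<^bsup>-(d + 2)\<^esup> 1\<^bsub>{\<parallel>x\<parallel> \<le> n + 1}\<^esub>\<close>: the volume \<open>V (n + 1)\<^sup>d\<close> of the balls leaves the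
  convergent series of \<open>(n + 1)\<^bsup>-2\<^esup>\<close>.\<close>
lemma integrable_if_decay:
  fixes f :: "'a::euclidean_space \<Rightarrow> 'b::{banach, second_countable_topology}"
  assumes [measurable]: "f \<in> borel_measurable borel"
    and C: "\<And>x. (1 + norm x) ^ (DIM('a) + 2) * norm (f x) \<le> C"
  shows "integrable lborel f"
proof (rule integrableI_bounded)
  let ?N = "DIM('a) + 2" and ?V = "unit_ball_vol (real DIM('a))"
  have "(1 + norm (0::'a)) ^ ?N * norm (f 0) \<le> C" by (rule C)
  then have C0: "0 \<le> C" by (simp add: order_trans[OF norm_ge_zero])
  have V0: "0 \<le> ?V" by simp
  have bound: "ennreal (norm (f x)) \<le> suminf (\<lambda>n. ennreal (C / real (Suc n) ^ ?N) * indicator (cball 0 (real (Suc n))) x)" for x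
  proof -
    \<comment> \<open>A single term of the series, the one of the shell containing \<open>x\<close>, already dominates.\<close>
    define n where "n = nat \<lfloor>norm x\<rfloor>"
    have n: "real n \<le> norm x" unfolding n_def by (rule of_nat_floor) simp
    have n': "norm x \<le> real (Suc n)"
      using le_nat_floor[of "Suc n" "norm x"] unfolding n_def by (meson Suc_n_not_le_n linorder_le_cases)
    have "real (Suc n) ^ ?N \<le> (1 + norm x) ^ ?N" using n by (intro power_mono) auto
    then have "real (Suc n) ^ ?N * norm (f x) \<le> C"
      using C[of x] mult_right_mono[of _ _ "norm (f x)"] by fastforce
    then have "norm (f x) \<le> C / real (Suc n) ^ ?N"
      by (simp add: pos_le_divide_eq mult.commute del: of_nat_Suc power_Suc)
    then have "ennreal (norm (f x)) \<le> (\<Sum>n\<in>{n}. ennreal (C / real (Suc n) ^ ?N) * indicator (cball 0 (real (Suc n))) x)"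
      using n' by (simp add: ennreal_leI del: of_nat_Suc power_Suc)
    also have "\<dots> \<le> suminf (\<lambda>n. ennreal (C / real (Suc n) ^ ?N) * indicator (cball 0 (real (Suc n))) x)"
      by (rule sum_le_suminf) auto
    finally show ?thesis .
  qed
  have ball_term: "(\<integral>\<^sup>+x. ennreal (C / real (Suc n) ^ ?N) * indicator (cball (0::'a) (real (Suc n))) x \<partial>lborel)
      = ennreal (C * ?V * inverse (real (Suc n) ^ 2))" for n
  proof -
    have "(\<integral>\<^sup>+x. ennreal (C / real (Suc n) ^ ?N) * indicator (cball (0::'a) (real (Suc n))) x \<partial>lborel)
        = ennreal (C / real (Suc n) ^ ?N) * ennreal (?V * real (Suc n) ^ DIM('a))"
      by (subst nn_integral_cmult_indicator) (auto simp: emeasure_cball simp del: of_nat_Suc)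
    also have "\<dots> = ennreal (C / real (Suc n) ^ ?N * (?V * real (Suc n) ^ DIM('a)))"
      using C0 V0 by (intro ennreal_mult[symmetric]) (auto simp del: of_nat_Suc)
    also have "C / real (Suc n) ^ ?N * (?V * real (Suc n) ^ DIM('a)) = C * ?V * inverse (real (Suc n) ^ 2)"
      by (simp only: power_add) (simp add: field_simps del: of_nat_Suc)
    finally show ?thesis .
  qed
  have "(\<integral>\<^sup>+x. ennreal (norm (f x)) \<partial>lborel)
      \<le> (\<integral>\<^sup>+x. suminf (\<lambda>n. ennreal (C / real (Suc n) ^ ?N) * indicator (cball (0::'a) (real (Suc n))) x) \<partial>lborel)"
    by (rule nn_integral_mono) (rule bound)
  also have "\<dots> = suminf (\<lambda>n. ennreal (C * ?V * inverse (real (Suc n) ^ 2)))"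
  proof (subst nn_integral_suminf)
    show "(\<lambda>x. ennreal (C / real (Suc n) ^ ?N) * indicator (cball (0::'a) (real (Suc n))) x) \<in> borel_measurable lborel" for n
      by (intro borel_measurable_times_ennreal borel_measurable_const borel_measurable_indicator) simp
  qed (simp only: ball_term)
  also have "\<dots> < \<infinity>"
  proof -
    have "summable (\<lambda>n. C * ?V * inverse (real (Suc n) ^ 2))"
      using inverse_power_summable[of 2, where 'a=real] by (intro summable_mult) (subst summable_Suc_iff, simp)
    then show ?thesis
      using C0 V0 by (subst suminf_ennreal2) (auto simp del: of_nat_Suc)
  qed
  finally show "(\<integral>\<^sup>+x. ennreal (norm (f x)) \<partial>lborel) < \<infinity>" .
qed simp

lemma schwartz_measurable [measurable_dest]: "f \<in> schwartz \<Longrightarrow> f \<in> borel_measurable borel"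
  by (intro borel_measurable_continuous_onI schwartz_continuous)

lemma schwartz_integrable:
  assumes "f \<in> schwartz"
  shows "integrable lborel f"
proof -
  obtain C where "0 \<le> C" "\<And>x. (1 + norm x) ^ (DIM(real^'a) + 2) * norm (f x) \<le> C"
    by (rule rapid_weight[OF schwartz_rapid[OF assms], of "DIM(real^'a) + 2"]) blast
  then show ?thesis by (intro integrable_if_decay schwartz_measurable assms)
qed

lemma lborel_affine_integral:
  fixes F :: "'a::euclidean_space \<Rightarrow> 'b::{banach, second_countable_topology}"
  assumes [measurable]: "F \<in> borel_measurable borel" and "c \<noteq> 0"
  shows "(LINT y|lborel. F y) = \<bar>c\<bar> ^ DIM('a) *\<^sub>R (LINT z|lborel. F (t + c *\<^sub>R z))"
    and "integrable lborel F \<Longrightarrow> integrable lborel (\<lambda>z. F (t + c *\<^sub>R z))"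
proof -
  let ?D = "distr lborel borel (\<lambda>x. t + c *\<^sub>R x) :: 'a measure"
  have L: "lborel = density ?D (\<lambda>_. ennreal (\<bar>c\<bar> ^ DIM('a)))"
    using lborel_affine[OF assms(2), of t] by (simp add: ennreal_power)
  have "(LINT y|lborel. F y) = (LINT y|density ?D (\<lambda>_. ennreal (\<bar>c\<bar> ^ DIM('a))). F y)"
    using L by simp
  also have "\<dots> = (LINT y|?D. \<bar>c\<bar> ^ DIM('a) *\<^sub>R F y)"
    by (rule integral_density) auto
  also have "\<dots> = (LINT z|lborel. \<bar>c\<bar> ^ DIM('a) *\<^sub>R F (t + c *\<^sub>R z))"
    by (rule integral_distr) auto
  finally show "(LINT y|lborel. F y) = \<bar>c\<bar> ^ DIM('a) *\<^sub>R (LINT z|lborel. F (t + c *\<^sub>R z))" by simp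
  assume "integrable lborel F"
  then have "integrable (density ?D (\<lambda>_. ennreal (\<bar>c\<bar> ^ DIM('a)))) F"
    using L by simp
  then have "integrable ?D (\<lambda>y. \<bar>c\<bar> ^ DIM('a) *\<^sub>R F y)"
    by (subst (asm) integrable_density) auto
  then have "integrable lborel (\<lambda>z. \<bar>c\<bar> ^ DIM('a) *\<^sub>R F (t + c *\<^sub>R z))"
    by (subst (asm) integrable_distr_eq) auto
  then have "integrable lborel (\<lambda>z. inverse (\<bar>c\<bar> ^ DIM('a)) *\<^sub>R (\<bar>c\<bar> ^ DIM('a) *\<^sub>R F (t + c *\<^sub>R z)))"
    by (rule integrable_scaleR_right)
  then show "integrable lborel (\<lambda>z. F (t + c *\<^sub>R z))"
    using assms(2) by simp
qed

lemma line_derivative: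
  assumes "\<And>y. f differentiable (at y)"
  shows "((\<lambda>s. f (x + s *\<^sub>R axis j 1)) has_vector_derivative partial j f (x + s *\<^sub>R axis j 1)) (at s)"
proof -
  obtain f' where f': "(f has_derivative f') (at (x + s *\<^sub>R axis j 1))"
    using assms unfolding differentiable_def by blast
  have "((\<lambda>t. f (x + t *\<^sub>R axis j 1)) has_derivative (\<lambda>t. f' (t *\<^sub>R axis j 1))) (at s)"
    by (rule has_derivative_compose[of _ _ _ _ f f'])
       (auto intro!: derivative_eq_intros simp: f')
  moreover have "f' (t *\<^sub>R axis j 1) = t *\<^sub>R f' (axis j 1)" for t
    using f' by (simp add: has_derivative_bounded_linear linear_simps)
  ultimately show ?thesis
    by (simp add: has_vector_derivative_def partial_eqI[OF f'])
qed

lemma difference_quotient_bound: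
  assumes "\<And>y. f differentiable (at y)" "0 < t"
    and B: "\<And>s. 0 \<le> s \<Longrightarrow> s \<le> t \<Longrightarrow> norm (partial j f (x + s *\<^sub>R axis j 1)) \<le> B"
  shows "norm ((f (x + t *\<^sub>R axis j 1) - f x) /\<^sub>R t) \<le> B"
proof -
  have "norm (f (x + t *\<^sub>R axis j 1) - f (x + 0 *\<^sub>R axis j 1)) \<le> B * norm (t - 0)"
  proof (rule differentiable_bound[of "{0..t}" "\<lambda>s. f (x + s *\<^sub>R axis j 1)"])
    show "((\<lambda>s. f (x + s *\<^sub>R axis j 1)) has_derivative (\<lambda>h. h *\<^sub>R partial j f (x + s *\<^sub>R axis j 1))) (at s within {0..t})" for s
      using line_derivative[OF assms(1), where x = x and j = j and s = s] unfolding has_vector_derivative_def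
      by (rule has_derivative_at_withinI)
    show "onorm (\<lambda>h. h *\<^sub>R partial j f (x + s *\<^sub>R axis j 1)) \<le> B" if "s \<in> {0..t}" for s
      using B[of s] that by (intro onorm_le) (auto simp: mult.commute[of B] intro!: mult_left_mono)
  qed (use assms(2) in auto)
  then show ?thesis using assms(2) by (simp add: divide_inverse_commute[symmetric] pos_divide_le_eq)
qed

text \<open>Difference quotients have integral zero by translation invariance, and dominated convergence passes
  to the derivative.  The majorant exists because the weights \<open>1 + \<parallel>x\<parallel>\<close> of points at distance at most
  one differ at most by the factor two.\<close>
lemma integral_partial_eq_0:
  fixes f :: "real^'d::finite \<Rightarrow> complex"
  assumes "f \<in> schwartz"
  shows "(LINT x|lborel. partial j f x) = 0"
proof -
  note diff = schwartz_differentiable[OF assms]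
  note [measurable] = schwartz_measurable[OF assms] schwartz_measurable[OF schwartz_partial[OF assms]]
  let ?N = "DIM(real^'d) + 2"
  let ?t = "\<lambda>n. inverse (real (Suc n))" and ?e = "axis j 1 :: real^'d"
  let ?q = "\<lambda>n x. (f (x + ?t n *\<^sub>R ?e) - f x) /\<^sub>R ?t n"
  obtain C where C: "0 \<le> C" "\<And>x. (1 + norm x) ^ ?N * norm (partial j f x) \<le> C"
    by (rule rapid_weight[OF schwartz_rapid[OF schwartz_partial[OF assms, of j]], of ?N]) blast
  define w :: "real^'d \<Rightarrow> real" where "w x = 2 ^ ?N * C / (1 + norm x) ^ ?N" for x
  have pos: "0 < 1 + norm x" for x :: "real^'d" by (simp add: add_pos_nonneg)
  have "integrable lborel w"
  proof (rule integrable_if_decay[where C = "2 ^ ?N * C"])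
    show "w \<in> borel_measurable borel" unfolding w_def by measurable
    fix x :: "real^'d"
    have "(1 + norm x) ^ ?N * norm (w x) = (1 + norm x) ^ ?N * (2 ^ ?N * C / (1 + norm x) ^ ?N)"
      unfolding w_def using C(1) pos[of x] by simp
    also have "\<dots> = 2 ^ ?N * C" using pos[of x] by (simp del: power_Suc power_add)
    finally show "(1 + norm x) ^ ?N * norm (w x) \<le> 2 ^ ?N * C" by simp
  qed
  moreover have bound: "norm (?q n x) \<le> w x" for n x
  proof (rule difference_quotient_bound[OF diff])
    fix s :: real assume s: "0 \<le> s" "s \<le> ?t n"
    have "?t n \<le> 1" by (simp add: inverse_le_1_iff)
    with s have s1: "\<bar>s\<bar> \<le> 1" by linarith
    let ?y = "x + s *\<^sub>R ?e"
    have "norm x \<le> norm ?y + norm (s *\<^sub>R ?e)" using norm_triangle_ineq4[of ?y "s *\<^sub>R ?e"] by simp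
    moreover have "norm (s *\<^sub>R ?e) \<le> 1" using s1 by simp
    moreover have "a \<le> b + c \<Longrightarrow> c \<le> 1 \<Longrightarrow> 0 \<le> b \<Longrightarrow> 1 + a \<le> 2 * (1 + b)" for a b c :: real by simp
    ultimately have "1 + norm x \<le> 2 * (1 + norm ?y)" using norm_ge_zero by blast
    then have "(1 + norm x) ^ ?N \<le> (2 * (1 + norm ?y)) ^ ?N" by (intro power_mono) auto
    then have "(1 + norm x) ^ ?N * norm (partial j f ?y) \<le> (2 * (1 + norm ?y)) ^ ?N * norm (partial j f ?y)"
      by (rule mult_right_mono) simp
    also have "\<dots> = 2 ^ ?N * ((1 + norm ?y) ^ ?N * norm (partial j f ?y))"
      by (simp only: power_mult_distrib mult.assoc)
    also have "\<dots> \<le> 2 ^ ?N * C" by (intro mult_left_mono C) simp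
    finally show "norm (partial j f ?y) \<le> w x"
      unfolding w_def using pos[of x] by (simp add: pos_le_divide_eq mult.commute del: power_Suc power_add)
  qed simp
  moreover have "(\<lambda>n. ?q n x) \<longlonglongrightarrow> partial j f x" for x
  proof -
    have "((\<lambda>s. f (x + s *\<^sub>R ?e)) has_vector_derivative partial j f x) (at 0)"
      using line_derivative[OF diff, where x = x and j = j and s = 0] by simp
    then have "((\<lambda>s. norm (f (x + s *\<^sub>R ?e) - f x - s *\<^sub>R partial j f x) / norm s) \<longlongrightarrow> 0) (at 0)"
      by (simp add: has_vector_derivative_def has_derivative_at)
    moreover have "\<forall>\<^sub>F s in at 0. norm (f (x + s *\<^sub>R ?e) - f x - s *\<^sub>R partial j f x) / norm s
        = norm ((f (x + s *\<^sub>R ?e) - f x) /\<^sub>R s - partial j f x)"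
    proof (rule eventually_at_filter[THEN iffD2], rule always_eventually, intro allI impI)
      fix s :: real assume "s \<noteq> 0"
      then have "(f (x + s *\<^sub>R ?e) - f x - s *\<^sub>R partial j f x) /\<^sub>R s = (f (x + s *\<^sub>R ?e) - f x) /\<^sub>R s - partial j f x"
        by (simp add: scaleR_diff_right)
      from arg_cong[OF this, of norm] show "norm (f (x + s *\<^sub>R ?e) - f x - s *\<^sub>R partial j f x) / norm s
        = norm ((f (x + s *\<^sub>R ?e) - f x) /\<^sub>R s - partial j f x)"
        by (simp add: divide_inverse_commute)
    qed
    ultimately have "((\<lambda>s. norm ((f (x + s *\<^sub>R ?e) - f x) /\<^sub>R s - partial j f x)) \<longlongrightarrow> 0) (at 0)"
      by (rule Lim_transform_eventually)
    then have "((\<lambda>s. (f (x + s *\<^sub>R ?e) - f x) /\<^sub>R s) \<longlongrightarrow> partial j f x) (at 0)"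
      by (rule LIM_zero_cancel[OF tendsto_norm_zero_cancel])
    moreover have "filterlim ?t (at 0) sequentially"
      by (rule filterlim_atI[OF LIMSEQ_inverse_real_of_nat]) simp
    ultimately show ?thesis by (rule filterlim_compose)
  qed
  ultimately have "(\<lambda>n. LINT x|lborel. ?q n x) \<longlonglongrightarrow> (LINT x|lborel. partial j f x)"
    by (intro integral_dominated_convergence[where w = w]) auto
  moreover have "(LINT x|lborel. ?q n x) = 0" for n
  proof -
    have i: "integrable lborel f" "integrable lborel (\<lambda>x. f (x + ?t n *\<^sub>R ?e))"
      using schwartz_integrable[OF assms] lborel_affine_integral(2)[of f 1 "?t n *\<^sub>R ?e"] by (simp_all add: add.commute)
    have "(LINT x|lborel. f (x + ?t n *\<^sub>R ?e)) = (LINT x|lborel. f x)"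
      using lborel_affine_integral(1)[of f 1 "?t n *\<^sub>R ?e"] by (simp add: add.commute)
    then show ?thesis using i by simp
  qed
  ultimately show ?thesis by (simp add: LIMSEQ_const_iff)
qed

section \<open>The Fourier transform on Schwartz space\<close>

abbreviation character :: "real^'d::finite \<Rightarrow> real^'d \<Rightarrow> complex" where
  "character \<omega> x \<equiv> exp (\<i> * complex_of_real (\<omega> \<bullet> x))"

lemma character_measurable [measurable]: "character \<omega> \<in> borel_measurable borel"
  by (intro borel_measurable_continuous_onI continuous_intros)

lemma has_derivative_character:
  "(character \<omega> has_derivative (\<lambda>h. \<i> * complex_of_real (\<omega> \<bullet> h) * character \<omega> x)) (at x)"
proof -
  have "((\<lambda>x. \<i> * complex_of_real (\<omega> \<bullet> x)) has_derivative (\<lambda>h. \<i> * complex_of_real (\<omega> \<bullet> h))) (at x)"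
    by (auto intro!: derivative_eq_intros)
  from has_derivative_compose[OF this DERIV_exp[unfolded has_field_derivative_def]]
  show ?thesis by (simp add: mult_ac)
qed

lemma partial_character: "partial j (character \<omega>) = (\<lambda>x. (\<i> * complex_of_real (\<omega> $ j)) * character \<omega> x)"
  by (simp add: fun_eq_iff partial_eqI[OF has_derivative_character] inner_axis)

text \<open>Differentiation multiplies a character by a constant, so no derivative grows.\<close>
lemma multiplier_character: "multiplier (character \<omega>)"
proof -
  have bd: "poly_bounded (character \<omega>)"
    unfolding poly_bounded_def by (intro exI[of _ 1] exI[of _ 0]) simp
  have "partials_upto poly_bounded UNIV n (character \<omega>)" for n
  proof (induction n)
    case 0
    then show ?case using bd has_derivative_character by (auto simp: differentiable_def)
  next
    case (Suc n)
    have "partials_upto poly_bounded UNIV n (partial j (character \<omega>))" for j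
      unfolding partial_character
      by (rule partials_upto_mult[OF open_UNIV agree_on_UNIV, where B'=poly_bounded])
         (auto intro: Suc.IH partials_upto_const poly_bounded_const poly_bounded_add poly_bounded_mult)
    then show ?case using bd has_derivative_character by (auto simp: differentiable_def)
  qed
  then show ?thesis by (simp add: multiplier_def)
qed

lemma fourier_integrable:
  "f \<in> schwartz \<Longrightarrow> integrable lborel (\<lambda>x. f x * character \<omega> x)"
  using schwartz_integrable[OF schwartz_mult[OF multiplier_character]] by (simp add: mult.commute)

lemma multiplier_coord_i: "multiplier (\<lambda>x. \<i> * complex_of_real (x $ j))"
  by (intro multiplier_mult multiplier_const multiplier_coord)

lemma norm_exp_i_remainder: "norm (exp (\<i> * complex_of_real t) - 1 - \<i> * complex_of_real t) \<le> t\<^sup>2"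
  using Taylor_exp[of "\<i> * complex_of_real t" 1] by (simp add: norm_mult power2_eq_square abs_mult_self_eq diff_diff_eq)

text \<open>The remainder of \<open>exp (\<i> h \<bullet> x)\<close> after the linear term is at most \<open>(h \<bullet> x)\<^sup>2 \<le> \<parallel>h\<parallel>\<^sup>2 \<parallel>x\<parallel>\<^sup>2\<close>, and \<open>\<parallel>x\<parallel>\<^sup>2 \<bar>f x\<bar>\<close> is
  integrable; hence the error is \<open>O(\<parallel>h\<parallel>\<^sup>2)\<close>.\<close>
lemma has_derivative_fourier:
  fixes f :: "real^'d::finite \<Rightarrow> complex"
  assumes f: "f \<in> schwartz"
  shows "(fourier f has_derivative
    (\<lambda>h. \<Sum>j\<in>UNIV. complex_of_real (h $ j) * fourier (\<lambda>x. \<i> * complex_of_real (x $ j) * f x) \<omega>)) (at \<omega>)"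
proof -
  let ?g = "\<lambda>j x. \<i> * complex_of_real (x $ j) * f x"
  let ?L = "\<lambda>h :: real^'d. \<Sum>j\<in>UNIV. complex_of_real (h $ j) * fourier (?g j) \<omega>"
  have g: "?g j \<in> schwartz" for j by (rule schwartz_mult[OF multiplier_coord_i f])
  have "(\<lambda>x. (\<Sum>j\<in>UNIV. complex_of_real (x $ j) * complex_of_real (x $ j)) * f x) \<in> schwartz"
    by (intro schwartz_mult multiplier_sum multiplier_mult multiplier_coord f)
  from integrable_norm[OF schwartz_integrable[OF this]]
  have sq: "integrable lborel (\<lambda>x. (norm x)\<^sup>2 * norm (f x))"
    by (simp add: norm_mult power2_norm_eq_inner inner_vec_def norm_of_real abs_of_nonneg sum_nonneg flip: of_real_mult of_real_sum)
  define M where "M = (LINT x|lborel. (norm x)\<^sup>2 * norm (f x))"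
  have bound: "norm (fourier f (\<omega> + h) - fourier f \<omega> - ?L h) \<le> M * (norm h)\<^sup>2" for h
  proof -
    let ?r = "\<lambda>x. f x * character \<omega> x * (exp (\<i> * complex_of_real (h \<bullet> x)) - 1 - \<i> * complex_of_real (h \<bullet> x))"
    have int: "integrable lborel (\<lambda>x. f x * character (\<omega> + h) x)" "integrable lborel (\<lambda>x. f x * character \<omega> x)"
       "integrable lborel (\<lambda>x. \<Sum>j\<in>UNIV. complex_of_real (h $ j) * (?g j x * character \<omega> x))"
      by (intro fourier_integrable f g Bochner_Integration.integrable_sum integrable_mult_right)+
    have "?L h = (LINT x|lborel. (\<Sum>j\<in>UNIV. complex_of_real (h $ j) * (?g j x * character \<omega> x)))"
      unfolding fourier_def
      by (subst Bochner_Integration.integral_sum)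
         (simp_all only: integral_mult_right_zero integrable_mult_right[OF fourier_integrable[OF g]])
    then have "fourier f (\<omega> + h) - fourier f \<omega> - ?L h =
      (LINT x|lborel. f x * character (\<omega> + h) x - f x * character \<omega> x - (\<Sum>j\<in>UNIV. complex_of_real (h $ j) * (?g j x * character \<omega> x)))"
      using int by (simp add: fourier_def)
    also have "\<dots> = (LINT x|lborel. ?r x)"
    proof (rule Bochner_Integration.integral_cong)
      fix x
      have "(\<Sum>j\<in>UNIV. complex_of_real (h $ j) * (?g j x * character \<omega> x)) = f x * character \<omega> x * (\<i> * complex_of_real (h \<bullet> x))"
      proof -
        have "complex_of_real (h \<bullet> x) = (\<Sum>j\<in>UNIV. complex_of_real (h $ j) * complex_of_real (x $ j))"
          by (simp add: inner_vec_def)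
        then show ?thesis by (simp only: sum_distrib_left) (simp add: mult_ac)
      qed
      moreover have "character (\<omega> + h) x = character \<omega> x * exp (\<i> * complex_of_real (h \<bullet> x))"
        by (simp add: inner_add_left distrib_left exp_add)
      ultimately show "f x * character (\<omega> + h) x - f x * character \<omega> x - (\<Sum>j\<in>UNIV. complex_of_real (h $ j) * (?g j x * character \<omega> x)) = ?r x"
        by (simp add: algebra_simps)
    qed simp
    finally have eq: "fourier f (\<omega> + h) - fourier f \<omega> - ?L h = (LINT x|lborel. ?r x)" .
    have "norm (LINT x|lborel. ?r x) \<le> (LINT x|lborel. (norm h)\<^sup>2 * ((norm x)\<^sup>2 * norm (f x)))"
    proof (rule Bochner_Integration.integral_norm_bound_integral)
      show "integrable lborel (\<lambda>x. (norm h)\<^sup>2 * ((norm x)\<^sup>2 * norm (f x)))"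
        using sq by (rule integrable_mult_right)
      show b: "norm (?r x) \<le> (norm h)\<^sup>2 * ((norm x)\<^sup>2 * norm (f x))" for x
      proof -
        have "norm (exp (\<i> * complex_of_real (h \<bullet> x)) - 1 - \<i> * complex_of_real (h \<bullet> x)) \<le> (h \<bullet> x)\<^sup>2"
          by (rule norm_exp_i_remainder)
        also have "\<dots> \<le> (norm h * norm x)\<^sup>2"
          using power_mono[OF Cauchy_Schwarz_ineq2[of h x], of 2] by simp
        finally have "norm (?r x) \<le> norm (f x) * (norm h * norm x)\<^sup>2"
          by (simp add: norm_mult mult_left_mono)
        then show ?thesis by (simp add: power_mult_distrib mult_ac)
      qed
      show "integrable lborel ?r"
      proof (rule Bochner_Integration.integrable_bound)
        show "integrable lborel (\<lambda>x. (norm h)\<^sup>2 * ((norm x)\<^sup>2 * norm (f x)))"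
          using sq by (rule integrable_mult_right)
        show "?r \<in> borel_measurable lborel" using schwartz_measurable[OF f] by measurable
        show "AE x in lborel. norm (?r x) \<le> norm ((norm h)\<^sup>2 * ((norm x)\<^sup>2 * norm (f x)))"
          using b by (intro AE_I2) (simp add: abs_mult)
      qed
    qed
    then show ?thesis unfolding eq M_def by (simp add: mult.commute)
  qed
  show ?thesis
  proof (rule has_derivativeI_sandwich[of 1 _ _ _ _ "\<lambda>y. M * norm (y - \<omega>)"])
    show "bounded_linear ?L"
      by (intro bounded_linear_sum bounded_linear_mult_const bounded_linear_compose[OF bounded_linear_of_real]
            bounded_linear_vec_nth)
    show "((\<lambda>y. M * norm (y - \<omega>)) \<longlongrightarrow> 0) (at \<omega>)"
      by (intro tendsto_mult_right_zero tendsto_norm_zero LIM_zero tendsto_ident_at)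
    fix y assume "y \<noteq> \<omega>"
    then have "norm (fourier f y - fourier f \<omega> - ?L (y - \<omega>)) / norm (y - \<omega>) \<le> M * (norm (y - \<omega>))\<^sup>2 / norm (y - \<omega>)"
      using bound[of "y - \<omega>"] by (intro divide_right_mono) auto
    also have "\<dots> = M * norm (y - \<omega>)" by (simp add: power2_eq_square)
    finally show "norm (fourier f y - fourier f \<omega> - ?L (y - \<omega>)) / norm (y - \<omega>) \<le> M * norm (y - \<omega>)" .
  qed simp
qed

lemma partial_fourier:
  assumes "f \<in> schwartz"
  shows "partial j (fourier f) = fourier (\<lambda>x. \<i> * complex_of_real (x $ j) * f x)"
proof
  fix \<omega>
  have "partial j (fourier f) \<omega> = (\<Sum>i\<in>UNIV. complex_of_real (axis j 1 $ i) * fourier (\<lambda>x. \<i> * complex_of_real (x $ i) * f x) \<omega>)"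
    by (rule partial_eqI[OF has_derivative_fourier[OF assms]])
  also have "\<dots> = (\<Sum>i\<in>UNIV. if i = j then fourier (\<lambda>x. \<i> * complex_of_real (x $ i) * f x) \<omega> else 0)"
    by (intro sum.cong) (auto simp: axis_def)
  finally show "partial j (fourier f) \<omega> = fourier (\<lambda>x. \<i> * complex_of_real (x $ j) * f x) \<omega>" by simp
qed

text \<open>Integration by parts: the product of \<open>f\<close> with a character is a Schwartz function, so its partial
  derivative has integral zero.\<close>
lemma fourier_partial:
  assumes f: "f \<in> schwartz"
  shows "fourier (partial j f) \<omega> = - \<i> * complex_of_real (\<omega> $ j) * fourier f \<omega>"
proof -
  have "(\<lambda>x. character \<omega> x * f x) \<in> schwartz" by (rule schwartz_mult[OF multiplier_character f])
  from integral_partial_eq_0[OF this, of j]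
  have "0 = (LINT x|lborel. partial j f x * character \<omega> x + (\<i> * complex_of_real (\<omega> $ j)) * (f x * character \<omega> x))"
  proof -
    have "partial j (\<lambda>x. character \<omega> x * f x) x = partial j f x * character \<omega> x + (\<i> * complex_of_real (\<omega> $ j)) * (f x * character \<omega> x)" for x
      using has_derivative_character[of \<omega>] schwartz_differentiable[OF f]
      by (subst partial_mult) (auto simp: partial_character differentiable_def)
    with \<open>(LINT x|lborel. partial j (\<lambda>x. character \<omega> x * f x) x) = 0\<close> show ?thesis by simp
  qed
  also have "\<dots> = fourier (partial j f) \<omega> + \<i> * complex_of_real (\<omega> $ j) * fourier f \<omega>"
    using fourier_integrable[OF f] fourier_integrable[OF schwartz_partial[OF f]] by (simp add: fourier_def)
  finally show ?thesis by (simp add: eq_neg_iff_add_eq_0)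
qed

lemma norm_fourier_le: "norm (fourier f \<omega>) \<le> (LINT x|lborel. norm (f x))"
proof -
  have "norm (fourier f \<omega>) \<le> (LINT x|lborel. norm (f x * character \<omega> x))"
    unfolding fourier_def by (rule integral_norm_bound)
  then show ?thesis by (simp add: norm_mult)
qed

text \<open>Each factor \<open>\<parallel>\<omega>\<parallel> \<le> \<Sum>j. \<bar>\<omega>\<^sub>j\<bar>\<close> is exchanged for a derivative of \<open>f\<close>.\<close>
lemma rapid_fourier:
  assumes "f \<in> schwartz"
  shows "rapid (fourier f)"
proof -
  have "\<exists>C. \<forall>\<omega>. norm \<omega> ^ N * norm (fourier f \<omega>) \<le> C" for N
    using assms
  proof (induction N arbitrary: f)
    case 0
    then show ?case using norm_fourier_le[of f] by auto
  next
    case (Suc N)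
    have "\<forall>j. \<exists>C. \<forall>\<omega>. norm \<omega> ^ N * norm (fourier (partial j f) \<omega>) \<le> C"
      using Suc.IH schwartz_partial[OF Suc.prems] by blast
    then obtain C where C: "\<And>j \<omega>. norm \<omega> ^ N * norm (fourier (partial j f) \<omega>) \<le> C j" by metis
    have "norm \<omega> ^ Suc N * norm (fourier f \<omega>) \<le> (\<Sum>j\<in>UNIV. C j)" for \<omega>
    proof -
      have "norm \<omega> ^ Suc N * norm (fourier f \<omega>) = norm \<omega> ^ N * (norm \<omega> * norm (fourier f \<omega>))" by simp
      also have "\<dots> \<le> norm \<omega> ^ N * ((\<Sum>j\<in>UNIV. \<bar>\<omega> $ j\<bar>) * norm (fourier f \<omega>))"
        by (intro mult_left_mono mult_right_mono norm_le_l1_cart) auto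
      also have "\<dots> = (\<Sum>j\<in>UNIV. norm \<omega> ^ N * norm (fourier (partial j f) \<omega>))"
        by (simp add: fourier_partial[OF Suc.prems] norm_mult sum_distrib_left sum_distrib_right)
      also have "\<dots> \<le> (\<Sum>j\<in>UNIV. C j)" by (intro sum_mono C)
      finally show ?thesis .
    qed
    then show ?case by blast
  qed
  then show ?thesis by (simp add: rapid_def)
qed

text \<open>The partial derivatives of a transform are themselves transforms of Schwartz functions, so rapid
  decay of all transforms is enough.\<close>
lemma fourier_schwartz:
  assumes "f \<in> schwartz"
  shows "fourier f \<in> schwartz"
proof -
  have "partials_upto rapid UNIV n (fourier f)" for n
    using assms
  proof (induction n arbitrary: f)
    case 0
    then show ?case using rapid_fourier has_derivative_fourier by (auto simp: differentiable_def)
  next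
    case (Suc n)
    have "partials_upto rapid UNIV n (partial j (fourier f))" for j
      unfolding partial_fourier[OF Suc.prems] by (intro Suc.IH schwartz_mult multiplier_coord_i Suc.prems)
    then show ?case using rapid_fourier[OF Suc.prems] has_derivative_fourier[OF Suc.prems]
      by (auto simp: differentiable_def)
  qed
  then show ?thesis by (simp add: schwartz_iff)
qed

section \<open>The Gaussian\<close>

definition gaussian :: "real^'d::finite \<Rightarrow> complex" where
  "gaussian x = complex_of_real (exp (- (x \<bullet> x) / 2))"

lemma has_derivative_gaussian:
  "(gaussian has_derivative (\<lambda>h. - complex_of_real (x \<bullet> h) * gaussian x)) (at x)"
  unfolding gaussian_def by (auto intro!: derivative_eq_intros simp: inner_commute)

lemma partial_gaussian: "partial j gaussian = (\<lambda>x. - complex_of_real (x $ j) * gaussian x)"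
  by (simp add: fun_eq_iff partial_eqI[OF has_derivative_gaussian] inner_axis)

lemma norm_gaussian_le_1: "norm (gaussian x) \<le> 1"
  by (simp add: gaussian_def)

lemma gaussian_0 [simp]: "gaussian 0 = 1"
  by (simp add: gaussian_def)

text \<open>From \<open>r\<^sup>N \<le> 1 + r\<^bsup>2N\<^esup>\<close> and \<open>(r\<^sup>2/2)\<^sup>N \<le> N! exp (r\<^sup>2/2)\<close>.\<close>
lemma rapid_gaussian: "rapid gaussian"
  unfolding rapid_def
proof
  fix N
  have "norm x ^ N * norm (gaussian x) \<le> 1 + 2 ^ N * fact N" for x :: "real^'a"
  proof -
    let ?s = "(norm x)\<^sup>2 / 2"
    have g: "norm (gaussian x) = exp (- ?s)" by (simp add: gaussian_def power2_norm_eq_inner)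
    have "norm x ^ N \<le> 1 + (norm x ^ N)\<^sup>2" using sum_squares_ge_zero[of "norm x ^ N - 1" "norm x ^ N"]
      by (simp add: power2_eq_square algebra_simps)
    also have "(norm x ^ N)\<^sup>2 = 2 ^ N * ?s ^ N" by (simp add: power_divide power_mult[symmetric] mult.commute)
    also have "?s ^ N \<le> fact N * exp ?s" using power_div_fact_le_exp[of ?s N] by (simp add: field_simps)
    finally have "norm x ^ N \<le> 1 + 2 ^ N * (fact N * exp ?s)" by simp
    then have "norm x ^ N * exp (- ?s) \<le> (1 + 2 ^ N * (fact N * exp ?s)) * exp (- ?s)"
      by (rule mult_right_mono) simp
    also have "\<dots> = exp (- ?s) + 2 ^ N * fact N" by (simp add: distrib_right exp_minus)
    also have "\<dots> \<le> 1 + 2 ^ N * fact N" by simp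
    finally show ?thesis by (simp only: g)
  qed
  then show "\<exists>C. \<forall>x::real^'a. norm x ^ N * norm (gaussian x) \<le> C" by blast
qed

lemma gaussian_schwartz: "(gaussian :: real^'d::finite \<Rightarrow> complex) \<in> schwartz"
proof -
  have "partials_upto rapid UNIV n (gaussian :: real^'d \<Rightarrow> complex)" for n
  proof (induction n)
    case 0
    then show ?case using rapid_gaussian has_derivative_gaussian by (auto simp: differentiable_def)
  next
    case (Suc n)
    have "multiplier (\<lambda>x. - 1 * complex_of_real (x $ j))" for j :: 'd
      by (intro multiplier_mult multiplier_const multiplier_coord)
    then have "partials_upto rapid UNIV n (partial j gaussian)" for j :: 'd
      unfolding partial_gaussian
      by (intro partials_upto_mult[OF open_UNIV agree_on_UNIV, where B'=poly_bounded])
         (use Suc.IH in \<open>simp_all add: rapid_add rapid_mult multiplier_def\<close>)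
    then show ?case using rapid_gaussian has_derivative_gaussian by (auto simp: differentiable_def)
  qed
  then show ?thesis by (simp add: schwartz_iff)
qed

text \<open>Its value is \<open>(2\<pi>)\<^bsup>d/2\<^esup>\<close>; the formulas below are stated in terms of the integral itself.\<close>
definition gauss_mass :: "'d::finite itself \<Rightarrow> complex" where
  "gauss_mass _ = (LINT x|lborel. gaussian (x :: real^'d))"

lemma gauss_mass_nonzero: "gauss_mass TYPE('d::finite) \<noteq> 0"
proof
  let ?g = "\<lambda>x :: real^'d. exp (- (x \<bullet> x) / 2)"
  assume "gauss_mass TYPE('d) = 0"
  then have "complex_of_real (LINT x|lborel. ?g x) = 0"
    by (simp add: gauss_mass_def gaussian_def[abs_def])
  then have "(LINT x|lborel. ?g x) = 0" by (simp only: of_real_eq_0_iff)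
  moreover have "integrable lborel ?g"
    using integrable_Re[OF schwartz_integrable[OF gaussian_schwartz[where 'd='d]]] by (simp add: gaussian_def)
  ultimately have "AE x in lborel. ?g x = 0"
    by (subst (asm) integral_nonneg_eq_0_iff_AE) auto
  then have "UNIV \<in> null_sets (lborel :: (real^'d) measure)"
    using AE_iff_null[of lborel "\<lambda>x :: real^'d. False"] by simp
  then show False by (simp add: null_sets_def emeasure_lborel_UNIV)
qed

text \<open>The Gaussian satisfies \<open>\<partial>\<^sub>j u = - x\<^sub>j u\<close> for every \<open>j\<close>.  The transform exchanges the two sides, so it satisfies
  the same system, and the quotient of the two has derivative zero.\<close>
lemma fourier_gaussian: "fourier gaussian \<omega> = gauss_mass TYPE('d) * gaussian (\<omega> :: real^'d::finite)"
proof -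
  let ?F = "fourier (gaussian :: real^'d \<Rightarrow> complex)"
  let ?H = "\<lambda>\<omega> :: real^'d. ?F \<omega> * complex_of_real (exp ((\<omega> \<bullet> \<omega>) / 2))"
  have "fourier (\<lambda>x. \<i> * complex_of_real (x $ j) * gaussian x) \<omega> = - complex_of_real (\<omega> $ j) * ?F \<omega>" for j \<omega>
  proof -
    have "fourier (\<lambda>x. \<i> * complex_of_real (x $ j) * gaussian x) \<omega> = - \<i> * fourier (partial j gaussian) \<omega>"
      unfolding fourier_def partial_gaussian by (subst integral_mult_right_zero[symmetric]) (simp add: mult_ac)
    then show ?thesis by (simp add: fourier_partial[OF gaussian_schwartz] flip: mult.assoc)
  qed
  then have dF: "(?F has_derivative (\<lambda>h. - complex_of_real (h \<bullet> \<omega>) * ?F \<omega>)) (at \<omega>)" for \<omega>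
    using has_derivative_fourier[OF gaussian_schwartz, of \<omega>]
    by (simp add: inner_vec_def sum_distrib_left sum_negf mult_ac)
  have "(?H has_derivative (\<lambda>h. 0)) (at \<omega>)" for \<omega>
    by (rule derivative_eq_intros dF refl)+ (auto simp: inner_commute algebra_simps)
  then have "\<exists>c. \<forall>\<omega>\<in>UNIV. ?H \<omega> = c"
    by (intro has_derivative_zero_constant) auto
  then have "?H \<omega> = ?H 0" by (metis UNIV_I)
  also have "\<dots> = gauss_mass TYPE('d)" by (simp add: fourier_def gauss_mass_def)
  finally have "?F \<omega> * (complex_of_real (exp ((\<omega> \<bullet> \<omega>) / 2)) * gaussian \<omega>) = gauss_mass TYPE('d) * gaussian \<omega>"
    by simp
  moreover have "complex_of_real (exp ((\<omega> \<bullet> \<omega>) / 2)) * gaussian \<omega> = 1"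
    unfolding gaussian_def by (simp flip: of_real_mult exp_add)
  ultimately show ?thesis by simp
qed


section \<open>Inversion\<close>

lemma fourier_gaussian_scaled:
  fixes \<epsilon> :: real and v :: "real^'d::finite"
  assumes "\<epsilon> > 0"
  shows "(LINT \<omega>|lborel. gaussian (\<epsilon> *\<^sub>R \<omega>) * character \<omega> (\<epsilon> *\<^sub>R v)) =
     inverse (\<epsilon> ^ CARD('d)) *\<^sub>R (gauss_mass TYPE('d) * gaussian v)"
proof -
  have [measurable]: "gaussian \<in> borel_measurable (borel :: (real^'d) measure)"
    by (rule schwartz_measurable[OF gaussian_schwartz])
  have "fourier gaussian v = (LINT \<eta>|lborel. gaussian \<eta> * character v \<eta>)" by (simp add: fourier_def)
  also have "\<dots> = \<bar>\<epsilon>\<bar> ^ DIM(real^'d) *\<^sub>R (LINT \<omega>|lborel. gaussian (0 + \<epsilon> *\<^sub>R \<omega>) * character v (0 + \<epsilon> *\<^sub>R \<omega>))"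
    by (rule lborel_affine_integral(1)) (use assms in auto)
  also have "(\<lambda>\<omega>. gaussian (0 + \<epsilon> *\<^sub>R \<omega>) * character v (0 + \<epsilon> *\<^sub>R \<omega>)) = (\<lambda>\<omega>. gaussian (\<epsilon> *\<^sub>R \<omega>) * character \<omega> (\<epsilon> *\<^sub>R v))"
    by (simp add: inner_commute)
  finally show ?thesis using assms by (simp add: fourier_gaussian)
qed

text \<open>Both sides are the double integral of \<open>f(y) exp (-\<parallel>\<epsilon> \<omega>\<parallel>\<^sup>2/2) exp (\<i> \<omega> \<bullet> (y - x))\<close>, integrated over \<open>y\<close> first on
  the left and over \<open>\<omega>\<close> first on the right, followed by \<open>y = x + \<epsilon> z\<close>.\<close>
lemma gaussian_multiplication_formula:
  fixes f :: "real^'d::finite \<Rightarrow> complex"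
  assumes f: "f \<in> schwartz" and \<epsilon>: "\<epsilon> > 0"
  shows "(LINT \<omega>|lborel. fourier f \<omega> * (gaussian (\<epsilon> *\<^sub>R \<omega>) * character \<omega> (- x)))
       = gauss_mass TYPE('d) * (LINT z|lborel. f (x + \<epsilon> *\<^sub>R z) * gaussian z)"
proof -
  let ?G = "\<lambda>\<omega> :: real^'d. gaussian (\<epsilon> *\<^sub>R \<omega>)"
  let ?k = "\<lambda>y \<omega>. f y * (?G \<omega> * character \<omega> (y - x))"
  note [measurable] = schwartz_measurable[OF f]
  have gauss_meas [measurable]: "gaussian \<in> borel_measurable (borel :: (real^'d) measure)"
    by (rule schwartz_measurable[OF gaussian_schwartz])
  have intG: "integrable lborel ?G"
    using lborel_affine_integral(2)[OF gauss_meas _ schwartz_integrable[OF gaussian_schwartz], of \<epsilon> 0] \<epsilon> by simp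
  have char: "(\<lambda>(y, \<omega>). character \<omega> (y - x)) \<in> borel_measurable (borel \<Otimes>\<^sub>M borel)"
    unfolding borel_prod split_beta by (intro borel_measurable_continuous_onI continuous_intros)
  have meas: "case_prod ?k \<in> borel_measurable (lborel \<Otimes>\<^sub>M lborel)"
  proof -
    have "(\<lambda>p. f (fst p) * (?G (snd p) * (case p of (y, \<omega>) \<Rightarrow> character \<omega> (y - x)))) \<in> borel_measurable (borel \<Otimes>\<^sub>M borel)"
      by (intro borel_measurable_times char) measurable
    then show ?thesis by (simp add: split_beta)
  qed
  have int: "integrable (lborel \<Otimes>\<^sub>M lborel) (case_prod ?k)"
  proof (rule lborel_pair.Fubini_integrable[OF meas])
    have eq: "(LINT \<omega>|lborel. norm (case (y, \<omega>) of (y, \<omega>) \<Rightarrow> ?k y \<omega>)) = norm (f y) * (LINT \<omega>|lborel. norm (?G \<omega>))" for y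
      by (simp add: norm_mult)
    show "integrable lborel (\<lambda>y. LINT \<omega>|lborel. norm (case (y, \<omega>) of (y, \<omega>) \<Rightarrow> ?k y \<omega>))"
      unfolding eq by (intro integrable_mult_left integrable_norm schwartz_integrable f)
    show "AE y in lborel. integrable lborel (\<lambda>\<omega>. case (y, \<omega>) of (y, \<omega>) \<Rightarrow> ?k y \<omega>)"
    proof (rule AE_I2)
      fix y
      have "integrable lborel (\<lambda>\<omega>. ?G \<omega> * character \<omega> (y - x))"
      proof (rule Bochner_Integration.integrable_bound[OF intG])
        have "(\<lambda>\<omega>. character \<omega> (y - x)) \<in> borel_measurable borel"
          by (intro borel_measurable_continuous_onI continuous_intros)
        then show "(\<lambda>\<omega>. ?G \<omega> * character \<omega> (y - x)) \<in> borel_measurable lborel" by measurable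
      qed (simp add: norm_mult)
      then show "integrable lborel (\<lambda>\<omega>. case (y, \<omega>) of (y, \<omega>) \<Rightarrow> ?k y \<omega>)" by simp
    qed
  qed
  have "(LINT \<omega>|lborel. fourier f \<omega> * (?G \<omega> * character \<omega> (- x))) = (LINT \<omega>|lborel. (LINT y|lborel. ?k y \<omega>))"
  proof (rule Bochner_Integration.integral_cong)
    fix \<omega>
    have "?k y \<omega> = (f y * character \<omega> y) * (?G \<omega> * character \<omega> (- x))" for y
      by (simp add: inner_diff_right right_diff_distrib exp_diff exp_minus divide_inverse mult_ac)
    then show "fourier f \<omega> * (?G \<omega> * character \<omega> (- x)) = (LINT y|lborel. ?k y \<omega>)"
      by (simp only: fourier_def integral_mult_left_zero)
  qed simp
  also have "\<dots> = (LINT y|lborel. (LINT \<omega>|lborel. ?k y \<omega>))"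
    by (rule lborel_pair.Fubini_integral[OF int])
  also have "\<dots> = \<bar>\<epsilon>\<bar> ^ DIM(real^'d) *\<^sub>R (LINT z|lborel. (LINT \<omega>|lborel. ?k (x + \<epsilon> *\<^sub>R z) \<omega>))"
  proof (rule lborel_affine_integral(1))
    show "(\<lambda>y. LINT \<omega>|lborel. ?k y \<omega>) \<in> borel_measurable borel"
      using lborel.borel_measurable_lebesgue_integral[OF meas] by simp
  qed (use \<epsilon> in simp)
  also have "(\<lambda>z. LINT \<omega>|lborel. ?k (x + \<epsilon> *\<^sub>R z) \<omega>) =
      (\<lambda>z. inverse (\<epsilon> ^ CARD('d)) *\<^sub>R (gauss_mass TYPE('d) * (f (x + \<epsilon> *\<^sub>R z) * gaussian z)))"
  proof
    fix z
    have "(LINT \<omega>|lborel. ?k (x + \<epsilon> *\<^sub>R z) \<omega>) = f (x + \<epsilon> *\<^sub>R z) * (LINT \<omega>|lborel. ?G \<omega> * character \<omega> (\<epsilon> *\<^sub>R z))"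
      by simp
    also have "\<dots> = inverse (\<epsilon> ^ CARD('d)) *\<^sub>R (gauss_mass TYPE('d) * (f (x + \<epsilon> *\<^sub>R z) * gaussian z))"
      unfolding fourier_gaussian_scaled[OF \<epsilon>] by (simp add: mult_ac)
    finally show "(LINT \<omega>|lborel. ?k (x + \<epsilon> *\<^sub>R z) \<omega>) =
      inverse (\<epsilon> ^ CARD('d)) *\<^sub>R (gauss_mass TYPE('d) * (f (x + \<epsilon> *\<^sub>R z) * gaussian z))" .
  qed
  finally show ?thesis using \<epsilon> by simp
qed

text \<open>Let \<open>\<epsilon> \<rightarrow> 0\<close> in the multiplication formula: the Gaussian factor on the left tends to one, and on the
  right \<open>f (x + \<epsilon> z)\<close> tends to \<open>f x\<close>.\<close>
lemma fourier_inversion: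
  fixes f :: "real^'d::finite \<Rightarrow> complex"
  assumes f: "f \<in> schwartz"
  shows "fourier (fourier f) (- x) = (gauss_mass TYPE('d))\<^sup>2 * f x"
proof -
  let ?e = "\<lambda>n. inverse (real (Suc n))"
  note F = fourier_schwartz[OF f]
  note [measurable] = schwartz_measurable[OF f] schwartz_measurable[OF F]
  have [measurable]: "gaussian \<in> borel_measurable (borel :: (real^'d) measure)"
    by (rule schwartz_measurable[OF gaussian_schwartz])
  have small: "(\<lambda>n. ?e n *\<^sub>R z) \<longlonglongrightarrow> 0" for z :: "real^'d"
    using tendsto_scaleR[OF LIMSEQ_inverse_real_of_nat tendsto_const[of z]] by simp
  have charm[measurable]: "(\<lambda>\<omega>. character \<omega> (- x)) \<in> borel_measurable borel"
    by (intro borel_measurable_continuous_onI continuous_intros)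
  have gcont: "isCont gaussian z" for z :: "real^'d"
    using schwartz_continuous[OF gaussian_schwartz[where 'd='d]] by (simp add: continuous_on_eq_continuous_at)
  have fcont: "isCont f z" for z
    using schwartz_continuous[OF f] by (simp add: continuous_on_eq_continuous_at)
  have lhs: "(\<lambda>n. LINT \<omega>|lborel. fourier f \<omega> * (gaussian (?e n *\<^sub>R \<omega>) * character \<omega> (- x)))
      \<longlonglongrightarrow> (LINT \<omega>|lborel. fourier f \<omega> * (gaussian (0 :: real^'d) * character \<omega> (- x)))"
  proof (rule integral_dominated_convergence[where w = "\<lambda>\<omega>. norm (fourier f \<omega>)"])
    show "integrable lborel (\<lambda>\<omega>. norm (fourier f \<omega>))" by (intro integrable_norm schwartz_integrable F)
    show "AE \<omega> in lborel. (\<lambda>n. fourier f \<omega> * (gaussian (?e n *\<^sub>R \<omega>) * character \<omega> (- x)))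
        \<longlonglongrightarrow> fourier f \<omega> * (gaussian (0 :: real^'d) * character \<omega> (- x))"
      by (intro AE_I2 tendsto_mult tendsto_const isCont_tendsto_compose[OF gcont] small)
    show "AE \<omega> in lborel. norm (fourier f \<omega> * (gaussian (?e n *\<^sub>R \<omega>) * character \<omega> (- x))) \<le> norm (fourier f \<omega>)" for n
      by (intro AE_I2) (simp add: norm_mult mult_left_le norm_gaussian_le_1)
  qed measurable
  obtain C where C: "norm (f y) \<le> C" for y
    using rapid_weight[OF schwartz_rapid[OF f], of 0] by auto
  have rhs: "(\<lambda>n. LINT z|lborel. f (x + ?e n *\<^sub>R z) * gaussian z) \<longlonglongrightarrow> (LINT z|lborel. f (x + 0) * gaussian (z :: real^'d))"
  proof (rule integral_dominated_convergence[where w = "\<lambda>z. C * norm (gaussian z)"])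
    show "integrable lborel (\<lambda>z :: real^'d. C * norm (gaussian z))"
      by (intro integrable_mult_right integrable_norm schwartz_integrable gaussian_schwartz)
    show "AE z in lborel. (\<lambda>n. f (x + ?e n *\<^sub>R z) * gaussian z) \<longlonglongrightarrow> f (x + 0) * gaussian (z :: real^'d)"
      by (intro AE_I2 tendsto_mult tendsto_const isCont_tendsto_compose[OF fcont] tendsto_add small)
    show "AE z in lborel. norm (f (x + ?e n *\<^sub>R z) * gaussian z) \<le> C * norm (gaussian z)" for n
      using C by (intro AE_I2) (simp add: norm_mult mult_right_mono)
  qed measurable
  have "(\<lambda>n. gauss_mass TYPE('d) * (LINT z|lborel. f (x + ?e n *\<^sub>R z) * gaussian z))
      \<longlonglongrightarrow> gauss_mass TYPE('d) * (LINT z|lborel. f (x + 0) * gaussian (z :: real^'d))"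
    by (rule tendsto_mult_left[OF rhs])
  moreover have "(LINT \<omega>|lborel. fourier f \<omega> * (gaussian (?e n *\<^sub>R \<omega>) * character \<omega> (- x)))
      = gauss_mass TYPE('d) * (LINT z|lborel. f (x + ?e n *\<^sub>R z) * gaussian z)" for n
    by (rule gaussian_multiplication_formula[OF f]) simp
  ultimately have "(LINT \<omega>|lborel. fourier f \<omega> * (gaussian (0 :: real^'d) * character \<omega> (- x))) = gauss_mass TYPE('d) * (LINT z|lborel. f (x + 0) * gaussian (z :: real^'d))"
    using LIMSEQ_unique[OF lhs] by simp
  then show ?thesis
    by (simp add: fourier_def[of "fourier f"] gauss_mass_def power2_eq_square inner_commute mult_ac)
qed

text \<open>By inversion the square of the transform is a reflection up to a factor, so its fourth power is a
  nonzero scalar.\<close>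
lemma fourier_surjective:
  fixes f :: "real^'d::finite \<Rightarrow> complex"
  assumes f: "f \<in> schwartz"
  obtains g where "g \<in> schwartz" "fourier g = f"
proof -
  let ?c = "(gauss_mass TYPE('d))\<^sup>2"
  have c: "?c \<noteq> 0" by (simp add: gauss_mass_nonzero)
  have FF: "fourier (fourier h) x = ?c * h (- x)" if "h \<in> schwartz" for h :: "real^'d \<Rightarrow> complex" and x
    using fourier_inversion[OF that, of "- x"] by simp
  \<comment> \<open>Three further transforms complete \<open>f\<close> to a fourth power.\<close>
  let ?g = "\<lambda>x. inverse (?c * ?c) * fourier (fourier (fourier f)) x"
  show thesis
  proof (rule that)
    show "?g \<in> schwartz" by (intro schwartz_mult multiplier_const fourier_schwartz f)
    have "fourier ?g x = inverse (?c * ?c) * fourier (fourier (fourier (fourier f))) x" for x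
      unfolding fourier_def by (simp add: mult.assoc)
    also have "\<dots> x = f x" for x
      using c by (simp add: FF fourier_schwartz f)
    finally show "fourier ?g = f" by auto
  qed
qed

section \<open>Tempered distributions and symbols\<close>

text \<open>All partial derivatives vanish off the compact support and are continuous on it.\<close>
lemma test_on_subset_schwartz:
  assumes "f \<in> test_on S"
  shows "f \<in> schwartz"
proof -
  let ?K = "closure {x. f x \<noteq> 0}"
  have f: "smooth_on UNIV f" "compact ?K" using assms by (auto simp: test_on_def)
  have zero: "partials js f x = 0" if "x \<notin> ?K" for js x
    using that
  proof (induction js arbitrary: x)
    case Nil
    then show ?case using closure_subset[of "{x. f x \<noteq> 0}"] by (auto simp: partials_def)
  next
    case (Cons j js)
    have "partial j (partials js f) x = partial j (\<lambda>_. 0) x"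
      by (rule partial_cong[of "- ?K"]) (use Cons in auto)
    then show ?case by (simp add: partials_def partial_const)
  qed
  have "\<exists>C. \<forall>x. norm x ^ N * norm (partials js f x) \<le> C" for N js
  proof -
    have "continuous_on UNIV (partials js f)"
      by (rule smooth_on_continuous[OF smooth_on_partials[OF f(1)]])
    then have "continuous_on ?K (\<lambda>x. norm x ^ N * norm (partials js f x))"
      by (intro continuous_intros) (auto intro: continuous_on_subset)
    then have "bounded ((\<lambda>x. norm x ^ N * norm (partials js f x)) ` ?K)"
      by (intro compact_imp_bounded compact_continuous_image f(2))
    then obtain C where C: "\<And>x. x \<in> ?K \<Longrightarrow> norm (norm x ^ N * norm (partials js f x)) \<le> C"
      unfolding bounded_iff by blast
    have "norm x ^ N * norm (partials js f x) \<le> \<bar>C\<bar>" for x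
    proof (cases "x \<in> ?K")
      case True
      from C[OF this] show ?thesis by simp
    qed (simp add: zero)
    then show ?thesis by blast
  qed
  then show ?thesis using f(1) by (simp add: schwartz_def)
qed

lemma set_coords: "distinct (coords :: 'd::finite list)" "set (coords :: 'd list) = UNIV"
proof -
  have "\<exists>xs :: 'd list. distinct xs \<and> set xs = UNIV"
    using finite_distinct_list[of "UNIV :: 'd set"] by auto
  from someI_ex[OF this] show "distinct (coords :: 'd list)" "set (coords :: 'd list) = UNIV"
    unfolding coords_def by auto
qed

lemma partial_power_fourier:
  assumes "f \<in> schwartz"
  shows "(partial j ^^ n) (fourier f) = fourier (\<lambda>x. (\<i> * complex_of_real (x $ j)) ^ n * f x)"
proof (induction n)
  case (Suc n)
  have "(\<lambda>x. (\<i> * complex_of_real (x $ j)) ^ n * f x) \<in> schwartz"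
    by (intro schwartz_mult multiplier_power multiplier_coord_i assms)
  then show ?case by (simp add: Suc partial_fourier mult.assoc)
qed simp

text \<open>Every single derivative becomes a multiplication under the integral, so the order in which the
  coordinates are listed drops out.\<close>
lemma mi_deriv_fourier:
  assumes f: "f \<in> schwartz"
  shows "mi_deriv \<alpha> (fourier f) = fourier (\<lambda>x. (\<Prod>j\<in>UNIV. (\<i> * complex_of_real (x $ j)) ^ \<alpha> j) * f x)"
proof -
  have "(\<lambda>x. prod_list (map (\<lambda>j. (\<i> * complex_of_real (x $ j)) ^ \<alpha> j) js) * f x) \<in> schwartz \<and>
    foldr (\<lambda>j. partial j ^^ \<alpha> j) js (fourier f) =
      fourier (\<lambda>x. prod_list (map (\<lambda>j. (\<i> * complex_of_real (x $ j)) ^ \<alpha> j) js) * f x)" for js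
  proof (induction js)
    case Nil
    then show ?case using f by simp
  next
    case (Cons j js)
    let ?g = "\<lambda>x. prod_list (map (\<lambda>j. (\<i> * complex_of_real (x $ j)) ^ \<alpha> j) js) * f x"
    have "(\<lambda>x. (\<i> * complex_of_real (x $ j)) ^ \<alpha> j * ?g x) \<in> schwartz"
      by (intro schwartz_mult multiplier_power multiplier_coord_i Cons[THEN conjunct1])
    then show ?case using Cons by (simp add: partial_power_fourier mult.assoc)
  qed
  then show ?thesis
    by (simp add: mi_deriv_def prod.distinct_set_conv_list[OF set_coords(1), unfolded set_coords(2)])
qed

text \<open>Linearity on the Schwartz space only: elsewhere the values of a functional are arbitrary.\<close>
definition schwartz_linear :: "'d::finite distr \<Rightarrow> bool" where
  "schwartz_linear T \<longleftrightarrow> (\<forall>f\<in>schwartz. \<forall>g\<in>schwartz. \<forall>a b. T (\<lambda>x. a * f x + b * g x) = a * T f + b * T g)"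

lemma tempered_linear: "tempered T \<Longrightarrow> schwartz_linear T"
  by (simp add: tempered_def schwartz_linear_def)

lemma schwartz_const_mult: "f \<in> schwartz \<Longrightarrow> (\<lambda>x. c * f x) \<in> schwartz"
  by (rule schwartz_mult[OF multiplier_const])

lemma schwartz_zero: "(\<lambda>x. 0) \<in> schwartz"
  using schwartz_const_mult[OF gaussian_schwartz, of 0] by simp

lemma schwartz_linear_sum:
  assumes T: "schwartz_linear T" and "finite I" "\<And>i. i \<in> I \<Longrightarrow> f i \<in> schwartz"
  shows "(\<lambda>x. \<Sum>i\<in>I. c i * f i x) \<in> schwartz \<and> T (\<lambda>x. \<Sum>i\<in>I. c i * f i x) = (\<Sum>i\<in>I. c i * T (f i))"
  using assms(2,3)
proof (induction I rule: finite_induct)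
  case empty
  have "T (\<lambda>x. 0 * 0 + 0 * 0) = 0 * T (\<lambda>x. 0) + 0 * T (\<lambda>x. 0)"
    using T[unfolded schwartz_linear_def, rule_format, OF schwartz_zero schwartz_zero, of 0 0] .
  then show ?case by (simp add: schwartz_zero)
next
  case (insert i I)
  let ?g = "\<lambda>x. \<Sum>i\<in>I. c i * f i x"
  have g: "?g \<in> schwartz" "T ?g = (\<Sum>i\<in>I. c i * T (f i))" using insert by auto
  have fi: "f i \<in> schwartz" using insert by simp
  have "T (\<lambda>x. c i * f i x + 1 * ?g x) = c i * T (f i) + 1 * T ?g"
    using T[unfolded schwartz_linear_def, rule_format, OF fi g(1), of "c i" 1] .
  moreover have "(\<lambda>x. c i * f i x + ?g x) \<in> schwartz"
    by (intro schwartz_add schwartz_const_mult fi g(1))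
  ultimately show ?case using insert(1,2) g(2) by simp
qed

lemma finite_multi_indices: "finite {\<alpha> :: 'd::finite \<Rightarrow> nat. mi_size \<alpha> \<le> r}"
proof (rule finite_subset)
  show "{\<alpha> :: 'd \<Rightarrow> nat. mi_size \<alpha> \<le> r} \<subseteq> PiE UNIV (\<lambda>_. {..r})"
  proof
    fix \<alpha> :: "'d \<Rightarrow> nat" assume "\<alpha> \<in> {\<alpha>. mi_size \<alpha> \<le> r}"
    then have "\<alpha> j \<le> r" for j
      using member_le_sum[of j UNIV \<alpha>] by (simp add: mi_size_def)
    then show "\<alpha> \<in> PiE UNIV (\<lambda>_. {..r})" by auto
  qed
qed (simp add: finite_PiE)

text \<open>The sign \<open>(-1)\<^bsup>|\<alpha>|\<^esup>\<close> from transposing the derivatives, the factor \<open>s\<^bsup>|\<alpha>|\<^esup>\<close> and the factor \<open>\<i>\<close> from each derivative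
  of the transform combine to the symbol \<open>(-s \<i> x)\<^sup>\<alpha>\<close>.\<close>
lemma diff_op_fourier:
  assumes T: "schwartz_linear T" and f: "f \<in> schwartz"
  shows "diff_op r c s T (fourier f) =
    T (fourier (\<lambda>x. (\<Sum>\<alpha> | mi_size \<alpha> \<le> r. complex_of_real (c \<alpha>) *
      (\<Prod>j\<in>UNIV. (- complex_of_real s * \<i> * complex_of_real (x $ j)) ^ \<alpha> j)) * f x))"
proof -
  let ?I = "{\<alpha>. mi_size \<alpha> \<le> r}"
  let ?m = "\<lambda>\<alpha> x. (\<Prod>j\<in>UNIV. (\<i> * complex_of_real (x $ j)) ^ \<alpha> j) * f x"
  let ?c = "\<lambda>\<alpha>. complex_of_real (c \<alpha> * s ^ mi_size \<alpha>) * (- 1) ^ mi_size \<alpha>"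
  have m: "?m \<alpha> \<in> schwartz" for \<alpha>
    by (intro schwartz_mult multiplier_prod multiplier_power multiplier_coord_i f)
  have "diff_op r c s T (fourier f) = (\<Sum>\<alpha>\<in>?I. ?c \<alpha> * T (fourier (?m \<alpha>)))"
    by (simp add: diff_op_def D_distr_def mi_deriv_fourier[OF f] mult.assoc)
  also have "\<dots> = T (\<lambda>\<omega>. \<Sum>\<alpha>\<in>?I. ?c \<alpha> * fourier (?m \<alpha>) \<omega>)"
    using schwartz_linear_sum[OF T finite_multi_indices, of r "\<lambda>\<alpha>. fourier (?m \<alpha>)" ?c] fourier_schwartz[OF m] by simp
  also have "(\<lambda>\<omega>. \<Sum>\<alpha>\<in>?I. ?c \<alpha> * fourier (?m \<alpha>) \<omega>) = fourier (\<lambda>x. \<Sum>\<alpha>\<in>?I. ?c \<alpha> * ?m \<alpha> x)"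
  proof
    fix \<omega>
    have "fourier (\<lambda>x. \<Sum>\<alpha>\<in>?I. ?c \<alpha> * ?m \<alpha> x) \<omega> = (LINT x|lborel. (\<Sum>\<alpha>\<in>?I. ?c \<alpha> * (?m \<alpha> x * character \<omega> x)))"
      by (simp add: fourier_def sum_distrib_right mult.assoc)
    also have "\<dots> = (\<Sum>\<alpha>\<in>?I. LINT x|lborel. ?c \<alpha> * (?m \<alpha> x * character \<omega> x))"
      by (rule Bochner_Integration.integral_sum) (rule integrable_mult_right[OF fourier_integrable[OF m]])
    also have "\<dots> = (\<Sum>\<alpha>\<in>?I. ?c \<alpha> * fourier (?m \<alpha>) \<omega>)"
      by (simp only: fourier_def integral_mult_right_zero)
    finally show "(\<Sum>\<alpha>\<in>?I. ?c \<alpha> * fourier (?m \<alpha>) \<omega>) = fourier (\<lambda>x. \<Sum>\<alpha>\<in>?I. ?c \<alpha> * ?m \<alpha> x) \<omega>" ..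
  qed
  also have "(\<lambda>x. \<Sum>\<alpha>\<in>?I. ?c \<alpha> * ?m \<alpha> x) = (\<lambda>x. (\<Sum>\<alpha>\<in>?I. complex_of_real (c \<alpha>) *
      (\<Prod>j\<in>UNIV. (- complex_of_real s * \<i> * complex_of_real (x $ j)) ^ \<alpha> j)) * f x)"
  proof
    fix x
    have "?c \<alpha> * ?m \<alpha> x = complex_of_real (c \<alpha>) *
      (\<Prod>j\<in>UNIV. (- complex_of_real s * \<i> * complex_of_real (x $ j)) ^ \<alpha> j) * f x" for \<alpha>
    proof -
      have "(\<Prod>j\<in>UNIV. (- complex_of_real s * \<i> * complex_of_real (x $ j)) ^ \<alpha> j)
          = (\<Prod>j\<in>UNIV. (- complex_of_real s) ^ \<alpha> j * (\<i> * complex_of_real (x $ j)) ^ \<alpha> j)"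
        by (simp only: power_mult_distrib[symmetric] mult.assoc)
      also have "\<dots> = (- complex_of_real s) ^ mi_size \<alpha> * (\<Prod>j\<in>UNIV. (\<i> * complex_of_real (x $ j)) ^ \<alpha> j)"
        by (simp add: prod.distrib power_sum mi_size_def)
      also have "(- complex_of_real s) ^ mi_size \<alpha> = complex_of_real (s ^ mi_size \<alpha>) * (- 1) ^ mi_size \<alpha>"
        by (subst power_minus) (simp add: mult.commute)
      finally show ?thesis by simp
    qed
    then show "(\<Sum>\<alpha>\<in>?I. ?c \<alpha> * ?m \<alpha> x) = (\<Sum>\<alpha>\<in>?I. complex_of_real (c \<alpha>) *
      (\<Prod>j\<in>UNIV. (- complex_of_real s * \<i> * complex_of_real (x $ j)) ^ \<alpha> j)) * f x"
      by (simp only: sum_distrib_right)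
  qed
  finally show ?thesis .
qed

lemma Psym_adj_nth: "adj (Psym r \<gamma> \<omega>) $ l $ i = (\<Sum>\<alpha> | mi_size \<alpha> \<le> r l.
     complex_of_real (\<gamma> l \<alpha> $ i) * (\<Prod>j\<in>UNIV. (\<i> * complex_of_real (\<omega> $ j)) ^ \<alpha> j))"
  by (simp add: adj_def Psym_def)

lemma Psym_nth: "Psym r \<gamma> \<omega> $ i $ l = (\<Sum>\<alpha> | mi_size \<alpha> \<le> r l.
     complex_of_real (\<gamma> l \<alpha> $ i) * (\<Prod>j\<in>UNIV. (- \<i> * complex_of_real (\<omega> $ j)) ^ \<alpha> j))"
  by (simp add: Psym_def)

lemma multiplier_Psym_adj: "multiplier (\<lambda>\<omega>. adj (Psym r \<gamma> \<omega>) $ l $ i)"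
  unfolding Psym_adj_nth
  by (intro multiplier_sum multiplier_mult multiplier_prod multiplier_power multiplier_const multiplier_coord)

lemma diff_op_minus_fourier:
  assumes "schwartz_linear T" "f \<in> schwartz"
  shows "diff_op (r l) (\<lambda>\<alpha>. \<gamma> l \<alpha> $ i) (- 1) T (fourier f) = ft T (\<lambda>\<omega>. adj (Psym r \<gamma> \<omega>) $ l $ i * f \<omega>)"
  unfolding diff_op_fourier[OF assms] Psym_adj_nth ft_def by simp

lemma ft_PT_minus:
  assumes "schwartz_linear u" "f \<in> schwartz"
  shows "ft (PT_minus r \<gamma> u l j) f = ft u (\<lambda>\<omega>. adj (Psym r \<gamma> \<omega>) $ l $ j * f \<omega>)"
  unfolding PT_minus_def by (subst ft_def) (rule diff_op_minus_fourier[OF assms])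

lemma ft_P_left:
  assumes "\<And>l. schwartz_linear (\<Phi> l k)" "f \<in> schwartz"
  shows "ft (P_left r \<gamma> \<Phi> i k) f = (\<Sum>l\<in>UNIV. ft (\<Phi> l k) (\<lambda>\<omega>. Psym r \<gamma> \<omega> $ i $ l * f \<omega>))"
  unfolding ft_def P_left_def Psym_nth by (simp add: diff_op_fourier assms)

text \<open>Linear independence gives every \<open>P\<^sub>l\<close> a nonzero coefficient, so some entry of the symbol is a nonzero
  polynomial.\<close>
lemma AE_Psym_adj_nonzero:
  fixes \<gamma> :: "'n::finite \<Rightarrow> ('d::finite \<Rightarrow> nat) \<Rightarrow> real^'m::finite"
  assumes "ops_independent r \<gamma>"
  obtains l i where "AE \<omega> in lborel. adj (Psym r \<gamma> \<omega>) $ l $ i \<noteq> 0"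
proof -
  fix l :: 'n
  have "\<exists>\<alpha>. mi_size \<alpha> \<le> r l \<and> \<gamma> l \<alpha> \<noteq> 0"
  proof (rule ccontr)
    assume "\<not> ?thesis"
    then have "(\<Sum>l'\<in>UNIV. (if l' = l then 1 else 0) *\<^sub>R (if mi_size \<alpha> \<le> r l' then \<gamma> l' \<alpha> else 0)) = 0" for \<alpha>
      by (intro sum.neutral) auto
    then have "(if l = l then 1 else 0 :: real) = 0"
      using assms[unfolded ops_independent_def, rule_format, of "\<lambda>l'. if l' = l then 1 else 0" l] by blast
    then show False by simp
  qed
  then obtain \<alpha> i where \<alpha>: "mi_size \<alpha> \<le> r l" "\<gamma> l \<alpha> $ i \<noteq> 0" by (auto simp: vec_eq_iff)
  have "adj (Psym r \<gamma> \<omega>) $ l $ i = (\<Sum>\<alpha> | mi_size \<alpha> \<le> r l.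
      (complex_of_real (\<gamma> l \<alpha> $ i) * \<i> ^ mi_size \<alpha>) * (\<Prod>j\<in>UNIV. complex_of_real (\<omega> $ j) ^ \<alpha> j))" for \<omega>
    unfolding Psym_adj_nth by (simp add: power_mult_distrib prod.distrib mi_size_def power_sum mult.assoc)
  then have "AE \<omega> in lborel. adj (Psym r \<gamma> \<omega>) $ l $ i \<noteq> 0"
    using AE_polynomial_nonzero[OF finite_multi_indices, of \<alpha> "r l" "\<lambda>\<alpha>. complex_of_real (\<gamma> l \<alpha> $ i) * \<i> ^ mi_size \<alpha>"] \<alpha>
    by simp
  then show thesis by (rule that)
qed

lemma continuous_AE_zero_imp_zero:
  fixes d :: "'a::euclidean_space \<Rightarrow> complex"
  assumes "open S" "continuous_on S d" "AE x in lborel. x \<in> S \<longrightarrow> d x = 0" "x \<in> S"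
  shows "d x = 0"
proof (rule ccontr)
  assume x: "d x \<noteq> 0"
  let ?U = "S \<inter> d -` (- {0})"
  have U: "open ?U" by (rule continuous_open_preimage[OF assms(2,1)]) (simp add: open_Compl)
  have "{x \<in> space lborel. \<not> (x \<in> S \<longrightarrow> d x = 0)} = ?U" by auto
  then have "?U \<in> null_sets lborel"
    using assms(3) U AE_iff_null[of lborel "\<lambda>x. x \<in> S \<longrightarrow> d x = 0"] by simp
  then have "negligible ?U"
    by (simp add: negligible_iff_null_sets null_sets_completionI)
  then show False using open_not_negligible[OF U] x assms(4) by auto
qed

section \<open>The transform of the kernel\<close>

lemma is_fun_imp_is_fun_on: "is_fun T g \<Longrightarrow> is_fun_on S T g"
  by (auto simp: is_fun_def is_fun_on_def intro: test_on_subset_schwartz)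

text \<open>Integrability of the products with test functions is the only regularity that a represented
  distribution provides; off the point \<open>z\<close> it implies measurability.\<close>
lemma is_fun_on_measurable: "is_fun_on (- {z}) T g \<Longrightarrow> g \<in> borel_measurable borel"
  by (rule borel_measurable_if_test_products) (auto simp: is_fun_on_def)

lemma test_on_mult_multiplier:
  "multiplier m \<Longrightarrow> f \<in> test_on (- {z}) \<Longrightarrow> (\<lambda>x. m x * f x) \<in> test_on (- {z})"
  by (rule test_on_mult) (auto intro: smooth_on_subset[OF multiplier_smooth] simp: open_Compl)

lemma adj_Psym_Proj_nth: "(\<Sum>i\<in>UNIV. adj (Psym r \<gamma> \<omega>) $ l $ i * Proj r \<gamma> \<omega> $ i $ j) = 0"
  using arg_cong[OF adj_P_Proj[of r \<gamma> \<omega>], of "\<lambda>M. M $ l $ j"]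
  by (simp add: matrix_matrix_mult_def)

text \<open>As a distribution \<open>v\<^sub>k\<^sub>j\<close> is \<open>P\<^sup>*\<^sub>k\<^sub>j\<close> times the transform of \<open>u\<close>.  Multiplying crosswise eliminates that
  transform, which need not be a function.  Both sides are continuous, so equality almost everywhere
  is equality at every point; it is the pointwise form that can be inserted into the argument of
  another distribution.\<close>
lemma convolution_factors_proportional:
  fixes u :: "'d::finite distr"
  assumes u: "schwartz_linear u"
    and v: "\<And>k j. smooth_on (- {0}) (v k j)"
    and v_fun: "\<And>k j. is_fun_on (- {0}) (ft (PT_minus r \<gamma> u k j)) (v k j)"
    and "\<omega> \<noteq> 0"
  shows "v k j \<omega> * adj (Psym r \<gamma> \<omega>) $ k' $ j' = v k' j' \<omega> * adj (Psym r \<gamma> \<omega>) $ k $ j"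
proof -
  let ?A = "\<lambda>k j \<omega>. adj (Psym r \<gamma> \<omega>) $ k $ j"
  let ?d = "\<lambda>\<omega>. v k j \<omega> * ?A k' j' \<omega> - v k' j' \<omega> * ?A k j \<omega>"
  have cont: "continuous_on (- {0}) ?d"
    by (intro continuous_intros smooth_on_continuous v smooth_on_subset[OF multiplier_smooth[OF multiplier_Psym_adj]]) auto
  have S: "open (- {0 :: real^'d})" by (simp add: open_Compl)
  have "integrable lborel (\<lambda>x. ?d x * f x) \<and> (LINT x|lborel. ?d x * f x) = 0" if f: "f \<in> test_on (- {0})" for f
  proof -
    have t: "(\<lambda>\<omega>. ?A k j \<omega> * f \<omega>) \<in> test_on (- {0})" for k j
      by (rule test_on_mult_multiplier[OF multiplier_Psym_adj f])
    have eq: "integrable lborel (\<lambda>x. v k j x * (?A k' j' x * f x))"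
      "(LINT x|lborel. v k j x * (?A k' j' x * f x)) = ft u (\<lambda>\<omega>. ?A k j \<omega> * (?A k' j' \<omega> * f \<omega>))" for k j k' j'
      using v_fun[of k j] t[of k' j'] test_on_subset_schwartz[OF t[of k' j']]
      by (auto simp: is_fun_on_def of_fun_def ft_PT_minus[OF u])
    have "(LINT x|lborel. v k j x * (?A k' j' x * f x)) = (LINT x|lborel. v k' j' x * (?A k j x * f x))"
      unfolding eq(2) by (simp add: mult.left_commute)
    moreover have "?d x * f x = v k j x * (?A k' j' x * f x) - v k' j' x * (?A k j x * f x)" for x
      by (simp add: algebra_simps)
    ultimately show ?thesis using eq(1)[of k j k' j'] eq(1)[of k' j' k j] by simp
  qed
  from AE_zero_if_test_integrals_zero[OF S this] have "AE x in lborel. x \<in> - {0} \<longrightarrow> ?d x = 0" .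
  from continuous_AE_zero_imp_zero[OF S cont this, of \<omega>] show ?thesis using assms(4) by simp
qed

text \<open>The division-free form of the identity \<open>\<kappa> = (I - P G\<^sup>\<dagger> P\<^sup>*)\<^sub>a\<^sub>b U\<close>, \<open>U\<close> being the transform of \<open>u\<close>,
  with \<open>v\<^sub>k\<^sub>j\<close> standing for \<open>P\<^sup>*\<^sub>k\<^sub>j\<close> times \<open>U\<close>.  Test the transform of the kernel with \<open>P\<^sup>*\<^sub>k\<^sub>j f\<close>.  On the
  diagonal term this factor produces the smooth function \<open>v\<^sub>k\<^sub>j\<close>.  In the convolution term, proportionality
  replaces \<open>v\<^sub>p\<^sub>b P\<^sup>*\<^sub>k\<^sub>j\<close> by \<open>P\<^sup>*\<^sub>p\<^sub>b v\<^sub>k\<^sub>j\<close> for every \<open>p\<close>, so the sum over \<open>p\<close> becomes the sandwich of the transform of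
  \<open>\<Phi>\<close> between \<open>P\<close> and \<open>P\<^sup>*\<close>, applied to the test function \<open>v\<^sub>k\<^sub>j f\<close>, where the hypothesis on \<open>\<Phi>\<close> evaluates it.\<close>
lemma kernel_transform_times_symbol:
  fixes \<gamma> :: "'n::finite \<Rightarrow> ('d::finite \<Rightarrow> nat) \<Rightarrow> real^'m::finite"
  assumes u: "schwartz_linear u" and Phi: "\<And>a b. schwartz_linear (\<Phi> a b)"
    and Phi_symbol: "\<And>i j. is_fun_on (- {0})
           (P_sandwich r \<gamma> (\<lambda>a b. ft (\<Phi> a b)) i j) (\<lambda>\<omega>. PGP r \<gamma> \<omega> $ i $ j)"
    and v: "\<And>k j. smooth_on (- {0}) (v k j)"
    and v_fun: "\<And>k j. is_fun_on (- {0}) (ft (PT_minus r \<gamma> u k j)) (v k j)"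
    and C: "\<And>i j f. f \<in> test_on (- {0}) \<Longrightarrow>
          ft (C i j) f = (\<Sum>k\<in>UNIV. fmult (v k j) (ft (P_left r \<gamma> \<Phi> i k)) f)"
    and K: "\<And>i j f. f \<in> schwartz \<Longrightarrow> K i j f = (if i = j then u f else 0) - C i j f"
    and \<kappa>: "is_fun (ft (K a b)) \<kappa>"
  shows "AE \<omega> in lborel. \<omega> \<noteq> 0 \<longrightarrow>
     \<kappa> \<omega> * adj (Psym r \<gamma> \<omega>) $ k $ j = Proj r \<gamma> \<omega> $ a $ b * v k j \<omega>"
proof -
  let ?A = "\<lambda>k j \<omega>. adj (Psym r \<gamma> \<omega>) $ k $ j" and ?P = "\<lambda>i k \<omega>. Psym r \<gamma> \<omega> $ i $ k"
  let ?d = "\<lambda>\<omega>. \<kappa> \<omega> * ?A k j \<omega> - Proj r \<gamma> \<omega> $ a $ b * v k j \<omega>"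
  have S: "open (- {0 :: real^'d})" by (simp add: open_Compl)
  have "integrable lborel (\<lambda>x. ?d x * f x) \<and> (LINT x|lborel. ?d x * f x) = 0" if f: "f \<in> test_on (- {0})" for f
  proof -
    \<comment> \<open>At the origin nothing is known about \<open>v\<close>; both arguments compared below vanish there with \<open>f\<close>.\<close>
    have f0: "f 0 = 0" using f closure_subset[of "{x. f x \<noteq> 0}"] by (auto simp: test_on_def)
    let ?g = "\<lambda>\<omega>. ?A k j \<omega> * f \<omega>" and ?w = "\<lambda>\<omega>. v k j \<omega> * f \<omega>"
    have g: "?g \<in> test_on (- {0})" by (rule test_on_mult_multiplier[OF multiplier_Psym_adj f])
    \<comment> \<open>\<open>v\<close> is smooth off the origin only, which suffices for multiplying test functions supported there.\<close>
    have w: "?w \<in> test_on (- {0})" by (rule test_on_mult[OF S v f])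
    note g' = test_on_subset_schwartz[OF g] and w' = test_on_subset_schwartz[OF w]
    have ug: "integrable lborel ?w" "ft u ?g = (LINT x|lborel. ?w x)"
      using v_fun[of k j] f test_on_subset_schwartz[OF f]
      by (auto simp: is_fun_on_def of_fun_def ft_PT_minus[OF u])
    have Kg: "integrable lborel (\<lambda>x. \<kappa> x * ?g x)" "ft (K a b) ?g = (LINT x|lborel. \<kappa> x * ?g x)"
      using \<kappa> g' by (auto simp: is_fun_def of_fun_def)
    have PGPw: "integrable lborel (\<lambda>x. PGP r \<gamma> x $ a $ b * ?w x)"
        "P_sandwich r \<gamma> (\<lambda>a b. ft (\<Phi> a b)) a b ?w = (LINT x|lborel. PGP r \<gamma> x $ a $ b * ?w x)"
      using Phi_symbol[of a b] w by (auto simp: is_fun_on_def of_fun_def)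
    have "ft (C a b) ?g = (\<Sum>k'\<in>UNIV. ft (P_left r \<gamma> \<Phi> a k') (\<lambda>\<omega>. v k' b \<omega> * ?g \<omega>))"
      by (simp add: C[OF g] fmult_def)
    also have "\<dots> = (\<Sum>k'\<in>UNIV. ft (P_left r \<gamma> \<Phi> a k') (\<lambda>\<omega>. ?A k' b \<omega> * ?w \<omega>))"
    proof (intro sum.cong refl arg_cong[where f = "ft _"] ext)
      fix k' \<omega>
      show "v k' b \<omega> * ?g \<omega> = ?A k' b \<omega> * ?w \<omega>"
      proof (cases "\<omega> = 0")
        case False
        from convolution_factors_proportional[OF u v v_fun this, of k j k' b] show ?thesis by (simp add: mult_ac)
      qed (simp add: f0)
    qed
    also have "\<dots> = (\<Sum>k'\<in>UNIV. \<Sum>l\<in>UNIV. ft (\<Phi> l k') (\<lambda>\<omega>. ?P a l \<omega> * (?A k' b \<omega> * ?w \<omega>)))"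
      by (intro sum.cong refl ft_P_left Phi schwartz_mult multiplier_Psym_adj w')
    also have "\<dots> = P_sandwich r \<gamma> (\<lambda>a b. ft (\<Phi> a b)) a b ?w"
      unfolding P_sandwich_def fmult_def by (subst sum.swap) (simp add: mult.assoc)
    finally have Cg: "ft (C a b) ?g = (LINT x|lborel. PGP r \<gamma> x $ a $ b * ?w x)" by (simp add: PGPw(2))
    have "(LINT x|lborel. \<kappa> x * ?g x) = (if a = b then ft u ?g else 0) - ft (C a b) ?g"
      unfolding Kg(2)[symmetric] ft_def by (rule K[OF fourier_schwartz[OF g']])
    also have "\<dots> = (LINT x|lborel. (if a = b then 1 else 0) * ?w x - PGP r \<gamma> x $ a $ b * ?w x)"
      using ug PGPw(1) by (simp add: Cg)
    finally have eq: "(LINT x|lborel. \<kappa> x * ?g x) = (LINT x|lborel. (if a = b then 1 else 0) * ?w x - PGP r \<gamma> x $ a $ b * ?w x)" .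
    have "?d x * f x = \<kappa> x * ?g x - ((if a = b then 1 else 0) * ?w x - PGP r \<gamma> x $ a $ b * ?w x)" for x
      by (simp add: Proj_def mat_def algebra_simps)
    moreover have "integrable lborel (\<lambda>x. (if a = b then 1 else 0) * ?w x - PGP r \<gamma> x $ a $ b * ?w x)"
      using ug(1) PGPw(1) by simp
    ultimately show ?thesis using eq Kg(1) by simp
  qed
  from AE_zero_if_test_integrals_zero[OF S this] show ?thesis by simp
qed

theorem lemma3p1:
  fixes r :: "'n::finite \<Rightarrow> nat"
    and \<gamma> :: "'n \<Rightarrow> ('d::finite \<Rightarrow> nat) \<Rightarrow> real^'m::finite"
    and L k :: nat and h :: real
    and \<Phi> :: "('d, 'n, 'n) mdistr"
    and C K :: "('d, 'm, 'm) mdistr"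
  assumes indep: "ops_independent r \<gamma>"
    and "1 \<le> k" and "k \<le> L" and "CARD('d) + 1 \<le> 2 * L" and "h > 0"
    and Phi_tempered: "\<And>a b. tempered (\<Phi> a b)"
    and Phi_symbol: "\<And>i j. is_fun_on (- {0})
           (P_sandwich r \<gamma> (\<lambda>a b. ft (\<Phi> a b)) i j) (\<lambda>\<omega>. PGP r \<gamma> \<omega> $ i $ j)"
    and C_tempered: "\<And>i j. tempered (C i j)"
    and C_conv: "is_conv (P_left r \<gamma> \<Phi>) (PT_minus r \<gamma> (spline_distr L k h)) C"
    and K_tempered: "\<And>i j. tempered (K i j)"
    and K_eq: "\<And>i j f. f \<in> schwartz \<Longrightarrow>
           K i j f = (if i = j then spline_distr L k h f else 0) - C i j f"
    and K_hat_fun: "\<And>i j. \<exists>\<kappa>. is_fun (ft (K i j)) \<kappa>"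
  shows "(\<forall>\<psi>h. is_fun (ft (spline_distr L k h)) \<psi>h \<longrightarrow>
            (\<forall>i j. is_fun (ft (K i j)) (\<lambda>\<omega>. Proj r \<gamma> \<omega> $ i $ j * \<psi>h \<omega>)))
       \<and> (\<forall>l j. \<forall>f\<in>schwartz. (\<Sum>i\<in>UNIV. diff_op (r l) (\<lambda>\<alpha>. \<gamma> l \<alpha> $ i) (-1) (K i j) f) = 0)"
proof -
  let ?u = "spline_distr L k h :: 'd distr"
  let ?A = "\<lambda>l i \<omega>. adj (Psym r \<gamma> \<omega>) $ l $ i"
  have S: "open (- {0 :: real^'d})" by (simp add: open_Compl)
  \<comment> \<open>On Schwartz functions the spline is a diagonal entry of \<open>K\<close> plus the same entry of \<open>C\<close>, hence linear.\<close>
  have u: "schwartz_linear ?u"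
  proof -
    fix i :: 'm
    have "?u f = K i i f + C i i f" if "f \<in> schwartz" for f
      using K_eq[OF that, of i i] by simp
    moreover have "(\<lambda>x. a * f x + b * g x) \<in> schwartz" if "f \<in> schwartz" "g \<in> schwartz" for f g :: "real^'d \<Rightarrow> complex" and a b
      by (intro schwartz_add schwartz_const_mult that)
    ultimately show ?thesis
      using tempered_linear[OF K_tempered[of i i]] tempered_linear[OF C_tempered[of i i]]
      by (simp add: schwartz_linear_def algebra_simps)
  qed
  obtain v where v: "\<And>k j. smooth_on (- {0}) (v k j)"
      "\<And>k j. is_fun_on (- {0}) (ft (PT_minus r \<gamma> ?u k j)) (v k j)"
    and conv: "\<And>i j f. f \<in> test_on (- {0}) \<Longrightarrow>
        ft (C i j) f = (\<Sum>k\<in>UNIV. fmult (v k j) (ft (P_left r \<gamma> \<Phi> i k)) f)"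
    using C_conv unfolding is_conv_def by blast
  obtain \<kappa> where \<kappa>: "\<And>i j. is_fun (ft (K i j)) (\<kappa> i j)"
    using K_hat_fun by metis
  obtain l\<^sub>0 i\<^sub>0 where nz: "AE \<omega> in lborel. ?A l\<^sub>0 i\<^sub>0 \<omega> \<noteq> 0"
    by (rule AE_Psym_adj_nonzero[OF indep])
  have off0: "AE \<omega> in lborel. \<omega> \<noteq> (0 :: real^'d)" by (rule AE_lborel_singleton)
  have off_origin: "AE \<omega> in lborel. \<omega> \<noteq> 0 \<longrightarrow> \<kappa> a b \<omega> * ?A l\<^sub>0 i\<^sub>0 \<omega> = Proj r \<gamma> \<omega> $ a $ b * v l\<^sub>0 i\<^sub>0 \<omega>" for a b
    by (rule kernel_transform_times_symbol[OF u tempered_linear[OF Phi_tempered] Phi_symbol v conv K_eq \<kappa>])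
  have kernel: "AE \<omega> in lborel. \<kappa> a b \<omega> * ?A l\<^sub>0 i\<^sub>0 \<omega> = Proj r \<gamma> \<omega> $ a $ b * v l\<^sub>0 i\<^sub>0 \<omega>" for a b
    using off0 off_origin[of a b] by eventually_elim blast

  \<comment> \<open>The nonzero entry of \<open>P\<^sup>*\<close> cancels from two identities for the same function \<open>v\<close>.\<close>
  have "is_fun (ft (K a b)) (\<lambda>\<omega>. Proj r \<gamma> \<omega> $ a $ b * \<psi>h \<omega>)" if \<psi>h: "is_fun (ft ?u) \<psi>h" for \<psi>h a b
  proof -
    have [measurable]: "\<psi>h \<in> borel_measurable borel"
      by (rule is_fun_on_measurable[OF is_fun_imp_is_fun_on[OF \<psi>h]])
    have [measurable]: "(\<lambda>\<omega>. PGP r \<gamma> \<omega> $ a $ b) \<in> borel_measurable borel"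
      by (rule is_fun_on_measurable[OF Phi_symbol])
    have meas [measurable]: "(\<lambda>\<omega>. Proj r \<gamma> \<omega> $ a $ b * \<psi>h \<omega>) \<in> borel_measurable borel"
      unfolding Proj_def by simp
    let ?d = "\<lambda>\<omega>. v l\<^sub>0 i\<^sub>0 \<omega> - \<psi>h \<omega> * ?A l\<^sub>0 i\<^sub>0 \<omega>"
    have "integrable lborel (\<lambda>x. ?d x * f x) \<and> (LINT x|lborel. ?d x * f x) = 0" if f: "f \<in> test_on (- {0})" for f
    proof -
      have f': "f \<in> schwartz" by (rule test_on_subset_schwartz[OF f])
      have g: "(\<lambda>\<omega>. ?A l\<^sub>0 i\<^sub>0 \<omega> * f \<omega>) \<in> schwartz" by (rule schwartz_mult[OF multiplier_Psym_adj f'])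
      have "integrable lborel (\<lambda>x. v l\<^sub>0 i\<^sub>0 x * f x)" "(LINT x|lborel. v l\<^sub>0 i\<^sub>0 x * f x) = ft ?u (\<lambda>\<omega>. ?A l\<^sub>0 i\<^sub>0 \<omega> * f \<omega>)"
        using v(2)[of l\<^sub>0 i\<^sub>0] f by (auto simp: is_fun_on_def of_fun_def ft_PT_minus[OF u f'])
      moreover have "integrable lborel (\<lambda>x. \<psi>h x * (?A l\<^sub>0 i\<^sub>0 x * f x))"
          "ft ?u (\<lambda>\<omega>. ?A l\<^sub>0 i\<^sub>0 \<omega> * f \<omega>) = (LINT x|lborel. \<psi>h x * (?A l\<^sub>0 i\<^sub>0 x * f x))"
        using \<psi>h g by (auto simp: is_fun_def of_fun_def)
      moreover have "?d x * f x = v l\<^sub>0 i\<^sub>0 x * f x - \<psi>h x * (?A l\<^sub>0 i\<^sub>0 x * f x)" for x by (simp add: algebra_simps)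
      ultimately show ?thesis by simp
    qed
    from AE_zero_if_test_integrals_zero[OF S this] have "AE \<omega> in lborel. \<omega> \<in> - {0} \<longrightarrow> ?d \<omega> = 0" .
    with off0 nz kernel[of a b] have eq: "AE \<omega> in lborel. Proj r \<gamma> \<omega> $ a $ b * \<psi>h \<omega> = \<kappa> a b \<omega>"
    proof eventually_elim
      case (elim \<omega>)
      then have "(Proj r \<gamma> \<omega> $ a $ b * \<psi>h \<omega>) * ?A l\<^sub>0 i\<^sub>0 \<omega> = \<kappa> a b \<omega> * ?A l\<^sub>0 i\<^sub>0 \<omega>" by simp
      with elim(2) show ?case by simp
    qed
    show ?thesis
      unfolding is_fun_def of_fun_def
    proof (intro ballI conjI)
      fix f :: "real^'d \<Rightarrow> complex" assume f: "f \<in> schwartz"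
      note [measurable] = schwartz_measurable[OF f]
      have \<kappa>f: "integrable lborel (\<lambda>x. \<kappa> a b x * f x)" "ft (K a b) f = (LINT x|lborel. \<kappa> a b x * f x)"
        using \<kappa>[of a b] f by (auto simp: is_fun_def of_fun_def)
      have ae: "AE x in lborel. \<kappa> a b x * f x = Proj r \<gamma> x $ a $ b * \<psi>h x * f x"
        using eq by eventually_elim simp
      have m: "(\<lambda>x. Proj r \<gamma> x $ a $ b * \<psi>h x * f x) \<in> borel_measurable lborel"
        using meas by measurable
      show "integrable lborel (\<lambda>x. Proj r \<gamma> x $ a $ b * \<psi>h x * f x)"
        by (rule Bochner_Integration.integrable_cong_AE_imp[OF \<kappa>f(1) m]) (use ae in auto)
      show "ft (K a b) f = (LINT x|lborel. Proj r \<gamma> x $ a $ b * \<psi>h x * f x)"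
        unfolding \<kappa>f(2) using \<kappa>f(1) m ae by (intro integral_cong_AE) auto
    qed
  qed
  moreover have "(\<Sum>i\<in>UNIV. diff_op (r l) (\<lambda>\<alpha>. \<gamma> l \<alpha> $ i) (-1) (K i j) f) = 0" if f: "f \<in> schwartz" for l j f
  proof -
    \<comment> \<open>Surjectivity of the transform moves the whole computation to the frequency side.\<close>
    obtain g where g: "g \<in> schwartz" "fourier g = f" by (rule fourier_surjective[OF f])
    have Ag: "(\<lambda>\<omega>. ?A l i \<omega> * g \<omega>) \<in> schwartz" for i by (rule schwartz_mult[OF multiplier_Psym_adj g(1)])
    have K: "integrable lborel (\<lambda>x. \<kappa> i j x * (?A l i x * g x))"
        "ft (K i j) (\<lambda>\<omega>. ?A l i \<omega> * g \<omega>) = (LINT x|lborel. \<kappa> i j x * (?A l i x * g x))" for i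
      using \<kappa>[of i j] Ag[of i] by (auto simp: is_fun_def of_fun_def)
    have "(\<Sum>i\<in>UNIV. diff_op (r l) (\<lambda>\<alpha>. \<gamma> l \<alpha> $ i) (-1) (K i j) f) = (\<Sum>i\<in>UNIV. ft (K i j) (\<lambda>\<omega>. ?A l i \<omega> * g \<omega>))"
      unfolding g(2)[symmetric] by (intro sum.cong refl diff_op_minus_fourier tempered_linear K_tempered g(1))
    also have "\<dots> = (LINT x|lborel. (\<Sum>i\<in>UNIV. \<kappa> i j x * (?A l i x * g x)))"
      by (subst Bochner_Integration.integral_sum) (simp_all add: K)
    also have "\<dots> = (LINT x|(lborel :: (real^'d) measure). 0)"
    proof (rule integral_cong_AE)
      have "AE \<omega> in lborel. \<forall>i. \<kappa> i j \<omega> * ?A l\<^sub>0 i\<^sub>0 \<omega> = Proj r \<gamma> \<omega> $ i $ j * v l\<^sub>0 i\<^sub>0 \<omega>"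
        using kernel by (intro eventually_all_finite)
      with nz show "AE x in lborel. (\<Sum>i\<in>UNIV. \<kappa> i j x * (?A l i x * g x)) = 0"
      proof eventually_elim
        case (elim \<omega>)
        have "(\<Sum>i\<in>UNIV. \<kappa> i j \<omega> * (?A l i \<omega> * g \<omega>)) * ?A l\<^sub>0 i\<^sub>0 \<omega>
            = (\<Sum>i\<in>UNIV. (\<kappa> i j \<omega> * ?A l\<^sub>0 i\<^sub>0 \<omega>) * (?A l i \<omega> * g \<omega>))"
          by (subst sum_distrib_right) (simp add: mult_ac)
        also have "\<dots> = (\<Sum>i\<in>UNIV. ?A l i \<omega> * Proj r \<gamma> \<omega> $ i $ j) * (v l\<^sub>0 i\<^sub>0 \<omega> * g \<omega>)"
          using elim(2) by (subst sum_distrib_right) (simp add: mult_ac)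
        finally show ?case using elim(1) by (simp add: adj_Psym_Proj_nth)
      qed
    qed (use borel_measurable_integrable[OF K(1)] in auto)
    finally show ?thesis by simp
  qed
  ultimately show ?thesis by blast
qed

end
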